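(* Let $M$ be a hyperkähler manifold with $\dim_{\mathbb C}M=n>2$, let $I$ be an induced complex structure, and let $\omega=\omega_I$ be the Kähler form of $(M,I)$. Let $(B,\nabla)$ be a holomorphic Hermitian vector bundle on $(M,I)$ with a hyperholomorphic connection, $\Theta$ its curvature, and let $$r_2:=\frac{1}{4\pi^2}\,\mathrm{Tr}(\Theta\wedge\Theta)$$ be the corresponding real $4$-form. Then the $(n-1,n-1)$-form $r_2\wedge\omega^{n-3}$ on $(M,I)$ is positive.
   Context: A hyperkähler manifold is a Riemannian manifold $(M,g)$ with three complex structures $I,J,K$ such that $g$ is Kähler with respect to each of them and $I\circ J=-J\circ I=K$ on $TM$. An induced complex structure is one given by a quaternion $L=aI+bJ+cK$ with real constants satisfying $a^2+b^2+c^2=1$; $(M,L)$ denotes the resulting Kähler manifold, with Kähler form $\omega_L(x,y)=g(Lx,y)$. The group $SU(2)$, identified with the unit quaternions, acts on $TM$ and, by multiplicativity, on differential forms; on forms with coefficients in a bundle it acts on the form part only. A connection $\nabla$ on a Hermitian vector bundle $B$ over $M$ is hyperholomorphic if it is Hermitian and its curvature is $SU(2)$-invariant; here it is also compatible with the given holomorphic structure of $B$ on $(M,I)$. A real $(p,p)$-form $\eta$ on a complex manifold is positive if $(-\sqrt{-1})^p\,\eta(\alpha_1,\bar\alpha_1,\dots,\alpha_p,\bar\alpha_p)\ge 0$ for all $(1,0)$-vector fields $\alpha_1,\dots,\alpha_p$ (so that $\sqrt{-1}\,z\wedge\bar z$ is positive for every $(1,0)$-form $z$). *)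

theory Defs
  imports "HOL-Analysis.Analysis"
begin

section \<open>Smooth manifolds\<close>

text \<open>The set \<open>S\<close> is meant to be open in the following two definitions.\<close>

fun Ck_on :: "nat \<Rightarrow> ('a::euclidean_space \<Rightarrow> 'b::real_normed_vector) \<Rightarrow> 'a set \<Rightarrow> bool" where
  "Ck_on 0 f S \<longleftrightarrow> continuous_on S f"
| "Ck_on (Suc k) f S \<longleftrightarrow>
     (\<forall>x\<in>S. f differentiable (at x)) \<and> (\<forall>v. Ck_on k (\<lambda>x. frechet_derivative f (at x) v) S)"

definition smooth_on :: "('a::euclidean_space \<Rightarrow> 'b::real_normed_vector) \<Rightarrow> 'a set \<Rightarrow> bool" where
  "smooth_on f S \<longleftrightarrow> (\<forall>k. Ck_on k f S)"

text \<open>A chart is a pair of its domain and its coordinate map; coordinates live in a Euclidean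
  space \<open>'e\<close>, of which only the real structure matters here.\<close>

type_synonym ('m, 'e) chart = "'m set \<times> ('m \<Rightarrow> 'e)"

record ('m, 'e) manifold =
  topo :: "'m topology"
  atlas :: "('m, 'e) chart set"

definition chart_inv :: "('m, 'e) chart \<Rightarrow> 'e \<Rightarrow> 'm" where
  "chart_inv c = inv_into (fst c) (snd c)"

definition is_chart :: "'m topology \<Rightarrow> ('m, 'e::euclidean_space) chart \<Rightarrow> bool" where
  "is_chart X c \<longleftrightarrow> openin X (fst c) \<and> open (snd c ` fst c) \<and>
     homeomorphic_map (subtopology X (fst c)) (top_of_set (snd c ` fst c)) (snd c)"

definition smoothly_compatible ::
    "('m, 'e::euclidean_space) chart \<Rightarrow> ('m, 'e) chart \<Rightarrow> bool" where
  "smoothly_compatible c d \<longleftrightarrow>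
     smooth_on (snd d \<circ> chart_inv c) (snd c ` (fst c \<inter> fst d)) \<and>
     smooth_on (snd c \<circ> chart_inv d) (snd d ` (fst c \<inter> fst d))"

definition smooth_manifold :: "('m, 'e::euclidean_space) manifold \<Rightarrow> bool" where
  "smooth_manifold M \<longleftrightarrow>
     Hausdorff_space (topo M) \<and> second_countable (topo M) \<and>
     (\<forall>c\<in>atlas M. is_chart (topo M) c) \<and>
     (\<Union>c\<in>atlas M. fst c) = topspace (topo M) \<and>
     (\<forall>c\<in>atlas M. \<forall>d\<in>atlas M. smoothly_compatible c d)"

definition smooth_fun ::
    "('m, 'e::euclidean_space) manifold \<Rightarrow> ('m \<Rightarrow> 'b::real_normed_vector) \<Rightarrow> 'm set \<Rightarrow> bool" where
  "smooth_fun M f U \<longleftrightarrow> (\<forall>c\<in>atlas M. smooth_on (f \<circ> chart_inv c) (snd c ` (fst c \<inter> U)))"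

text \<open>The tangent space \<open>T\<^sub>pM\<close> is represented by the coordinate space \<open>'e\<close>, through the
  differential of a chart chosen once and for all at \<open>p\<close>. The choice need not depend continuously
  on \<open>p\<close>, so statements about neighbouring tangent spaces go through \<open>differential\<close>.\<close>

definition chart_at :: "('m, 'e) manifold \<Rightarrow> 'm \<Rightarrow> ('m, 'e) chart" where
  "chart_at M p = (SOME c. c \<in> atlas M \<and> p \<in> fst c)"

text \<open>\<open>differential M f p u\<close> is \<open>df\<^sub>p(u)\<close>. If \<open>c\<close> is a chart around \<open>p\<close>, then
  \<open>differential M (snd c) p\<close> maps a tangent vector to its components with respect to \<open>c\<close>.\<close>

definition differential ::
    "('m, 'e::euclidean_space) manifold \<Rightarrow> ('m \<Rightarrow> 'b::real_normed_vector) \<Rightarrow> 'm \<Rightarrow> 'e \<Rightarrow> 'b" where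
  "differential M f p u =
     frechet_derivative (f \<circ> chart_inv (chart_at M p)) (at (snd (chart_at M p) p)) u"

definition smooth_vector_field ::
    "('m, 'e::euclidean_space) manifold \<Rightarrow> ('m \<Rightarrow> 'e) \<Rightarrow> 'm set \<Rightarrow> bool" where
  "smooth_vector_field M X U \<longleftrightarrow>
     (\<forall>c\<in>atlas M. smooth_fun M (\<lambda>p. differential M (snd c) p (X p)) (U \<inter> fst c))"

text \<open>The usual formula \<open>[X,Y]\<^sup>k = X(Y\<^sup>k) - Y(X\<^sup>k)\<close> in the chart chosen at \<open>p\<close>. With respect to
  that chart \<open>T\<^sub>pM\<close> is identified with \<open>'e\<close> by the identity.\<close>

definition lie_bracket ::
    "('m, 'e::euclidean_space) manifold \<Rightarrow> ('m \<Rightarrow> 'e) \<Rightarrow> ('m \<Rightarrow> 'e) \<Rightarrow> 'm \<Rightarrow> 'e" where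
  "lie_bracket M X Y p =
     (let \<phi> = snd (chart_at M p) in
        differential M (\<lambda>q. differential M \<phi> q (Y q)) p (X p) -
        differential M (\<lambda>q. differential M \<phi> q (X q)) p (Y p))"


section \<open>Kaehler and hyperkaehler manifolds\<close>

definition riemannian_metric ::
    "('m, 'e::euclidean_space) manifold \<Rightarrow> ('m \<Rightarrow> 'e \<Rightarrow> 'e \<Rightarrow> real) \<Rightarrow> bool" where
  "riemannian_metric M g \<longleftrightarrow>
     (\<forall>p\<in>topspace (topo M). bilinear (g p) \<and> (\<forall>u v. g p u v = g p v u) \<and>
        (\<forall>u. u \<noteq> 0 \<longrightarrow> g p u u > 0)) \<and>
     (\<forall>U X Y. openin (topo M) U \<longrightarrow> smooth_vector_field M X U \<longrightarrow> smooth_vector_field M Y U \<longrightarrow>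
        smooth_fun M (\<lambda>p. g p (X p) (Y p)) U)"

definition almost_complex_structure ::
    "('m, 'e::euclidean_space) manifold \<Rightarrow> ('m \<Rightarrow> 'e \<Rightarrow> 'e) \<Rightarrow> bool" where
  "almost_complex_structure M I \<longleftrightarrow>
     (\<forall>p\<in>topspace (topo M). linear (I p) \<and> (\<forall>u. I p (I p u) = - u)) \<and>
     (\<forall>U X. openin (topo M) U \<longrightarrow> smooth_vector_field M X U \<longrightarrow>
        smooth_vector_field M (\<lambda>p. I p (X p)) U)"

text \<open>Integrability is the existence of holomorphic coordinates: charts of the smooth manifold
  whose differential carries \<open>I\<close> to multiplication by \<open>\<i>\<close> on \<open>\<complex>\<^sup>n\<close>. For this the
  coordinate space \<open>\<real>\<^sup>2\<^sup>n\<close> is taken to be the real vector space underlying \<open>\<complex>\<^sup>n\<close>, so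
  that \<open>CARD('n)\<close> is the complex dimension; the charts in \<open>atlas M\<close> themselves are merely smooth.\<close>

definition complex_structure ::
    "('m, complex^'n) manifold \<Rightarrow> ('m \<Rightarrow> complex^'n \<Rightarrow> complex^'n) \<Rightarrow> bool" where
  "complex_structure M I \<longleftrightarrow> almost_complex_structure M I \<and>
     (\<forall>p\<in>topspace (topo M). \<exists>c. is_chart (topo M) c \<and> (\<forall>d\<in>atlas M. smoothly_compatible c d) \<and>
        p \<in> fst c \<and>
        (\<forall>q\<in>fst c. \<forall>u. differential M (snd c) q (I q u) = \<i> *s differential M (snd c) q u))"

text \<open>\<open>d\<omega> = 0\<close>, through the coordinate-free formula for \<open>d\<omega>(X,Y,Z)\<close>.\<close>

definition closed_2form ::
    "('m, 'e::euclidean_space) manifold \<Rightarrow> ('m \<Rightarrow> 'e \<Rightarrow> 'e \<Rightarrow> real) \<Rightarrow> bool" where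
  "closed_2form M \<omega> \<longleftrightarrow>
     (\<forall>U X Y Z. openin (topo M) U \<longrightarrow>
        smooth_vector_field M X U \<longrightarrow> smooth_vector_field M Y U \<longrightarrow> smooth_vector_field M Z U \<longrightarrow>
        (\<forall>p\<in>U. differential M (\<lambda>q. \<omega> q (Y q) (Z q)) p (X p)
             - differential M (\<lambda>q. \<omega> q (X q) (Z q)) p (Y p)
             + differential M (\<lambda>q. \<omega> q (X q) (Y q)) p (Z p)
             - \<omega> p (lie_bracket M X Y p) (Z p)
             + \<omega> p (lie_bracket M X Z p) (Y p)
             - \<omega> p (lie_bracket M Y Z p) (X p) = 0))"

definition kaehler_form ::
    "('m \<Rightarrow> 'e \<Rightarrow> 'e \<Rightarrow> real) \<Rightarrow> ('m \<Rightarrow> 'e \<Rightarrow> 'e) \<Rightarrow> 'm \<Rightarrow> 'e \<Rightarrow> 'e \<Rightarrow> real" where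
  "kaehler_form g I p u v = g p (I p u) v"

definition kaehler ::
    "('m, complex^'n) manifold \<Rightarrow> ('m \<Rightarrow> complex^'n \<Rightarrow> complex^'n \<Rightarrow> real) \<Rightarrow>
     ('m \<Rightarrow> complex^'n \<Rightarrow> complex^'n) \<Rightarrow> bool" where
  "kaehler M g I \<longleftrightarrow> riemannian_metric M g \<and> complex_structure M I \<and>
     (\<forall>p\<in>topspace (topo M). \<forall>u v. g p (I p u) (I p v) = g p u v) \<and>
     closed_2form M (kaehler_form g I)"

definition hyperkaehler ::
    "('m, complex^'n) manifold \<Rightarrow> ('m \<Rightarrow> complex^'n \<Rightarrow> complex^'n \<Rightarrow> real) \<Rightarrow>
     ('m \<Rightarrow> complex^'n \<Rightarrow> complex^'n) \<Rightarrow> ('m \<Rightarrow> complex^'n \<Rightarrow> complex^'n) \<Rightarrow>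
     ('m \<Rightarrow> complex^'n \<Rightarrow> complex^'n) \<Rightarrow> bool" where
  "hyperkaehler M g I J K \<longleftrightarrow> smooth_manifold M \<and>
     kaehler M g I \<and> kaehler M g J \<and> kaehler M g K \<and>
     (\<forall>p\<in>topspace (topo M). \<forall>u. I p (J p u) = K p u \<and> J p (I p u) = - K p u)"

definition quaternion_action ::
    "('m \<Rightarrow> 'e \<Rightarrow> 'e::real_vector) \<Rightarrow> ('m \<Rightarrow> 'e \<Rightarrow> 'e) \<Rightarrow> ('m \<Rightarrow> 'e \<Rightarrow> 'e) \<Rightarrow>
     real \<Rightarrow> real \<Rightarrow> real \<Rightarrow> real \<Rightarrow> 'm \<Rightarrow> 'e \<Rightarrow> 'e" where
  "quaternion_action I J K t a b c p u =
     t *\<^sub>R u + a *\<^sub>R I p u + b *\<^sub>R J p u + c *\<^sub>R K p u"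

definition induced_complex_structure ::
    "('m \<Rightarrow> 'e \<Rightarrow> 'e::real_vector) \<Rightarrow> ('m \<Rightarrow> 'e \<Rightarrow> 'e) \<Rightarrow> ('m \<Rightarrow> 'e \<Rightarrow> 'e) \<Rightarrow>
     ('m \<Rightarrow> 'e \<Rightarrow> 'e) \<Rightarrow> bool" where
  "induced_complex_structure I J K L \<longleftrightarrow>
     (\<exists>a b c. a\<^sup>2 + b\<^sup>2 + c\<^sup>2 = 1 \<and> L = quaternion_action I J K 0 a b c)"


section \<open>Holomorphic Hermitian vector bundles and connections\<close>

text \<open>Every fibre of the bundle \<open>B\<close> of rank \<open>CARD('r)\<close> is a copy of \<open>\<complex>\<^sup>r\<close>. Fibres over different
  points are related only through local trivializations \<open>(U, e)\<close>, where for \<open>p \<in> U\<close> the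
  invertible matrix \<open>e p\<close> is the isomorphism \<open>B\<^sub>p \<rightarrow> \<complex>\<^sup>r\<close>. Up to isomorphism every bundle
  is of this form (choose a basis of each fibre). A section is a function into \<open>\<complex>\<^sup>r\<close>.\<close>

type_synonym ('m, 'r) trivialization = "'m set \<times> ('m \<Rightarrow> complex^'r^'r)"

text \<open>Holomorphic on \<open>(M, L)\<close>.\<close>

definition holomorphic_fun ::
    "('m, 'e::euclidean_space) manifold \<Rightarrow> ('m \<Rightarrow> 'e \<Rightarrow> 'e) \<Rightarrow> ('m \<Rightarrow> complex) \<Rightarrow> 'm set \<Rightarrow> bool" where
  "holomorphic_fun M L f U \<longleftrightarrow> smooth_fun M f U \<and>
     (\<forall>p\<in>U. \<forall>u. differential M f p (L p u) = \<i> * differential M f p u)"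

definition holomorphic_vector_bundle ::
    "('m, 'e::euclidean_space) manifold \<Rightarrow> ('m \<Rightarrow> 'e \<Rightarrow> 'e) \<Rightarrow> ('m, 'r::finite) trivialization set \<Rightarrow> bool" where
  "holomorphic_vector_bundle M L T \<longleftrightarrow>
     (\<forall>(U, e)\<in>T. openin (topo M) U \<and> (\<forall>p\<in>U. invertible (e p))) \<and>
     (\<Union>(U, e)\<in>T. U) = topspace (topo M) \<and>
     (\<forall>(U, e)\<in>T. \<forall>(V, f)\<in>T. \<forall>i j.
        holomorphic_fun M L (\<lambda>p. (f p ** matrix_inv (e p)) $ i $ j) (U \<inter> V))"

definition smooth_section ::
    "('m, 'e::euclidean_space) manifold \<Rightarrow> ('m, 'r::finite) trivialization set \<Rightarrow>
     ('m \<Rightarrow> complex^'r) \<Rightarrow> 'm set \<Rightarrow> bool" where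
  "smooth_section M T s U \<longleftrightarrow> (\<forall>(V, e)\<in>T. smooth_fun M (\<lambda>p. e p *v s p) (U \<inter> V))"

definition holomorphic_section ::
    "('m, 'e::euclidean_space) manifold \<Rightarrow> ('m \<Rightarrow> 'e \<Rightarrow> 'e) \<Rightarrow> ('m, 'r::finite) trivialization set \<Rightarrow>
     ('m \<Rightarrow> complex^'r) \<Rightarrow> 'm set \<Rightarrow> bool" where
  "holomorphic_section M L T s U \<longleftrightarrow>
     (\<forall>(V, e)\<in>T. \<forall>i. holomorphic_fun M L (\<lambda>p. (e p *v s p) $ i) (U \<inter> V))"

definition hermitian_metric ::
    "('m, 'e::euclidean_space) manifold \<Rightarrow> ('m, 'r::finite) trivialization set \<Rightarrow>
     ('m \<Rightarrow> complex^'r \<Rightarrow> complex^'r \<Rightarrow> complex) \<Rightarrow> bool" where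
  "hermitian_metric M T h \<longleftrightarrow>
     (\<forall>p\<in>topspace (topo M).
        (\<forall>x y z a. h p (a *s x + y) z = a * h p x z + h p y z) \<and>
        (\<forall>x y. h p y x = cnj (h p x y)) \<and>
        (\<forall>x. x \<noteq> 0 \<longrightarrow> Re (h p x x) > 0)) \<and>
     (\<forall>U s t. openin (topo M) U \<longrightarrow> smooth_section M T s U \<longrightarrow> smooth_section M T t U \<longrightarrow>
        smooth_fun M (\<lambda>p. h p (s p) (t p)) U)"

text \<open>A connection acts on local smooth sections: \<open>nabla s p u\<close> is \<open>(\<nabla>\<^sub>u s)(p)\<close>. As sections are
  total functions, of which only the values on \<open>U\<close> are relevant, compatibility with restriction
  to open subsets is the last clause.\<close>

type_synonym ('m, 'e, 'r) connection = "('m \<Rightarrow> complex^'r) \<Rightarrow> 'm \<Rightarrow> 'e \<Rightarrow> complex^'r"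

definition connection ::
    "('m, 'e::euclidean_space) manifold \<Rightarrow> ('m, 'r::finite) trivialization set \<Rightarrow>
     ('m, 'e, 'r) connection \<Rightarrow> bool" where
  "connection M T nabla \<longleftrightarrow>
     (\<forall>U s. openin (topo M) U \<longrightarrow> smooth_section M T s U \<longrightarrow>
        (\<forall>p\<in>U. linear (nabla s p)) \<and>
        (\<forall>X. smooth_vector_field M X U \<longrightarrow> smooth_section M T (\<lambda>p. nabla s p (X p)) U) \<and>
        (\<forall>t. smooth_section M T t U \<longrightarrow>
           (\<forall>p\<in>U. \<forall>u. nabla (\<lambda>q. s q + t q) p u = nabla s p u + nabla t p u)) \<and>
        (\<forall>f::'m \<Rightarrow> complex. smooth_fun M f U \<longrightarrow>
           (\<forall>p\<in>U. \<forall>u. nabla (\<lambda>q. f q *s s q) p u =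
                      differential M f p u *s s p + f p *s nabla s p u)) \<and>
        (\<forall>t. (\<forall>q\<in>U. t q = s q) \<longrightarrow> (\<forall>p\<in>U. nabla t p = nabla s p)))"

definition hermitian_connection ::
    "('m, 'e::euclidean_space) manifold \<Rightarrow> ('m, 'r::finite) trivialization set \<Rightarrow>
     ('m \<Rightarrow> complex^'r \<Rightarrow> complex^'r \<Rightarrow> complex) \<Rightarrow> ('m, 'e, 'r) connection \<Rightarrow> bool" where
  "hermitian_connection M T h nabla \<longleftrightarrow> connection M T nabla \<and>
     (\<forall>U s t. openin (topo M) U \<longrightarrow> smooth_section M T s U \<longrightarrow> smooth_section M T t U \<longrightarrow>
        (\<forall>p\<in>U. \<forall>u. differential M (\<lambda>q. h q (s q) (t q)) p u =
                   h p (nabla s p u) (t p) + h p (s p) (nabla t p u)))"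

text \<open>\<open>\<nabla>\<^sup>0\<^sup>,\<^sup>1\<close> is the operator \<open>\<partial>\<close>-bar of \<open>B\<close>, that is, \<open>\<nabla>\<^sup>0\<^sup>,\<^sup>1\<close> annihilates local holomorphic
  sections. On the (0,1)-vector \<open>u + \<i> L u\<close> this reads \<open>\<nabla>\<^sub>u s + \<i> \<nabla>\<^sub>L\<^sub>u s = 0\<close>.\<close>

definition compatible_with_holomorphic_structure ::
    "('m, 'e::euclidean_space) manifold \<Rightarrow> ('m \<Rightarrow> 'e \<Rightarrow> 'e) \<Rightarrow> ('m, 'r::finite) trivialization set \<Rightarrow>
     ('m, 'e, 'r) connection \<Rightarrow> bool" where
  "compatible_with_holomorphic_structure M L T nabla \<longleftrightarrow>
     (\<forall>U s. openin (topo M) U \<longrightarrow> holomorphic_section M L T s U \<longrightarrow>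
        (\<forall>p\<in>U. \<forall>u. nabla s p (L p u) = \<i> *s nabla s p u))"

text \<open>\<open>\<Theta>\<close> is the curvature of the connection:
  \<open>\<Theta>(X,Y)s = \<nabla>\<^sub>X\<nabla>\<^sub>Ys - \<nabla>\<^sub>Y\<nabla>\<^sub>Xs - \<nabla>\<^sub>[\<^sub>X\<^sub>,\<^sub>Y\<^sub>]s\<close>.
  This determines the values of \<open>\<Theta>\<close> at all points of \<open>M\<close>, since the right-hand side is
  tensorial.\<close>

definition curvature_form ::
    "('m, 'e::euclidean_space) manifold \<Rightarrow> ('m, 'r::finite) trivialization set \<Rightarrow>
     ('m, 'e, 'r) connection \<Rightarrow> ('m \<Rightarrow> 'e \<Rightarrow> 'e \<Rightarrow> complex^'r^'r) \<Rightarrow> bool" where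
  "curvature_form M T nabla \<Theta> \<longleftrightarrow>
     (\<forall>U X Y s. openin (topo M) U \<longrightarrow>
        smooth_vector_field M X U \<longrightarrow> smooth_vector_field M Y U \<longrightarrow> smooth_section M T s U \<longrightarrow>
        (\<forall>p\<in>U. \<Theta> p (X p) (Y p) *v s p =
           nabla (\<lambda>q. nabla s q (Y q)) p (X p) - nabla (\<lambda>q. nabla s q (X q)) p (Y p)
           - nabla s p (lie_bracket M X Y p)))"

text \<open>\<open>SU(2)\<close> is the group of unit quaternions; it acts on the form part only.\<close>

definition su2_invariant_2form ::
    "('m, 'e::euclidean_space) manifold \<Rightarrow>
     ('m \<Rightarrow> 'e \<Rightarrow> 'e) \<Rightarrow> ('m \<Rightarrow> 'e \<Rightarrow> 'e) \<Rightarrow> ('m \<Rightarrow> 'e \<Rightarrow> 'e) \<Rightarrow>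
     ('m \<Rightarrow> 'e \<Rightarrow> 'e \<Rightarrow> 'c) \<Rightarrow> bool" where
  "su2_invariant_2form M I J K \<Theta> \<longleftrightarrow>
     (\<forall>p\<in>topspace (topo M). \<forall>t a b c. t\<^sup>2 + a\<^sup>2 + b\<^sup>2 + c\<^sup>2 = 1 \<longrightarrow>
        (\<forall>u v. \<Theta> p (quaternion_action I J K t a b c p u) (quaternion_action I J K t a b c p v) =
               \<Theta> p u v))"

definition hyperholomorphic_connection ::
    "('m, 'e::euclidean_space) manifold \<Rightarrow>
     ('m \<Rightarrow> 'e \<Rightarrow> 'e) \<Rightarrow> ('m \<Rightarrow> 'e \<Rightarrow> 'e) \<Rightarrow> ('m \<Rightarrow> 'e \<Rightarrow> 'e) \<Rightarrow>
     ('m, 'r::finite) trivialization set \<Rightarrow>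
     ('m \<Rightarrow> complex^'r \<Rightarrow> complex^'r \<Rightarrow> complex) \<Rightarrow> ('m, 'e, 'r) connection \<Rightarrow> bool" where
  "hyperholomorphic_connection M I J K T h nabla \<longleftrightarrow> hermitian_connection M T h nabla \<and>
     (\<forall>\<Theta>. curvature_form M T nabla \<Theta> \<longrightarrow> su2_invariant_2form M I J K \<Theta>)"


section \<open>Exterior algebra\<close>

text \<open>A \<open>k\<close>-form at a point is a function of a sequence \<open>v\<close> of tangent vectors that depends on
  \<open>v 0, \<dots>, v (k - 1)\<close> only. In \<open>wedge_by m k l\<close>, \<open>m\<close> multiplies the values of a \<open>k\<close>-form
  with those of an \<open>l\<close>-form; the normalization is the one for which
  \<open>(\<alpha> \<and> \<beta>)(v, w) = \<alpha>(v)\<beta>(w) - \<alpha>(w)\<beta>(v)\<close> for 1-forms.\<close>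

definition wedge_by ::
    "('a \<Rightarrow> 'b \<Rightarrow> 'c::real_vector) \<Rightarrow> nat \<Rightarrow> nat \<Rightarrow>
     ((nat \<Rightarrow> 'e) \<Rightarrow> 'a) \<Rightarrow> ((nat \<Rightarrow> 'e) \<Rightarrow> 'b) \<Rightarrow> (nat \<Rightarrow> 'e) \<Rightarrow> 'c" where
  "wedge_by m k l \<alpha> \<beta> v =
     (1 / (fact k * fact l)) *\<^sub>R
     (\<Sum>\<sigma> | \<sigma> permutes {..<k + l}.
        of_int (sign \<sigma>) *\<^sub>R m (\<alpha> (\<lambda>i. v (\<sigma> i))) (\<beta> (\<lambda>i. v (\<sigma> (k + i)))))"

abbreviation wedge ::
    "nat \<Rightarrow> nat \<Rightarrow> ((nat \<Rightarrow> 'e) \<Rightarrow> complex) \<Rightarrow> ((nat \<Rightarrow> 'e) \<Rightarrow> complex) \<Rightarrow> (nat \<Rightarrow> 'e) \<Rightarrow> complex" where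
  "wedge \<equiv> wedge_by (*)"

fun wedge_power_2form :: "((nat \<Rightarrow> 'e) \<Rightarrow> complex) \<Rightarrow> nat \<Rightarrow> (nat \<Rightarrow> 'e) \<Rightarrow> complex" where
  "wedge_power_2form \<omega> 0 = (\<lambda>_. 1)"
| "wedge_power_2form \<omega> (Suc m) = wedge 2 (2 * m) \<omega> (wedge_power_2form \<omega> m)"

definition form2 :: "('e \<Rightarrow> 'e \<Rightarrow> 'c) \<Rightarrow> (nat \<Rightarrow> 'e) \<Rightarrow> 'c" where
  "form2 \<beta> v = \<beta> (v 0) (v 1)"

definition r2_form ::
    "('m \<Rightarrow> 'e \<Rightarrow> 'e \<Rightarrow> complex^'r^'r) \<Rightarrow> 'm \<Rightarrow> (nat \<Rightarrow> 'e) \<Rightarrow> complex" where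
  "r2_form \<Theta> p v =
     1 / (4 * of_real pi ^ 2) * trace (wedge_by (**) 2 2 (form2 (\<Theta> p)) (form2 (\<Theta> p)) v)"

text \<open>An element \<open>(a, b)\<close> of \<open>'e \<times> 'e\<close> stands for the complexified tangent vector \<open>a + \<i> b\<close>, and
  \<open>complexify k \<eta>\<close> is the complex multilinear extension of the \<open>k\<close>-form \<open>\<eta>\<close>.\<close>

definition complexify ::
    "nat \<Rightarrow> ((nat \<Rightarrow> 'e) \<Rightarrow> complex) \<Rightarrow> (nat \<Rightarrow> 'e \<times> 'e) \<Rightarrow> complex" where
  "complexify k \<eta> w =
     (\<Sum>S\<in>Pow {..<k}. \<i> ^ card S * \<eta> (\<lambda>j. if j \<in> S then snd (w j) else fst (w j)))"

definition conj_vec :: "'e \<times> 'e::ab_group_add \<Rightarrow> 'e \<times> 'e" where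
  "conj_vec w = (fst w, - snd w)"

text \<open>\<open>L(a + \<i> b) = \<i> (a + \<i> b)\<close>\<close>

definition type_10 :: "('e \<Rightarrow> 'e::ab_group_add) \<Rightarrow> 'e \<times> 'e \<Rightarrow> bool" where
  "type_10 L w \<longleftrightarrow> L (fst w) = - snd w \<and> L (snd w) = fst w"

definition type_01 :: "('e \<Rightarrow> 'e::ab_group_add) \<Rightarrow> 'e \<times> 'e \<Rightarrow> bool" where
  "type_01 L w \<longleftrightarrow> type_10 L (conj_vec w)"

definition real_form :: "((nat \<Rightarrow> 'e) \<Rightarrow> complex) \<Rightarrow> bool" where
  "real_form \<eta> \<longleftrightarrow> (\<forall>v. \<eta> v \<in> \<real>)"

text \<open>A \<open>2p\<close>-form of type \<open>(p,p)\<close> vanishes on vectors of pure type unless exactly \<open>p\<close> of them are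
  of type (1,0).\<close>

definition pp_form :: "('e \<Rightarrow> 'e::ab_group_add) \<Rightarrow> nat \<Rightarrow> ((nat \<Rightarrow> 'e) \<Rightarrow> complex) \<Rightarrow> bool" where
  "pp_form L p \<eta> \<longleftrightarrow>
     (\<forall>S w. S \<subseteq> {..<2 * p} \<longrightarrow> card S \<noteq> p \<longrightarrow>
        (\<forall>j\<in>S. type_10 L (w j)) \<longrightarrow> (\<forall>j\<in>{..<2 * p} - S. type_01 L (w j)) \<longrightarrow>
        complexify (2 * p) \<eta> w = 0)"

definition positive_form ::
    "('m, 'e::euclidean_space) manifold \<Rightarrow> ('m \<Rightarrow> 'e \<Rightarrow> 'e) \<Rightarrow> nat \<Rightarrow>
     ('m \<Rightarrow> (nat \<Rightarrow> 'e) \<Rightarrow> complex) \<Rightarrow> bool" where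
  "positive_form M L p \<eta> \<longleftrightarrow>
     (\<forall>x\<in>topspace (topo M). real_form (\<eta> x) \<and> pp_form (L x) p (\<eta> x) \<and>
        (\<forall>\<alpha>. (\<forall>j<p. type_10 (L x) (\<alpha> j)) \<longrightarrow>
           (- \<i>) ^ p * complexify (2 * p) (\<eta> x)
              (\<lambda>j. if even j then \<alpha> (j div 2) else conj_vec (\<alpha> (j div 2))) \<in> \<real>\<^sub>\<ge>\<^sub>0))"

end

theory Submission
  imports Defs
begin

text \<open>
  Positivity is a condition at each point \<open>p\<close>. There the data are linear algebra: the tangent space
  \<open>V\<close> of real dimension \<open>2n\<close> with a Euclidean metric \<open>g\<close> and an isometric action of the quaternions, and
  an \<open>SU(2)\<close>-invariant 2-form \<open>\<Theta>\<close> on \<open>V\<close>. Its values are skew-Hermitian endomorphisms of the fibre,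
  because the second derivatives of the function \<open>h(s,t)\<close> commute (\<open>curvature_skew_hermitian\<close>). On
  skew-Hermitian matrices \<open>\<langle>X,Y\<rangle> = - Tr(XY)\<close> is real and positive semidefinite, and
  \<open>r\<^sub>2 = - \<langle>\<Theta>\<and>\<Theta>\<rangle>/4\<pi>\<^sup>2\<close>.

  For a vector \<open>\<alpha> = u - \<i> L u\<close> of type (1,0), \<open>\<alpha> \<and> \<alpha>\<close>-bar is \<open>2\<i> u \<and> L u\<close>. Positivity of
  \<open>\<eta> = r\<^sub>2 \<and> \<omega>\<^sup>n\<^sup>-\<^sup>3\<close> therefore says that \<open>\<eta>(u\<^sub>1,Lu\<^sub>1,u\<^sub>2,Lu\<^sub>2,\<dots>) \<ge> 0\<close> for all \<open>n - 1\<close> real vectors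
  \<open>u\<^sub>j\<close> (\<open>complexify_conjugate_pairs\<close>). A Gram-Schmidt step over \<open>\<complex>\<close> changes this value only by the square of a
  real factor, so it suffices to take a unitary family \<open>e\<^sub>1,\<dots>,e\<^sub>n\<^sub>-\<^sub>1\<close>
  (\<open>nonneg_on_frames_imp_nonneg\<close>). On such a family \<open>\<omega>\<^sup>n\<^sup>-\<^sup>3\<close> is nonzero only on pairs
  \<open>e\<^sub>j,Le\<^sub>j\<close>, and \<open>\<eta>\<close> takes a positive multiple of the value

    \<open>\<Sum>\<^sub>j\<^sub>k (\<bar>\<Theta>(e\<^sub>j,Le\<^sub>k)\<bar>\<^sup>2 + \<bar>\<Theta>(e\<^sub>j,e\<^sub>k)\<bar>\<^sup>2) - \<bar>\<Sum>\<^sub>j \<Theta>(e\<^sub>j,Le\<^sub>j)\<bar>\<^sup>2\<close>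

  (\<open>alternate_power_on_frame\<close>, \<open>alternate_4_curvature_symmetric\<close>). That this is nonnegative is
  \<open>unitary_curvature_inequality\<close>, where the invariance under the whole of \<open>SU(2)\<close> enters. Let \<open>\<xi>\<close> be
  a unit vector that completes the family to a unitary frame of \<open>V\<close>, and let \<open>R\<close> be an induced complex
  structure that anticommutes with \<open>L\<close>. As \<open>R\<close> changes the sign of \<open>\<Theta>(u,Lu)\<close>, the sum of
  \<open>\<Theta>(e,Le)\<close> over a unitary frame of \<open>V\<close> is zero, and the sum over the family is
  \<open>- \<Theta>(\<xi>,L\<xi>) = \<Theta>(R\<xi>,LR\<xi>)\<close>. Now \<open>R\<xi>\<close> is a unit vector orthogonal to \<open>\<xi>\<close> and
  \<open>L\<xi>\<close>, so it lies in the complex span of the family, and the inequality is Cauchy-Schwarz. The vanishing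
  of the trace alone would not do: a Hermitian form with eigenvalues 2, -1, -1 has trace zero, and for
  \<open>e\<^sub>1,e\<^sub>2\<close> in its \<open>-1\<close>-eigenspace the two sides would be \<open>2\<close> and \<open>4\<close>.
  What \<open>R\<close> adds is that the eigenvalues come in pairs \<open>\<lambda>, -\<lambda>\<close>.

  The form \<open>\<eta>\<close> has type \<open>(n-1,n-1)\<close> because it is invariant under the rotations
  \<open>exp(tL)\<close>, which act on a vector of type (1,0) or (0,1) by a phase
  (\<open>pp_form_rotation_invariant\<close>).
\<close>

section \<open>Calculus of \<open>C\<^sup>k\<close> functions\<close>

lemma Ck_on_cong:
  assumes "open S" "\<And>x. x \<in> S \<Longrightarrow> f x = g x"
  shows "Ck_on k f S \<longleftrightarrow> Ck_on k g S"
proof -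
  have imp: "Ck_on k f S \<Longrightarrow> Ck_on k g S" if "\<And>x. x \<in> S \<Longrightarrow> f x = g x" for f g :: "'a::euclidean_space \<Rightarrow> 'b::real_normed_vector"
    using that
  proof (induction k arbitrary: f g)
    case 0
    then show ?case by (metis Ck_on.simps(1) continuous_on_cong)
  next
    case (Suc k)
    have d: "g differentiable (at x)" "frechet_derivative f (at x) = frechet_derivative g (at x)" if "x \<in> S" for x
    proof -
      have f: "f differentiable (at x)" using Suc.prems(1) that by simp
      show "frechet_derivative f (at x) = frechet_derivative g (at x)"
        by (rule frechet_derivative_transform_within_open[OF f \<open>open S\<close> that]) (use Suc.prems in auto)
      show "g differentiable (at x)"
        using f \<open>open S\<close> that Suc.prems(2) unfolding differentiable_def
        by (meson has_derivative_transform_within_open)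
    qed
    show ?case
      using Suc.prems(1) d Suc.IH[of "\<lambda>x. frechet_derivative f (at x) v" "\<lambda>x. frechet_derivative g (at x) v" for v]
      by auto
  qed
  show ?thesis using imp[of f g] imp[of g f] assms by auto
qed

lemma Ck_on_mono: "Ck_on k f S \<Longrightarrow> S' \<subseteq> S \<Longrightarrow> Ck_on k f S'"
  by (induction k arbitrary: f) (auto intro: continuous_on_subset)

lemma Ck_on_Suc_imp: "Ck_on (Suc k) f S \<Longrightarrow> Ck_on k f S"
proof (induction k arbitrary: f)
  case 0
  then show ?case
    by (simp add: continuous_at_imp_continuous_on differentiable_imp_continuous_within)
qed auto

lemma Ck_on_const: "open S \<Longrightarrow> Ck_on k (\<lambda>x. c) S"
  by (induction k arbitrary: c) auto

lemma Ck_on_bounded_linear: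
  assumes "bounded_linear A" "open S"
  shows "Ck_on k f S \<Longrightarrow> Ck_on k (\<lambda>x. A (f x)) S"
proof (induction k arbitrary: f)
  case 0
  then show ?case using assms(1) by (simp add: bounded_linear.continuous_on)
next
  case (Suc k)
  have d: "((\<lambda>x. A (f x)) has_derivative (\<lambda>v. A (frechet_derivative f (at x) v))) (at x)" if "x \<in> S" for x
    using Suc.prems that by (intro bounded_linear.has_derivative[OF assms(1)]) (simp add: frechet_derivative_works[symmetric])
  then have "frechet_derivative (\<lambda>x. A (f x)) (at x) v = A (frechet_derivative f (at x) v)" if "x \<in> S" for x v
    using frechet_derivative_at[OF d[OF that], symmetric] by simp
  then have "Ck_on k (\<lambda>x. frechet_derivative (\<lambda>x. A (f x)) (at x) v) S" for v
    using Suc Ck_on_cong[OF \<open>open S\<close>, of "\<lambda>x. frechet_derivative (\<lambda>x. A (f x)) (at x) v"] by simp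
  then show ?case using d by (auto simp: differentiable_def)
qed

lemma Ck_on_add:
  assumes "open S"
  shows "Ck_on k f S \<Longrightarrow> Ck_on k g S \<Longrightarrow> Ck_on k (\<lambda>x. f x + g x) S"
proof (induction k arbitrary: f g)
  case 0
  then show ?case by (simp add: continuous_on_add)
next
  case (Suc k)
  have d: "((\<lambda>x. f x + g x) has_derivative (\<lambda>v. frechet_derivative f (at x) v + frechet_derivative g (at x) v)) (at x)" if "x \<in> S" for x
    using Suc.prems that by (intro has_derivative_add) (simp_all add: frechet_derivative_works[symmetric])
  then have "frechet_derivative (\<lambda>x. f x + g x) (at x) v = frechet_derivative f (at x) v + frechet_derivative g (at x) v" if "x \<in> S" for x v
    using frechet_derivative_at[OF d[OF that], symmetric] by simp
  then have "Ck_on k (\<lambda>x. frechet_derivative (\<lambda>x. f x + g x) (at x) v) S" for v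
    using Suc Ck_on_cong[OF \<open>open S\<close>, of "\<lambda>x. frechet_derivative (\<lambda>x. f x + g x) (at x) v"] by simp
  then show ?case using d by (auto simp: differentiable_def)
qed

lemma Ck_on_sum:
  assumes "open S" "\<And>i. i \<in> A \<Longrightarrow> Ck_on k (f i) S"
  shows "Ck_on k (\<lambda>x. \<Sum>i\<in>A. f i x) S"
  using assms(2)
proof (induction A rule: infinite_finite_induct)
  case (insert i A)
  then show ?case using Ck_on_add[OF \<open>open S\<close>, of k "f i" "\<lambda>x. \<Sum>i\<in>A. f i x"] by simp
qed (use Ck_on_const[OF \<open>open S\<close>] in auto)

text \<open>The Leibniz rule has the undifferentiated factors in it, so the induction uses that a
  \<open>C\<^sup>k\<^sup>+\<^sup>1\<close> function is \<open>C\<^sup>k\<close>.\<close>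

lemma Ck_on_scaleR:
  fixes f :: "'a::euclidean_space \<Rightarrow> real"
  assumes "open S"
  shows "Ck_on k f S \<Longrightarrow> Ck_on k g S \<Longrightarrow> Ck_on k (\<lambda>x. f x *\<^sub>R g x) S"
proof (induction k arbitrary: f g)
  case 0
  then show ?case by (simp add: continuous_on_scaleR)
next
  case (Suc k)
  have d: "((\<lambda>x. f x *\<^sub>R g x) has_derivative
      (\<lambda>v. f x *\<^sub>R frechet_derivative g (at x) v + frechet_derivative f (at x) v *\<^sub>R g x)) (at x)" if "x \<in> S" for x
    using Suc.prems that by (intro has_derivative_scaleR) (simp_all add: frechet_derivative_works[symmetric])
  then have "frechet_derivative (\<lambda>x. f x *\<^sub>R g x) (at x) v =
      f x *\<^sub>R frechet_derivative g (at x) v + frechet_derivative f (at x) v *\<^sub>R g x" if "x \<in> S" for x v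
    using frechet_derivative_at[OF d[OF that], symmetric] by simp
  moreover have "Ck_on k (\<lambda>x. f x *\<^sub>R frechet_derivative g (at x) v + frechet_derivative f (at x) v *\<^sub>R g x) S" for v
    using Suc.prems by (intro Ck_on_add[OF assms] Suc.IH Ck_on_Suc_imp[of k f] Ck_on_Suc_imp[of k g]) auto
  ultimately have "Ck_on k (\<lambda>x. frechet_derivative (\<lambda>x. f x *\<^sub>R g x) (at x) v) S" for v
    using Ck_on_cong[OF \<open>open S\<close>, of "\<lambda>x. frechet_derivative (\<lambda>x. f x *\<^sub>R g x) (at x) v"] by simp
  then show ?case using d by (auto simp: differentiable_def)
qed

text \<open>The derivative of the composition in direction \<open>v\<close> is expanded in the standard basis,
  \<open>\<Sum>\<^sub>b (Dg(x)v \<bullet> b) Df(g(x))b\<close>. Each summand is a product of a component of \<open>Dg(x)v\<close> with a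
  partial derivative of \<open>f\<close> composed with \<open>g\<close>, to which the induction hypothesis applies.\<close>

lemma Ck_on_compose:
  fixes f :: "'b::euclidean_space \<Rightarrow> 'c::real_normed_vector" and g :: "'a::euclidean_space \<Rightarrow> 'b"
  assumes "open S" "g ` S \<subseteq> S'"
  shows "Ck_on k f S' \<Longrightarrow> Ck_on k g S \<Longrightarrow> Ck_on k (\<lambda>x. f (g x)) S"
proof (induction k arbitrary: f)
  case 0
  then show ?case using continuous_on_compose2 assms(2) by auto
next
  case (Suc k)
  have gk: "Ck_on k g S" by (rule Ck_on_Suc_imp) (rule Suc.prems)
  have fl: "bounded_linear (frechet_derivative f (at (g x)))" if "x \<in> S" for x
    using Suc.prems that assms(2) by (meson Ck_on.simps(2) frechet_derivative_works has_derivative_bounded_linear image_subset_iff)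
  have expand: "frechet_derivative f (at (g x)) w = (\<Sum>b\<in>Basis. (w \<bullet> b) *\<^sub>R frechet_derivative f (at (g x)) b)" if "x \<in> S" for x w
  proof -
    interpret F: bounded_linear "frechet_derivative f (at (g x))" by (rule fl[OF that])
    have "frechet_derivative f (at (g x)) (\<Sum>b\<in>Basis. (w \<bullet> b) *\<^sub>R b) =
        (\<Sum>b\<in>Basis. (w \<bullet> b) *\<^sub>R frechet_derivative f (at (g x)) b)"
      by (simp only: F.sum F.scaleR)
    then show ?thesis by (simp only: euclidean_representation)
  qed
  have d: "((\<lambda>x. f (g x)) has_derivative (\<lambda>v. frechet_derivative f (at (g x)) (frechet_derivative g (at x) v))) (at x)"
    if "x \<in> S" for x
    using Suc.prems that assms(2) diff_chain_at[of g "frechet_derivative g (at x)" x f "frechet_derivative f (at (g x))"]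
    by (auto simp: o_def frechet_derivative_works[symmetric] image_subset_iff)
  then have "frechet_derivative (\<lambda>x. f (g x)) (at x) v = frechet_derivative f (at (g x)) (frechet_derivative g (at x) v)"
    if "x \<in> S" for x v
    using frechet_derivative_at[OF d[OF that], symmetric] by simp
  then have "frechet_derivative (\<lambda>x. f (g x)) (at x) v =
      (\<Sum>b\<in>Basis. (frechet_derivative g (at x) v \<bullet> b) *\<^sub>R frechet_derivative f (at (g x)) b)" if "x \<in> S" for x v
    using that expand by metis
  moreover have "Ck_on k (\<lambda>x. \<Sum>b\<in>Basis. (frechet_derivative g (at x) v \<bullet> b) *\<^sub>R frechet_derivative f (at (g x)) b) S" for v
  proof (intro Ck_on_sum Ck_on_scaleR assms)
    fix b :: 'b
    show "Ck_on k (\<lambda>x. frechet_derivative g (at x) v \<bullet> b) S"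
      using Suc.prems by (intro Ck_on_bounded_linear[OF bounded_linear_inner_left \<open>open S\<close>]) auto
    show "Ck_on k (\<lambda>x. frechet_derivative f (at (g x)) b) S"
      using Suc.prems(1) gk by (intro Suc.IH[of "\<lambda>y. frechet_derivative f (at y) b"]) auto
  qed
  ultimately have "Ck_on k (\<lambda>x. frechet_derivative (\<lambda>x. f (g x)) (at x) v) S" for v
    using Ck_on_cong[OF \<open>open S\<close>, of "\<lambda>x. frechet_derivative (\<lambda>x. f (g x)) (at x) v"] by simp
  then show ?case using d by (auto simp: differentiable_def)
qed

text \<open>The second difference over the parallelogram with sides \<open>tu\<close> and \<open>tv\<close> is \<open>t\<^sup>2\<close>
  times a mixed derivative at an intermediate point, by the mean value theorem along \<open>u\<close> and then along \<open>v\<close>.\<close>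

lemma second_difference_mvt:
  fixes G :: "'a::euclidean_space \<Rightarrow> real"
  assumes G: "\<And>y. y \<in> S \<Longrightarrow> G differentiable (at y)"
    and Gu: "\<And>y. y \<in> S \<Longrightarrow> (\<lambda>y. frechet_derivative G (at y) u) differentiable (at y)"
    and t: "t > 0" and S: "\<And>a b. 0 \<le> a \<Longrightarrow> a \<le> t \<Longrightarrow> 0 \<le> b \<Longrightarrow> b \<le> t \<Longrightarrow> x + a *\<^sub>R u + b *\<^sub>R v \<in> S"
  shows "\<exists>a b. 0 < a \<and> a < t \<and> 0 < b \<and> b < t \<and>
    G (x + t *\<^sub>R u + t *\<^sub>R v) - G (x + t *\<^sub>R u) - G (x + t *\<^sub>R v) + G x =
    t * (t * frechet_derivative (\<lambda>y. frechet_derivative G (at y) u) (at (x + a *\<^sub>R u + b *\<^sub>R v)) v)"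
proof -
  define Gu' where "Gu' = (\<lambda>y. frechet_derivative G (at y) u)"
  have Gl: "linear (frechet_derivative G (at y))" if "y \<in> S" for y
    using G[OF that] linear_frechet_derivative by blast
  have Gul: "linear (frechet_derivative Gu' (at y))" if "y \<in> S" for y
    using Gu[OF that] linear_frechet_derivative unfolding Gu'_def by blast
  have "\<exists>z. z > 0 \<and> z < t \<and> (\<lambda>s. G (x + s *\<^sub>R u + t *\<^sub>R v) - G (x + s *\<^sub>R u)) t -
      (\<lambda>s. G (x + s *\<^sub>R u + t *\<^sub>R v) - G (x + s *\<^sub>R u)) 0 =
      (t - 0) * (Gu' (x + z *\<^sub>R u + t *\<^sub>R v) - Gu' (x + z *\<^sub>R u))"
  proof (rule MVT2[OF t])
    fix s assume s: "0 \<le> s" "s \<le> t"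
    have in1: "x + s *\<^sub>R u + t *\<^sub>R v \<in> S" "x + s *\<^sub>R u \<in> S"
      using S[of s t] S[of s 0] s t by auto
    have 1: "((\<lambda>s. G (x + s *\<^sub>R u + t *\<^sub>R v)) has_derivative (\<lambda>r. frechet_derivative G (at (x + s *\<^sub>R u + t *\<^sub>R v)) (r *\<^sub>R u))) (at s)"
      by (rule has_derivative_compose[of "\<lambda>s. x + s *\<^sub>R u + t *\<^sub>R v" "\<lambda>r. r *\<^sub>R u"])
         (auto intro!: derivative_eq_intros simp: frechet_derivative_works[symmetric] G in1)
    have 2: "((\<lambda>s. G (x + s *\<^sub>R u)) has_derivative (\<lambda>r. frechet_derivative G (at (x + s *\<^sub>R u)) (r *\<^sub>R u))) (at s)"
      by (rule has_derivative_compose[of "\<lambda>s. x + s *\<^sub>R u" "\<lambda>r. r *\<^sub>R u"])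
         (auto intro!: derivative_eq_intros simp: frechet_derivative_works[symmetric] G in1)
    show "((\<lambda>s. G (x + s *\<^sub>R u + t *\<^sub>R v) - G (x + s *\<^sub>R u)) has_real_derivative
         Gu' (x + s *\<^sub>R u + t *\<^sub>R v) - Gu' (x + s *\<^sub>R u)) (at s)"
      unfolding has_field_derivative_def Gu'_def
      by (rule has_derivative_eq_rhs[OF has_derivative_diff[OF 1 2]])
         (simp add: fun_eq_iff linear_scale[OF Gl] in1 left_diff_distrib)
  qed
  then obtain a where a: "0 < a" "a < t" and 1:
    "G (x + t *\<^sub>R u + t *\<^sub>R v) - G (x + t *\<^sub>R u) - G (x + t *\<^sub>R v) + G x = t * (Gu' (x + a *\<^sub>R u + t *\<^sub>R v) - Gu' (x + a *\<^sub>R u))"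
    by auto
  have "\<exists>z. z > 0 \<and> z < t \<and> (\<lambda>s. Gu' (x + a *\<^sub>R u + s *\<^sub>R v)) t - (\<lambda>s. Gu' (x + a *\<^sub>R u + s *\<^sub>R v)) 0 =
      (t - 0) * frechet_derivative Gu' (at (x + a *\<^sub>R u + z *\<^sub>R v)) v"
  proof (rule MVT2[OF t])
    fix s assume s: "0 \<le> s" "s \<le> t"
    have in1: "x + a *\<^sub>R u + s *\<^sub>R v \<in> S"
      using S[of a s] s a by auto
    have 1: "((\<lambda>s. Gu' (x + a *\<^sub>R u + s *\<^sub>R v)) has_derivative (\<lambda>r. frechet_derivative Gu' (at (x + a *\<^sub>R u + s *\<^sub>R v)) (r *\<^sub>R v))) (at s)"
      by (rule has_derivative_compose[of "\<lambda>s. x + a *\<^sub>R u + s *\<^sub>R v" "\<lambda>r. r *\<^sub>R v"])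
         (auto intro!: derivative_eq_intros simp: frechet_derivative_works[symmetric] Gu'_def Gu in1)
    show "((\<lambda>s. Gu' (x + a *\<^sub>R u + s *\<^sub>R v)) has_real_derivative
         frechet_derivative Gu' (at (x + a *\<^sub>R u + s *\<^sub>R v)) v) (at s)"
      using 1 unfolding has_field_derivative_def
      by (simp add: linear_scale[OF Gul] in1 mult.commute[of _ "frechet_derivative _ _ _"])
  qed
  then show ?thesis using a 1 unfolding Gu'_def by auto
qed

text \<open>The second difference is symmetric in \<open>u\<close> and \<open>v\<close>, so the two mixed derivatives
  agree at some points of every small parallelogram at \<open>x\<close>, and continuity transports this to \<open>x\<close>.\<close>

lemma second_derivative_symmetric_real:
  fixes G :: "'a::euclidean_space \<Rightarrow> real"
  assumes S: "open S" "x \<in> S" and C2: "Ck_on 2 G S"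
  shows "frechet_derivative (\<lambda>y. frechet_derivative G (at y) u) (at x) v =
         frechet_derivative (\<lambda>y. frechet_derivative G (at y) v) (at x) u" (is "?P x = ?Q x")
proof -
  define P where "P = (\<lambda>x. frechet_derivative (\<lambda>y. frechet_derivative G (at y) u) (at x) v)"
  define Q where "Q = (\<lambda>x. frechet_derivative (\<lambda>y. frechet_derivative G (at y) v) (at x) u)"
  have C1: "Ck_on (Suc (Suc 0)) G S" using C2 by (simp only: numeral_2_eq_2)
  have d: "\<And>y. y \<in> S \<Longrightarrow> G differentiable (at y)"
    "\<And>w y. y \<in> S \<Longrightarrow> (\<lambda>y. frechet_derivative G (at y) w) differentiable (at y)"
    using C1 by auto
  have cont: "isCont P x" "isCont Q x"
    using C1 S unfolding P_def Q_def by (auto simp: continuous_on_eq_continuous_at)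
  have "\<bar>P x - Q x\<bar> \<le> e" if "e > 0" for e
  proof -
    have "\<forall>\<^sub>F y in nhds x. y \<in> S \<and> dist (P y) (P x) < e/2 \<and> dist (Q y) (Q x) < e/2"
    proof (intro eventually_conj)
      show "\<forall>\<^sub>F y in nhds x. y \<in> S" using S by (simp add: eventually_nhds_in_open)
      show "\<forall>\<^sub>F y in nhds x. dist (P y) (P x) < e/2" 
        using cont(1) \<open>e>0\<close> half_gt_zero unfolding continuous_at_eps_delta eventually_nhds_metric by blast
      show "\<forall>\<^sub>F y in nhds x. dist (Q y) (Q x) < e/2" 
        using cont(2) \<open>e>0\<close> half_gt_zero unfolding continuous_at_eps_delta eventually_nhds_metric by blast
    qed
    then obtain r where r: "r > 0" "\<And>y. dist y x < r \<Longrightarrow> y \<in> S \<and> dist (P y) (P x) < e/2 \<and> dist (Q y) (Q x) < e/2"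
      unfolding eventually_nhds_metric by blast
    \<comment> \<open>The parallelogram with sides \<open>tu\<close> and \<open>tv\<close> at \<open>x\<close> has to lie in the ball of radius \<open>r\<close>.\<close>
    define t where "t = r / (2 * (norm u + norm v + 1))"
    have pos: "norm u + norm v + 1 > 0" by (simp add: add_nonneg_pos)
    have t: "t > 0" unfolding t_def using r(1) pos by simp
    have small: "dist (x + a *\<^sub>R u + b *\<^sub>R v) x < r" if "0 \<le> a" "a \<le> t" "0 \<le> b" "b \<le> t" for a b
    proof -
      have "dist (x + a *\<^sub>R u + b *\<^sub>R v) x \<le> norm (a *\<^sub>R u) + norm (b *\<^sub>R v)"
        by (simp add: dist_norm add.assoc) (metis norm_scaleR norm_triangle_ineq)
      also have "\<dots> \<le> t * norm u + t * norm v"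
        using that by (intro add_mono) (auto intro!: mult_right_mono)
      also have "\<dots> < t * (norm u + norm v + 1)" using t by (simp add: algebra_simps)
      also have "\<dots> = r / 2" unfolding t_def using pos by (simp add: field_simps)
      finally show ?thesis using r(1) by simp
    qed
    obtain a b where ab: "0 < a" "a < t" "0 < b" "b < t" 
      "G (x + t *\<^sub>R u + t *\<^sub>R v) - G (x + t *\<^sub>R u) - G (x + t *\<^sub>R v) + G x = t * (t * P (x + a *\<^sub>R u + b *\<^sub>R v))"
      using second_difference_mvt[of S G u t x v] d t small r(2) unfolding P_def by blast
    obtain a' b' where ab': "0 < a'" "a' < t" "0 < b'" "b' < t" 
      "G (x + t *\<^sub>R v + t *\<^sub>R u) - G (x + t *\<^sub>R v) - G (x + t *\<^sub>R u) + G x = t * (t * Q (x + a' *\<^sub>R v + b' *\<^sub>R u))"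
    proof -
      have "x + a *\<^sub>R v + b *\<^sub>R u \<in> S" if "0 \<le> a" "a \<le> t" "0 \<le> b" "b \<le> t" for a b
        using small[of b a] r(2) that by (simp add: add_ac)
      then show ?thesis using that second_difference_mvt[of S G v t x u] d t unfolding Q_def by blast
    qed
    have swap: "x + t *\<^sub>R v + t *\<^sub>R u = x + t *\<^sub>R u + t *\<^sub>R v" by (simp add: add_ac)
    have "t * (t * P (x + a *\<^sub>R u + b *\<^sub>R v)) = t * (t * Q (x + a' *\<^sub>R v + b' *\<^sub>R u))"
      using ab(5) ab'(5) unfolding swap by linarith
    then have eq: "P (x + a *\<^sub>R u + b *\<^sub>R v) = Q (x + a' *\<^sub>R v + b' *\<^sub>R u)" using t by simp
    have "dist (P (x + a *\<^sub>R u + b *\<^sub>R v)) (P x) < e/2" using r(2) small[of a b] ab by auto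
    moreover have "dist (Q (x + a' *\<^sub>R v + b' *\<^sub>R u)) (Q x) < e/2"
      using r(2)[of "x + a' *\<^sub>R v + b' *\<^sub>R u"] small[of b' a'] ab' by (auto simp: add_ac)
    ultimately show ?thesis using eq unfolding dist_real_def by linarith
  qed
  then have "\<bar>P x - Q x\<bar> \<le> 0" by (rule field_le_epsilon) simp
  then show ?thesis by (simp add: P_def Q_def)
qed

lemma second_derivative_symmetric:
  fixes G :: "'a::euclidean_space \<Rightarrow> 'b::euclidean_space"
  assumes S: "open S" "x \<in> S" and C2: "Ck_on 2 G S"
  shows "frechet_derivative (\<lambda>y. frechet_derivative G (at y) u) (at x) v =
         frechet_derivative (\<lambda>y. frechet_derivative G (at y) v) (at x) u"
proof (rule euclidean_eqI)
  fix b :: 'b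
  have C1: "Ck_on (Suc (Suc 0)) G S" using C2 by (simp only: numeral_2_eq_2)
  have comp: "frechet_derivative (\<lambda>y. F y \<bullet> b) (at y) w = frechet_derivative F (at y) w \<bullet> b"
    if "F differentiable (at y)" for F :: "'a \<Rightarrow> 'b" and y w
  proof -
    have d: "((\<lambda>y. F y \<bullet> b) has_derivative (\<lambda>w. frechet_derivative F (at y) w \<bullet> b)) (at y)"
      using that by (intro has_derivative_inner_left) (simp add: frechet_derivative_works[symmetric])
    show ?thesis using frechet_derivative_at[OF d, symmetric] by simp
  qed
  have *: "frechet_derivative (\<lambda>y. frechet_derivative (\<lambda>y. G y \<bullet> b) (at y) w) (at x) w' =
      frechet_derivative (\<lambda>y. frechet_derivative G (at y) w) (at x) w' \<bullet> b" for w w'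
  proof -
    have d: "(\<lambda>y. frechet_derivative G (at y) w) differentiable (at x)" using C1 S by auto
    have "frechet_derivative (\<lambda>y. frechet_derivative (\<lambda>y. G y \<bullet> b) (at y) w) (at x) =
      frechet_derivative (\<lambda>y. frechet_derivative G (at y) w \<bullet> b) (at x)"
      using d C1 S by (intro frechet_derivative_transform_within_open[of "\<lambda>y. frechet_derivative G (at y) w \<bullet> b", symmetric]) (auto simp: comp)
    then show ?thesis using comp[OF d] by simp
  qed
  have "Ck_on 2 (\<lambda>y. G y \<bullet> b) S"
    using C2 S by (intro Ck_on_bounded_linear[OF bounded_linear_inner_left])
  then show "frechet_derivative (\<lambda>y. frechet_derivative G (at y) u) (at x) v \<bullet> b =
         frechet_derivative (\<lambda>y. frechet_derivative G (at y) v) (at x) u \<bullet> b"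
    using second_derivative_symmetric_real[OF S, of "\<lambda>y. G y \<bullet> b" u v] unfolding * by blast
qed

lemma smooth_on_open_cong:
  assumes "open S" "\<And>x. x \<in> S \<Longrightarrow> f x = g x"
  shows "smooth_on f S \<longleftrightarrow> smooth_on g S"
  unfolding smooth_on_def using Ck_on_cong[OF assms] by simp

lemma smooth_on_mono: "smooth_on f S \<Longrightarrow> S' \<subseteq> S \<Longrightarrow> smooth_on f S'"
  unfolding smooth_on_def using Ck_on_mono by blast

lemma smooth_on_const: "open S \<Longrightarrow> smooth_on (\<lambda>x. c) S"
  unfolding smooth_on_def using Ck_on_const by blast

lemma smooth_on_differentiable: "smooth_on f S \<Longrightarrow> x \<in> S \<Longrightarrow> f differentiable (at x)"
  unfolding smooth_on_def using Ck_on.simps(2) by blast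

lemma smooth_on_derivative: "smooth_on f S \<Longrightarrow> smooth_on (\<lambda>x. frechet_derivative f (at x) v) S"
  unfolding smooth_on_def using Ck_on.simps(2) by blast

lemma smooth_on_compose:
  fixes f :: "'b::euclidean_space \<Rightarrow> 'c::real_normed_vector" and g :: "'a::euclidean_space \<Rightarrow> 'b"
  assumes "open S" "g ` S \<subseteq> S'" "smooth_on f S'" "smooth_on g S"
  shows "smooth_on (\<lambda>x. f (g x)) S"
  using assms Ck_on_compose unfolding smooth_on_def by blast

lemma smooth_on_sum:
  assumes "open S" "\<And>i. i \<in> A \<Longrightarrow> smooth_on (f i) S"
  shows "smooth_on (\<lambda>x. \<Sum>i\<in>A. f i x) S"
  unfolding smooth_on_def by (intro allI Ck_on_sum) (use assms in \<open>auto simp: smooth_on_def\<close>)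

lemma smooth_on_bounded_linear:
  assumes "bounded_linear A" "open S" "smooth_on f S"
  shows "smooth_on (\<lambda>x. A (f x)) S"
  unfolding smooth_on_def
  by (rule allI, rule Ck_on_bounded_linear[OF assms(1,2)]) (use assms(3) in \<open>simp add: smooth_on_def\<close>)

lemma matrix_vector_eqI: "(\<And>x. A *v x = B *v x) \<Longrightarrow> A = (B :: complex^'r::finite^'r)"
  by (simp add: matrix_eq)

lemma scaleR_matrix_vector: "(r *\<^sub>R A) *v x = r *\<^sub>R (A *v (x::complex^'r::finite))"
  by (simp add: vec_eq_iff matrix_vector_mult_def scaleR_sum_right)

lemma scaleR_eq_of_real_smult: "r *\<^sub>R (x::complex^'r::finite) = complex_of_real r *s x"
  by (simp add: vec_eq_iff scaleR_conv_of_real[symmetric])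

section \<open>Curvature as a tensor with values in skew-Hermitian endomorphisms\<close>

context
  fixes M :: "('m, 'e::euclidean_space) manifold"
  assumes M: "smooth_manifold M"
begin

lemma chart_at_atlas:
  assumes "p \<in> topspace (topo M)"
  shows "chart_at M p \<in> atlas M" "p \<in> fst (chart_at M p)"
proof -
  have "\<exists>c. c \<in> atlas M \<and> p \<in> fst c" using M assms unfolding smooth_manifold_def by blast
  from someI_ex[OF this] show "chart_at M p \<in> atlas M" "p \<in> fst (chart_at M p)" unfolding chart_at_def by auto
qed

lemma atlas_openin: "c \<in> atlas M \<Longrightarrow> openin (topo M) (fst c)"
  using M unfolding smooth_manifold_def is_chart_def by blast

lemma atlas_topspace: "c \<in> atlas M \<Longrightarrow> p \<in> fst c \<Longrightarrow> p \<in> topspace (topo M)"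
  using atlas_openin openin_subset by blast

lemma chart_homeomorphic:
  assumes "c \<in> atlas M"
  shows "homeomorphic_map (subtopology (topo M) (fst c)) (top_of_set (snd c ` fst c)) (snd c)"
    "topspace (subtopology (topo M) (fst c)) = fst c"
  using M assms openin_subset[OF atlas_openin[OF assms]] unfolding smooth_manifold_def is_chart_def by (blast, auto)

lemma chart_inv_chart:
  assumes "c \<in> atlas M" "q \<in> fst c"
  shows "chart_inv c (snd c q) = q"
proof -
  have "inj_on (snd c) (fst c)"
    using homeomorphic_imp_injective_map[OF chart_homeomorphic(1)[OF assms(1)]] chart_homeomorphic(2)[OF assms(1)] by simp
  then show ?thesis unfolding chart_inv_def using assms(2) by (rule inv_into_f_f)
qed

lemma open_chart_image:
  assumes "c \<in> atlas M" "openin (topo M) U"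
  shows "open (snd c ` (fst c \<inter> U))"
proof -
  have "openin (subtopology (topo M) (fst c)) (fst c \<inter> U)"
    using assms(2) by (simp add: openin_subtopology_Int2)
  then have "openin (top_of_set (snd c ` fst c)) (snd c ` (fst c \<inter> U))"
    using homeomorphic_imp_open_map[OF chart_homeomorphic(1)[OF assms(1)]] unfolding open_map_def by blast
  moreover have "open (snd c ` fst c)" using M assms(1) unfolding smooth_manifold_def is_chart_def by blast
  ultimately show ?thesis by (metis openin_open_eq)
qed

lemma smooth_transition:
  assumes "c \<in> atlas M" "d \<in> atlas M"
  shows "smooth_on (\<lambda>x. snd d (chart_inv c x)) (snd c ` (fst c \<inter> fst d))"
  using M assms unfolding smooth_manifold_def smoothly_compatible_def o_def by blast

lemma smooth_fun_iff:
  "smooth_fun M f U \<longleftrightarrow> (\<forall>c\<in>atlas M. smooth_on (\<lambda>x. f (chart_inv c x)) (snd c ` (fst c \<inter> U)))"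
  by (simp add: smooth_fun_def o_def)

lemma smooth_fun_const:
  assumes "openin (topo M) U"
  shows "smooth_fun M (\<lambda>p. c) U"
  unfolding smooth_fun_iff using smooth_on_const open_chart_image[OF _ assms] by blast

text \<open>Allows a differential to be computed from any expression \<open>G\<close> of \<open>f\<close> in the chosen
  chart that is valid near \<open>p\<close>.\<close>

lemma differential_eqI:
  assumes "p \<in> U" "openin (topo M) U" "c = chart_at M p"
    and "\<And>q. q \<in> fst c \<inter> U \<Longrightarrow> f q = G (snd c q)" and "G differentiable (at (snd c p))"
  shows "differential M f p u = frechet_derivative G (at (snd c p)) u"
proof -
  have p: "p \<in> topspace (topo M)" using assms(1,2) openin_subset by blast
  have c: "c \<in> atlas M" "p \<in> fst c" using chart_at_atlas[OF p] assms(3) by auto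
  have "frechet_derivative G (at (snd c p)) = frechet_derivative (f \<circ> chart_inv c) (at (snd c p))"
  proof (rule frechet_derivative_transform_within_open[OF assms(5) open_chart_image[OF c(1) assms(2)]])
    show "snd c p \<in> snd c ` (fst c \<inter> U)" using c assms(1) by auto
    show "G x = (f \<circ> chart_inv c) x" if x: "x \<in> snd c ` (fst c \<inter> U)" for x
    proof -
      obtain q where q: "q \<in> fst c \<inter> U" "x = snd c q" using x by auto
      then show ?thesis using assms(4)[OF q(1)] chart_inv_chart[OF c(1), of q] by simp
    qed
  qed
  then show ?thesis by (simp add: differential_def assms(3))
qed

text \<open>The vector field whose components with respect to the chart \<open>c\<close> are constantly \<open>v\<close>. Since
  \<open>T\<^sub>qM\<close> is identified with the coordinate space through the chart chosen at \<open>q\<close>, its value at \<open>q\<close> is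
  obtained by the derivative of the change of charts.\<close>

definition coordinate_field :: "('m, 'e) chart \<Rightarrow> 'e \<Rightarrow> 'm \<Rightarrow> 'e" where
  "coordinate_field c v q = frechet_derivative (\<lambda>x. snd (chart_at M q) (chart_inv c x)) (at (snd c q)) v"

lemma transition_differentiable:
  assumes "c \<in> atlas M" "d \<in> atlas M" "q \<in> fst c" "q \<in> fst d"
  shows "(\<lambda>x. snd d (chart_inv c x)) differentiable (at (snd c q))"
  using smooth_on_differentiable[OF smooth_transition[OF assms(1,2)]] assms(3,4) by auto

text \<open>On a coordinate field the differential is a partial derivative in that chart: the two
  changes of charts, from \<open>c\<close> to the chart chosen at \<open>q\<close> and back, cancel.\<close>

lemma differential_coordinate_field:
  assumes c: "c \<in> atlas M" and q: "q \<in> fst c" "q \<in> U" and U: "openin (topo M) U"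
    and f: "(\<lambda>x. f (chart_inv c x)) differentiable (at (snd c q))"
  shows "differential M f q (coordinate_field c v q) = frechet_derivative (\<lambda>x. f (chart_inv c x)) (at (snd c q)) v"
proof -
  define d where "d = chart_at M q"
  have d: "d \<in> atlas M" "q \<in> fst d" using chart_at_atlas[OF atlas_topspace[OF c q(1)]] by (auto simp: d_def)
  let ?F = "\<lambda>x. f (chart_inv c x)"
  let ?cd = "\<lambda>x. snd c (chart_inv d x)" and ?dc = "\<lambda>x. snd d (chart_inv c x)"
  have dif: "?cd differentiable (at (snd d q))" "?dc differentiable (at (snd c q))"
    using transition_differentiable c d q by auto
  have inv: "?cd (snd d q) = snd c q" "?dc (snd c q) = snd d q"
    using chart_inv_chart c d q by auto
  have 1: "differential M f q w = frechet_derivative (?F \<circ> ?cd) (at (snd d q)) w" for w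
    unfolding d_def
  proof (rule differential_eqI[of q "fst c \<inter> U"])
    show "openin (topo M) (fst c \<inter> U)" using atlas_openin[OF c] U by blast
    show "f q' = (?F \<circ> (\<lambda>x. snd c (chart_inv (chart_at M q) x))) (snd (chart_at M q) q')" if "q' \<in> fst (chart_at M q) \<inter> (fst c \<inter> U)" for q'
      using that chart_inv_chart[OF c, of q'] chart_inv_chart[OF d(1), of q'] by (simp add: d_def)
    show "?F \<circ> (\<lambda>x. snd c (chart_inv (chart_at M q) x)) differentiable (at (snd (chart_at M q) q))"
      using differentiable_chain_at[of ?cd "snd d q" ?F] dif(1) f inv by (simp add: d_def)
  qed (use q in auto)
  have 2: "frechet_derivative (?F \<circ> ?cd) (at (snd d q)) =
      frechet_derivative ?F (at (snd c q)) \<circ> frechet_derivative ?cd (at (snd d q))"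
    using frechet_derivative_compose[of ?cd "snd d q" ?F] dif(1) f inv by simp
  have "frechet_derivative (?cd \<circ> ?dc) (at (snd c q)) =
      frechet_derivative ?cd (at (snd d q)) \<circ> frechet_derivative ?dc (at (snd c q))"
    using frechet_derivative_compose[of ?dc "snd c q" ?cd] dif inv by simp
  moreover have "frechet_derivative (\<lambda>x. x) (at (snd c q)) = frechet_derivative (?cd \<circ> ?dc) (at (snd c q))"
  proof (rule frechet_derivative_transform_within_open[of _ _ "snd c ` (fst c \<inter> fst d)"])
    show "open (snd c ` (fst c \<inter> fst d))" by (rule open_chart_image[OF c atlas_openin[OF d(1)]])
    show "x = (?cd \<circ> ?dc) x" if "x \<in> snd c ` (fst c \<inter> fst d)" for x
      using that chart_inv_chart[OF c] chart_inv_chart[OF d(1)] by auto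
  qed (use c d q in auto)
  ultimately have "frechet_derivative ?cd (at (snd d q)) (frechet_derivative ?dc (at (snd c q)) v) = v"
    by (metis comp_apply frechet_derivative_ident)
  then show ?thesis unfolding 1 2 coordinate_field_def d_def[symmetric] by simp
qed

lemma coordinate_field_linear:
  assumes "c \<in> atlas M" "q \<in> fst c"
  shows "linear (\<lambda>v. coordinate_field c v q)"
  unfolding coordinate_field_def
  using linear_frechet_derivative transition_differentiable[OF assms(1) _ assms(2)] chart_at_atlas[OF atlas_topspace[OF assms]]
  by blast

lemma coordinate_field_at:
  assumes "p \<in> topspace (topo M)"
  shows "coordinate_field (chart_at M p) v p = v"
proof -
  let ?c = "chart_at M p"
  note c = chart_at_atlas[OF assms]
  have "frechet_derivative (\<lambda>x. x) (at (snd ?c p)) = frechet_derivative (\<lambda>x. snd ?c (chart_inv ?c x)) (at (snd ?c p))"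
    by (rule frechet_derivative_transform_within_open[of _ _ "snd ?c ` (fst ?c \<inter> fst ?c)"])
      (use c chart_inv_chart[OF c(1)] open_chart_image[OF c(1) atlas_openin[OF c(1)]] in auto)
  then show ?thesis unfolding coordinate_field_def by (metis frechet_derivative_ident)
qed

lemma smooth_coordinate_field:
  assumes c: "c \<in> atlas M" and U: "openin (topo M) U" "U \<subseteq> fst c"
  shows "smooth_vector_field M (coordinate_field c v) U"
  unfolding smooth_vector_field_def smooth_fun_iff
proof (intro ballI)
  fix a d assume a: "a \<in> atlas M" and d: "d \<in> atlas M"
  let ?S = "snd d ` (fst d \<inter> (U \<inter> fst a))"
  have S: "open ?S" using open_chart_image[OF d] openin_Int[OF U(1) atlas_openin[OF a]] by blast
  have "smooth_on (\<lambda>y. frechet_derivative (\<lambda>x. snd a (chart_inv c x)) (at (snd c (chart_inv d y))) v) ?S"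
  proof (rule smooth_on_compose[OF S, where g = "\<lambda>y. snd c (chart_inv d y)"
        and f = "\<lambda>x. frechet_derivative (\<lambda>x. snd a (chart_inv c x)) (at x) v"])
    show "smooth_on (\<lambda>x. frechet_derivative (\<lambda>x. snd a (chart_inv c x)) (at x) v) (snd c ` (fst c \<inter> fst a))"
      by (rule smooth_on_derivative[OF smooth_transition[OF c a]])
    show "smooth_on (\<lambda>y. snd c (chart_inv d y)) ?S"
      by (rule smooth_on_mono[OF smooth_transition[OF d c]]) (use U(2) in auto)
    show "(\<lambda>y. snd c (chart_inv d y)) ` ?S \<subseteq> snd c ` (fst c \<inter> fst a)"
      using chart_inv_chart[OF d] U(2) by auto
  qed
  moreover have "frechet_derivative (\<lambda>x. snd a (chart_inv c x)) (at (snd c (chart_inv d y))) v =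
      differential M (snd a) (chart_inv d y) (coordinate_field c v (chart_inv d y))" if y: "y \<in> ?S" for y
  proof -
    obtain q where q: "y = snd d q" "q \<in> fst d" "q \<in> U" "q \<in> fst a" using y by auto
    have inv: "chart_inv d y = q" unfolding q(1) by (rule chart_inv_chart[OF d q(2)])
    have "q \<in> fst c" using q(3) U(2) by blast
    show ?thesis unfolding inv
      by (rule differential_coordinate_field[OF c \<open>q \<in> fst c\<close> q(3) U(1)
            transition_differentiable[OF c a \<open>q \<in> fst c\<close> q(4)], symmetric])
  qed
  ultimately show "smooth_on (\<lambda>y. differential M (snd a) (chart_inv d y) (coordinate_field c v (chart_inv d y))) ?S"
    using smooth_on_open_cong[OF S] by (metis (no_types, lifting))
qed

lemma differential_locally_const:
  assumes "p \<in> U" "openin (topo M) U" "\<And>q. q \<in> U \<Longrightarrow> f q = k"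
  shows "differential M f p u = 0"
  using differential_eqI[OF assms(1,2) refl, of f "\<lambda>_. k" u] assms(3) by simp

lemma lie_bracket_coordinate_fields:
  assumes p: "p \<in> topspace (topo M)"
  shows "lie_bracket M (coordinate_field (chart_at M p) u) (coordinate_field (chart_at M p) v) p = 0"
proof -
  let ?c = "chart_at M p"
  note c = chart_at_atlas[OF p]
  have "differential M (snd ?c) q (coordinate_field ?c w q) = w" if q: "q \<in> fst ?c" for q w
  proof -
    have "differential M (snd ?c) q (coordinate_field ?c w q) = frechet_derivative (\<lambda>x. snd ?c (chart_inv ?c x)) (at (snd ?c q)) w"
      by (rule differential_coordinate_field[OF c(1) q q atlas_openin[OF c(1)] transition_differentiable[OF c(1) c(1) q q]])
    also have "frechet_derivative (\<lambda>x. snd ?c (chart_inv ?c x)) (at (snd ?c q)) = frechet_derivative (\<lambda>x. x) (at (snd ?c q))"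
      by (rule frechet_derivative_transform_within_open[of _ _ "snd ?c ` (fst ?c \<inter> fst ?c)", symmetric])
        (use q c chart_inv_chart[OF c(1)] open_chart_image[OF c(1) atlas_openin[OF c(1)]] in auto)
    finally show ?thesis by simp
  qed
  then have "differential M (\<lambda>q. differential M (snd ?c) q (coordinate_field ?c w q)) p z = 0" for w z
    by (rule differential_locally_const[OF c(2) atlas_openin[OF c(1)]])
  then show ?thesis unfolding lie_bracket_def Let_def by simp
qed

text \<open>The section through \<open>x\<close> at \<open>p\<close> that is constant in the trivialization \<open>e\<close>.\<close>

definition frame_section :: "('m \<Rightarrow> complex^'r::finite^'r) \<Rightarrow> 'm \<Rightarrow> complex^'r \<Rightarrow> 'm \<Rightarrow> complex^'r" where
  "frame_section e p x q = matrix_inv (e q) *v (e p *v x)"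

lemma frame_section_at:
  assumes "invertible (e p)"
  shows "frame_section e p x p = x"
proof -
  have "matrix_inv (e p) ** e p = mat 1"
    using someI_ex[OF assms[unfolded invertible_def]] unfolding matrix_inv_def by blast
  then show ?thesis by (simp add: frame_section_def matrix_vector_mul_assoc)
qed

text \<open>In another trivialization \<open>f\<close> the section is a linear combination with constant coefficients of
  the entries of the transition matrix, which are holomorphic.\<close>

lemma smooth_frame_section:
  fixes T :: "('m, 'r::finite) trivialization set"
  assumes T: "holomorphic_vector_bundle M L T" and V: "(V, e) \<in> T" and U: "openin (topo M) U" "U \<subseteq> V"
  shows "smooth_section M T (frame_section e p x) U"
  unfolding smooth_section_def
proof (clarify)
  fix V' f assume V': "(V', f) \<in> T"
  define y where "y = e p *v x"
  have ent: "smooth_fun M (\<lambda>q. (f q ** matrix_inv (e q)) $ i $ j) (V \<inter> V')" for i j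
    using T V V' unfolding holomorphic_vector_bundle_def holomorphic_fun_def by fast
  have "openin (topo M) V'" using T V' unfolding holomorphic_vector_bundle_def by fast
  then have UV: "openin (topo M) (U \<inter> V')" using U by blast
  have expand: "A *v y = (\<Sum>i\<in>UNIV. \<Sum>j\<in>UNIV. axis i (A $ i $ j * y $ j))" for A
  proof -
    have "(\<Sum>i\<in>UNIV. \<Sum>j\<in>UNIV. axis i (A $ i $ j * y $ j)) $ k = (A *v y) $ k" for k
      by (simp add: matrix_vector_mult_def axis_def if_distrib sum.If_cases)
    then show ?thesis by (simp add: vec_eq_iff)
  qed
  show "smooth_fun M (\<lambda>q. f q *v frame_section e p x q) (U \<inter> V')"
    unfolding smooth_fun_iff frame_section_def y_def[symmetric] matrix_vector_mul_assoc
  proof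
    fix d assume d: "d \<in> atlas M"
    let ?S = "snd d ` (fst d \<inter> (U \<inter> V'))"
    have S: "open ?S" by (rule open_chart_image[OF d UV])
    have "smooth_on (\<lambda>z. \<Sum>i\<in>UNIV. \<Sum>j\<in>UNIV. axis i ((f (chart_inv d z) ** matrix_inv (e (chart_inv d z))) $ i $ j * y $ j)) ?S"
    proof (intro smooth_on_sum S)
      fix i j :: 'r
      have "linear (\<lambda>a::complex. axis i (a * y $ j))"
        by (rule linearI) (simp_all add: vec_eq_iff axis_def algebra_simps)
      then have "bounded_linear (\<lambda>a::complex. axis i (a * y $ j))" by (simp add: linear_conv_bounded_linear)
      moreover have "smooth_on (\<lambda>z. (f (chart_inv d z) ** matrix_inv (e (chart_inv d z))) $ i $ j) ?S"
        by (rule smooth_on_mono[OF ent[unfolded smooth_fun_iff, rule_format, OF d]]) (use U(2) in auto)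
      ultimately show "smooth_on (\<lambda>z. axis i ((f (chart_inv d z) ** matrix_inv (e (chart_inv d z))) $ i $ j * y $ j)) ?S"
        using smooth_on_bounded_linear[OF _ S] by blast
    qed
    then show "smooth_on (\<lambda>z. (f (chart_inv d z) ** matrix_inv (e (chart_inv d z))) *v y) ?S"
      unfolding expand[symmetric] .
  qed
qed

lemma connection_local_rules:
  assumes "connection M T nabla" "openin (topo M) U" "smooth_section M T s U"
  shows "p \<in> U \<Longrightarrow> linear (nabla s p)"
    and "smooth_vector_field M X U \<Longrightarrow> smooth_section M T (\<lambda>p. nabla s p (X p)) U"
    and "smooth_section M T t U \<Longrightarrow> p \<in> U \<Longrightarrow> nabla (\<lambda>q. s q + t q) p u = nabla s p u + nabla t p u"
    and "(\<And>q. q \<in> U \<Longrightarrow> s' q = s q) \<Longrightarrow> p \<in> U \<Longrightarrow> nabla s' p = nabla s p"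
    and "p \<in> U \<Longrightarrow> nabla (\<lambda>q. c *s s q) p u = c *s nabla s p u"
proof -
  note C = assms(1)[unfolded connection_def, rule_format, OF assms(2,3)]
  show "p \<in> U \<Longrightarrow> linear (nabla s p)" using C by blast
  show "smooth_vector_field M X U \<Longrightarrow> smooth_section M T (\<lambda>p. nabla s p (X p)) U" using C by blast
  show "smooth_section M T t U \<Longrightarrow> p \<in> U \<Longrightarrow> nabla (\<lambda>q. s q + t q) p u = nabla s p u + nabla t p u" using C by blast
  show "(\<And>q. q \<in> U \<Longrightarrow> s' q = s q) \<Longrightarrow> p \<in> U \<Longrightarrow> nabla s' p = nabla s p" using C by blast
  assume p: "p \<in> U"
  have "differential M (\<lambda>q. c) p u = 0" by (rule differential_locally_const[OF p assms(2) refl])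
  moreover have "\<forall>f::'m \<Rightarrow> complex. smooth_fun M f U \<longrightarrow> (\<forall>p\<in>U. \<forall>u. nabla (\<lambda>q. f q *s s q) p u =
      differential M f p u *s s p + f p *s nabla s p u)" using C by blast
  then have "nabla (\<lambda>q. c *s s q) p u = differential M (\<lambda>q. c) p u *s s p + c *s nabla s p u"
    using smooth_fun_const[OF assms(2), of c] p by blast
  ultimately show "nabla (\<lambda>q. c *s s q) p u = c *s nabla s p u" by simp
qed

context
  fixes T :: "('m, 'r::finite) trivialization set" and nabla :: "('m, 'e, 'r) connection"
    and \<Theta> :: "'m \<Rightarrow> 'e \<Rightarrow> 'e \<Rightarrow> complex^'r^'r" and L :: "'m \<Rightarrow> 'e \<Rightarrow> 'e"
  assumes T: "holomorphic_vector_bundle M L T" and nabla: "connection M T nabla"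
    and \<Theta>: "curvature_form M T nabla \<Theta>"
begin

text \<open>The local data with which the tensor \<open>\<Theta>\<close> is computed at \<open>p\<close>: a neighbourhood inside the
  chart chosen at \<open>p\<close>, so that coordinate fields have prescribed values at \<open>p\<close>, and a smooth
  section through each vector of the fibre.\<close>

lemma local_frame:
  assumes "p \<in> topspace (topo M)"
  shows "\<exists>U S. openin (topo M) U \<and> p \<in> U \<and> U \<subseteq> fst (chart_at M p) \<and>
     (\<forall>x. smooth_section M T (S x) U \<and> S x p = x)"
proof -
  have "p \<in> (\<Union>(U, e)\<in>T. U)" using T assms unfolding holomorphic_vector_bundle_def by simp
  then obtain V e where V: "(V, e) \<in> T" "p \<in> V" by auto
  have "\<forall>(U, e)\<in>T. openin (topo M) U \<and> (\<forall>p\<in>U. invertible (e p))"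
    using T unfolding holomorphic_vector_bundle_def by (elim conjE)
  from bspec[OF this V(1)] have oV: "openin (topo M) V" "invertible (e p)" using V(2) by auto
  note c = chart_at_atlas[OF assms]
  let ?U = "fst (chart_at M p) \<inter> V"
  have U: "openin (topo M) ?U" using oV atlas_openin[OF c(1)] by blast
  have "smooth_section M T (frame_section e p x) ?U \<and> frame_section e p x p = x" for x
    using smooth_frame_section[OF T V(1) U, of p x] frame_section_at[of e p, OF oV(2)] by blast
  moreover have "p \<in> ?U" "?U \<subseteq> fst (chart_at M p)" using V(2) c(2) by auto
  ultimately show ?thesis using U(1)
    by (intro exI[of _ ?U] exI[of _ "frame_section e p"] conjI allI) auto
qed

text \<open>Coordinate fields commute, so the bracket term of the curvature is absent.\<close>

lemma curvature_coordinate_fields: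
  assumes U: "openin (topo M) U" "p \<in> U" "U \<subseteq> fst (chart_at M p)" and s: "smooth_section M T s U"
  defines "X \<equiv> coordinate_field (chart_at M p)"
  shows "\<Theta> p u v *v s p = nabla (\<lambda>q. nabla s q (X v q)) p u - nabla (\<lambda>q. nabla s q (X u q)) p v"
proof -
  have p: "p \<in> topspace (topo M)" using U openin_subset by blast
  note c = chart_at_atlas[OF p]
  have X: "smooth_vector_field M (X w) U" for w unfolding X_def by (rule smooth_coordinate_field[OF c(1) U(1,3)])
  have Xp: "X w p = w" for w unfolding X_def by (rule coordinate_field_at[OF p])
  have br: "lie_bracket M (X u) (X v) p = 0" unfolding X_def by (rule lie_bracket_coordinate_fields[OF p])
  have "\<Theta> p (X u p) (X v p) *v s p = nabla (\<lambda>q. nabla s q (X v q)) p (X u p)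
      - nabla (\<lambda>q. nabla s q (X u q)) p (X v p) - nabla s p (lie_bracket M (X u) (X v) p)"
    using \<Theta> U X s unfolding curvature_form_def by blast
  then show ?thesis
    using linear_0[OF connection_local_rules(1)[OF nabla U(1) s U(2)]] by (simp add: Xp br)
qed

lemma curvature_antisymmetric:
  assumes p: "p \<in> topspace (topo M)"
  shows "\<Theta> p u v = - \<Theta> p v u"
proof (rule matrix_vector_eqI)
  fix x
  obtain U S where U: "openin (topo M) U" "p \<in> U" "U \<subseteq> fst (chart_at M p)"
    and S: "\<And>x. smooth_section M T (S x) U" "\<And>x. S x p = x" using local_frame[OF p] by blast
  have "(- \<Theta> p v u) *v x = - (\<Theta> p v u *v x)" by (simp add: vec_eq_iff matrix_vector_mult_def sum_negf)
  then show "\<Theta> p u v *v x = - \<Theta> p v u *v x"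
    using curvature_coordinate_fields[OF U S(1)[of x], of u v] curvature_coordinate_fields[OF U S(1)[of x], of v u]
    by (simp add: S(2))
qed

text \<open>Additivity in \<open>u\<close> is not immediate from the formula for \<open>\<Theta>(u,v)\<close>, because \<open>u\<close> also
  enters through the field inside the inner derivative. The axioms on local additivity and on
  multiplication by a constant function move it out.\<close>

lemma curvature_linear:
  assumes p: "p \<in> topspace (topo M)"
  shows "linear (\<lambda>u. \<Theta> p u v)"
proof -
  obtain U S where U: "openin (topo M) U" "p \<in> U" "U \<subseteq> fst (chart_at M p)"
    and S: "\<And>x. smooth_section M T (S x) U" "\<And>x. S x p = x" using local_frame[OF p] by blast
  note c = chart_at_atlas[OF p]
  define X where "X = coordinate_field (chart_at M p)"
  have X: "smooth_vector_field M (X w) U" for w unfolding X_def by (rule smooth_coordinate_field[OF c(1) U(1,3)])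
  have Xlin: "linear (\<lambda>w. X w q)" if "q \<in> U" for q
    unfolding X_def by (rule coordinate_field_linear[OF c(1)]) (use that U in blast)
  define D where "D = (\<lambda>x w q. nabla (S x) q (X w q))"
  have Dsm: "smooth_section M T (D x w) U" for x w
    unfolding D_def by (rule connection_local_rules(2)[OF nabla U(1) S(1) X])
  have curv: "\<Theta> p u v *v x = nabla (D x v) p u - nabla (D x u) p v" for u v x
    using curvature_coordinate_fields[OF U S(1)[of x], of u v] unfolding D_def X_def S(2) .
  have nlin: "linear (nabla (D x w) p)" "q \<in> U \<Longrightarrow> linear (nabla (S x) q)" for x w q
    using connection_local_rules(1)[OF nabla U(1)] Dsm S(1) U(2) by blast+
  have "nabla (D x (u + u')) p v = nabla (\<lambda>q. D x u q + D x u' q) p v" for x u u'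
    using connection_local_rules(4)[OF nabla U(1) Dsm[of x "u + u'"], of "\<lambda>q. D x u q + D x u' q" p] U(2)
    by (simp add: D_def linear_add[OF Xlin] linear_add[OF nlin(2)])
  then have add: "nabla (D x (u + u')) p v = nabla (D x u) p v + nabla (D x u') p v" for x u u'
    using connection_local_rules(3)[OF nabla U(1) Dsm Dsm U(2)] by simp
  have "nabla (D x (r *\<^sub>R u)) p v = nabla (\<lambda>q. complex_of_real r *s D x u q) p v" for x u r
    using connection_local_rules(4)[OF nabla U(1) Dsm[of x "r *\<^sub>R u"], of "\<lambda>q. complex_of_real r *s D x u q" p] U(2)
    by (simp add: D_def linear_scale[OF Xlin] linear_scale[OF nlin(2)] scaleR_eq_of_real_smult)
  then have scale: "nabla (D x (r *\<^sub>R u)) p v = r *\<^sub>R nabla (D x u) p v" for x u r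
    using connection_local_rules(5)[OF nabla U(1) Dsm U(2)] by (simp add: scaleR_eq_of_real_smult)
  show ?thesis
  proof (rule linearI)
    show "\<Theta> p (u + u') v = \<Theta> p u v + \<Theta> p u' v" for u u'
      by (rule matrix_vector_eqI) (simp add: curv matrix_vector_mult_add_rdistrib linear_add[OF nlin(1)] add)
    show "\<Theta> p (r *\<^sub>R u) v = r *\<^sub>R \<Theta> p u v" for r u
      by (rule matrix_vector_eqI) (simp add: curv scaleR_matrix_vector linear_scale[OF nlin(1)] scale scaleR_right_diff_distrib)
  qed
qed

lemma differential_add:
  assumes "openin (topo M) U" "p \<in> U" "smooth_fun M f U" "smooth_fun M f' U"
  shows "differential M (\<lambda>q. f q + f' q) p u = differential M f p u + differential M f' p u"
proof -
  have p: "p \<in> topspace (topo M)" using assms openin_subset by blast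
  note c = chart_at_atlas[OF p]
  define G G' where "G = f \<circ> chart_inv (chart_at M p)" and "G' = f' \<circ> chart_inv (chart_at M p)"
  let ?y = "snd (chart_at M p) p"
  have "?y \<in> snd (chart_at M p) ` (fst (chart_at M p) \<inter> U)" using c assms(2) by auto
  then have "G differentiable (at ?y)" "G' differentiable (at ?y)"
    using assms(3,4) c(1) smooth_on_differentiable unfolding smooth_fun_def G_def G'_def by blast+
  then have "((\<lambda>x. G x + G' x) has_derivative (\<lambda>u. frechet_derivative G (at ?y) u + frechet_derivative G' (at ?y) u)) (at ?y)"
    by (intro has_derivative_add) (simp_all add: frechet_derivative_works[symmetric])
  from frechet_derivative_at[OF this, symmetric]
  have "frechet_derivative (\<lambda>x. G x + G' x) (at ?y) u = frechet_derivative G (at ?y) u + frechet_derivative G' (at ?y) u"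
    by simp
  moreover have "(\<lambda>q. f q + f' q) \<circ> chart_inv (chart_at M p) = (\<lambda>x. G x + G' x)"
    by (simp add: G_def G'_def fun_eq_iff)
  ultimately show ?thesis by (simp add: differential_def G_def G'_def)
qed

text \<open>Differentiating \<open>F = h(s,t)\<close> along \<open>v\<close> and then along \<open>u\<close> by compatibility with the metric gives
  four terms; the two with one derivative on each factor are symmetric in \<open>u\<close> and \<open>v\<close> together. The left
  side is symmetric as well, being a second partial derivative of \<open>F\<close>, so antisymmetrization leaves
  \<open>0 = h(\<Theta>(u,v)s,t) + h(s,\<Theta>(u,v)t)\<close>.\<close>

lemma curvature_skew_hermitian:
  assumes h: "hermitian_metric M T h" and hc: "hermitian_connection M T h nabla"
    and p: "p \<in> topspace (topo M)"
  shows "h p (\<Theta> p u v *v x) y + h p x (\<Theta> p u v *v y) = 0"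
proof -
  obtain U S where U: "openin (topo M) U" "p \<in> U" "U \<subseteq> fst (chart_at M p)"
    and S: "\<And>x. smooth_section M T (S x) U" "\<And>x. S x p = x" using local_frame[OF p] by blast
  note c = chart_at_atlas[OF p]
  define X where "X = coordinate_field (chart_at M p)"
  have X: "smooth_vector_field M (X w) U" for w unfolding X_def by (rule smooth_coordinate_field[OF c(1) U(1,3)])
  have Xp: "X w p = w" for w unfolding X_def by (rule coordinate_field_at[OF p])
  define D where "D = (\<lambda>x w q. nabla (S x) q (X w q))"
  have Dsm: "smooth_section M T (D x w) U" for x w
    unfolding D_def by (rule connection_local_rules(2)[OF nabla U(1) S(1) X])
  have Dp: "D x w p = nabla (S x) p w" for x w by (simp add: D_def Xp)
  have curv: "\<Theta> p u v *v x = nabla (D x v) p u - nabla (D x u) p v" for u v x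
    using curvature_coordinate_fields[OF U S(1)[of x], of u v] unfolding D_def X_def S(2) .
  have leib: "differential M (\<lambda>q. h q (s q) (t q)) q w = h q (nabla s q w) (t q) + h q (s q) (nabla t q w)"
    if "smooth_section M T s U" "smooth_section M T t U" "q \<in> U" for s t q w
    using hc that U(1) unfolding hermitian_connection_def by blast
  have hsm: "smooth_fun M (\<lambda>q. h q (s q) (t q)) U"
    if "smooth_section M T s U" "smooth_section M T t U" for s t
    using h that U(1) unfolding hermitian_metric_def by blast
  have hp: "h p (a *s x + y) z = a * h p x z + h p y z" "h p y x = cnj (h p x y)" for a x y z
    using h p unfolding hermitian_metric_def by blast+
  have add1: "h p (x + y) z = h p x z + h p y z" for x y z using hp(1)[of 1] by simp
  have sub1: "h p (x - y) z = h p x z - h p y z" for x y z using add1[of "x - y" y z] by simp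
  have sub2: "h p z (x - y) = h p z x - h p z y" for x y z
    using hp(2)[of z] sub1[of x y z] by (metis complex_cnj_diff)
  define F where "F = (\<lambda>q. h q (S x q) (S y q))"
  \<comment> \<open>\<open>dF w\<close> is the derivative of \<open>F\<close> along the coordinate field of \<open>w\<close>.\<close>
  define dF where "dF = (\<lambda>w q. h q (D x w q) (S y q) + h q (S x q) (D y w q))"
  define G where "G = (\<lambda>z. F (chart_inv (chart_at M p) z))"
  let ?W = "snd (chart_at M p) ` (fst (chart_at M p) \<inter> U)"
  have W: "open ?W" by (rule open_chart_image[OF c(1) U(1)])
  have pW: "snd (chart_at M p) p \<in> ?W" using c U by auto
  have G: "smooth_on G ?W"
    using hsm[OF S(1) S(1)] c(1) unfolding smooth_fun_iff G_def F_def by blast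
  have dFG: "dF w q = frechet_derivative G (at (snd (chart_at M p) q)) w" if "q \<in> U" for w q
  proof -
    have "dF w q = differential M F q (X w q)"
      unfolding dF_def F_def leib[OF S(1) S(1) that] D_def ..
    also have "\<dots> = frechet_derivative G (at (snd (chart_at M p) q)) w"
      unfolding X_def G_def
      by (rule differential_coordinate_field[OF c(1) _ that U(1)])
         (use smooth_on_differentiable[OF G] that U(3) in \<open>auto simp: G_def\<close>)
    finally show ?thesis .
  qed
  have second: "differential M (dF w) p w' = frechet_derivative (\<lambda>z. frechet_derivative G (at z) w) (at (snd (chart_at M p) p)) w'" for w w'
    by (rule differential_eqI[OF U(2) U(1) refl])
       (use dFG smooth_on_differentiable[OF smooth_on_derivative[OF G]] pW in auto)
  have "Ck_on 2 G ?W" using G unfolding smooth_on_def by blast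
  then have sym: "differential M (dF v) p u = differential M (dF u) p v"
    unfolding second by (rule second_derivative_symmetric[OF W pW])
  have expand: "differential M (dF w) p w' = h p (nabla (D x w) p w') y + h p (nabla (S x) p w) (nabla (S y) p w')
      + (h p (nabla (S x) p w') (nabla (S y) p w) + h p x (nabla (D y w) p w'))" for w w'
    unfolding dF_def
    by (subst differential_add[OF U(1,2) hsm[OF Dsm S(1)] hsm[OF S(1) Dsm]])
       (simp add: leib[OF Dsm S(1) U(2)] leib[OF S(1) Dsm U(2)] Dp S(2))
  show ?thesis
    using sym unfolding expand curv sub1 sub2 by (simp add: algebra_simps)
qed

end

end

section \<open>Wedge products as alternations\<close>

text \<open>The alternating sum over \<open>S\<^sub>N\<close>, without a normalizing factor.\<close>

definition alternate :: "nat \<Rightarrow> ((nat \<Rightarrow> 'e) \<Rightarrow> 'c::real_vector) \<Rightarrow> (nat \<Rightarrow> 'e) \<Rightarrow> 'c" where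
  "alternate N F v = (\<Sum>\<sigma> | \<sigma> permutes {..<N}. of_int (sign \<sigma>) *\<^sub>R F (\<lambda>i. v (\<sigma> i)))"

lemma wedge_by_eq_alternate:
  "wedge_by m k l \<alpha> \<beta> =
     (\<lambda>v. (1 / (fact k * fact l)) *\<^sub>R alternate (k + l) (\<lambda>v. m (\<alpha> v) (\<beta> (\<lambda>i. v (k + i)))) v)"
  by (simp add: fun_eq_iff wedge_by_def alternate_def)

lemma alternate_cong: "(\<And>v. F v = G v) \<Longrightarrow> alternate N F v = alternate N G v"
  by (simp add: alternate_def)

lemma alternate_scaleR: "alternate N (\<lambda>v. c *\<^sub>R F v) v = c *\<^sub>R alternate N F v"
  by (simp add: alternate_def scaleR_sum_right mult.commute)

lemma linear_alternate:
  assumes "linear f"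
  shows "f (alternate N F v) = alternate N (\<lambda>v. f (F v)) v"
  by (simp add: alternate_def linear_sum[OF assms] linear_scale[OF assms])

lemma sign_compose_permutes:
  "\<sigma> permutes {..<N::nat} \<Longrightarrow> \<pi> permutes {..<N} \<Longrightarrow> sign (\<sigma> \<circ> \<pi>) = sign \<sigma> * sign \<pi>"
  by (intro sign_compose) (auto simp: permutation_permutes)

text \<open>A signed sum over a set \<open>P\<close> of permutations inside an alternation contributes its number of elements,
  by translation invariance of the sum over the symmetric group. With \<open>P\<close> the permutations of the first \<open>k\<close> or
  the last \<open>l\<close> arguments this makes wedge products associative up to the factors \<open>k!\<close> and \<open>l!\<close>.\<close>

lemma alternate_absorb:
  assumes P: "finite P" "\<And>\<pi>. \<pi> \<in> P \<Longrightarrow> \<pi> permutes {..<N}"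
  shows "alternate N (\<lambda>v. \<Sum>\<pi>\<in>P. of_int (sign \<pi>) *\<^sub>R F (\<lambda>i. v (\<pi> i))) v
       = of_nat (card P) *\<^sub>R alternate N F v"
proof -
  have "alternate N (\<lambda>v. \<Sum>\<pi>\<in>P. of_int (sign \<pi>) *\<^sub>R F (\<lambda>i. v (\<pi> i))) v
      = (\<Sum>\<pi>\<in>P. \<Sum>\<sigma> | \<sigma> permutes {..<N}. of_int (sign (\<sigma> \<circ> \<pi>)) *\<^sub>R F (\<lambda>i. v ((\<sigma> \<circ> \<pi>) i)))"
    unfolding alternate_def scaleR_sum_right
    by (subst sum.swap) (intro sum.cong refl, use P in \<open>simp add: sign_compose_permutes\<close>)
  also have "\<dots> = (\<Sum>\<pi>\<in>P. alternate N F v)"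
    unfolding alternate_def
    by (intro sum.cong refl sum_permutations_compose_right[symmetric, of _ _ "\<lambda>\<sigma>. of_int (sign \<sigma>) *\<^sub>R F (\<lambda>i. v (\<sigma> i))"]) (use P in auto)
  finally show ?thesis by (simp add: sum_constant_scaleR)
qed

lemma alternate_absorb_left:
  assumes "\<And>y. linear (\<lambda>x. m x y)"
  shows "alternate (k + l) (\<lambda>v. m (alternate k \<alpha> v) (\<beta> (\<lambda>i. v (k + i)))) v
       = fact k *\<^sub>R alternate (k + l) (\<lambda>v. m (\<alpha> v) (\<beta> (\<lambda>i. v (k + i)))) v"
proof -
  let ?P = "{\<pi>. \<pi> permutes {..<k}}"
  have P: "\<pi> permutes {..<k + l}" if "\<pi> \<in> ?P" for \<pi>
    using that permutes_subset by fastforce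
  have fix_k: "\<pi> (k + i) = k + i" if "\<pi> \<in> ?P" for \<pi> i
    using that by (auto intro: permutes_not_in)
  have "m (alternate k \<alpha> v) (\<beta> (\<lambda>i. v (k + i))) =
      (\<Sum>\<pi>\<in>?P. of_int (sign \<pi>) *\<^sub>R (\<lambda>v. m (\<alpha> v) (\<beta> (\<lambda>i. v (k + i)))) (\<lambda>i. v (\<pi> i)))" for v
    unfolding alternate_def linear_sum[OF assms] linear_scale[OF assms]
    by (intro sum.cong refl) (simp add: fix_k)
  then have "alternate (k + l) (\<lambda>v. m (alternate k \<alpha> v) (\<beta> (\<lambda>i. v (k + i)))) v =
     of_nat (card ?P) *\<^sub>R alternate (k + l) (\<lambda>v. m (\<alpha> v) (\<beta> (\<lambda>i. v (k + i)))) v"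
    by (simp only:) (intro alternate_absorb P, simp_all add: finite_permutations)
  then show ?thesis by (simp add: card_permutations[of "{..<k}" k])
qed

lemma alternate_absorb_right:
  assumes "\<And>x. linear (m x)" and \<alpha>: "\<And>v w. (\<And>i. i < k \<Longrightarrow> v i = w i) \<Longrightarrow> \<alpha> v = \<alpha> w"
    and \<beta>: "\<And>v w. (\<And>i. i < l \<Longrightarrow> v i = w i) \<Longrightarrow> \<beta> v = \<beta> w"
  shows "alternate (k + l) (\<lambda>v. m (\<alpha> v) (alternate l \<beta> (\<lambda>i. v (k + i)))) v
       = fact l *\<^sub>R alternate (k + l) (\<lambda>v. m (\<alpha> v) (\<beta> (\<lambda>i. v (k + i)))) v"
proof -
  \<comment> \<open>\<open>sh\<close> lets a permutation of \<open>{..<l}\<close> act on the last \<open>l\<close> of \<open>k + l\<close> indices.\<close>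
  define sh where "sh = map_permutation {..<l} (\<lambda>i. k + i)"
  let ?Q = "{\<pi>. \<pi> permutes {..<l}}"
  have inj: "inj_on (\<lambda>i. k + i) {..<l}" by simp
  have sh_perm: "sh \<pi> permutes {k..<k + l}" if "\<pi> \<in> ?Q" for \<pi>
  proof -
    have "(\<lambda>i. k + i) ` {..<l} = {k..<k + l}"
      by (simp add: lessThan_atLeast0 add.commute)
    then show ?thesis
      using that map_permutation_permutes[of "\<lambda>i. k + i" "{..<l}" "{k..<k+l}" \<pi>] inj
      unfolding sh_def bij_betw_def by auto
  qed
  have sh_P: "sh \<pi> permutes {..<k + l}" if "\<pi> \<in> ?Q" for \<pi>
    by (rule permutes_subset[OF sh_perm[OF that]]) auto
  have sh_app: "sh \<pi> (k + i) = k + \<pi> i" if "\<pi> \<in> ?Q" "i < l" for \<pi> i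
    using that map_permutation_apply[OF inj] unfolding sh_def by auto
  have sh_low: "sh \<pi> i = i" if "\<pi> \<in> ?Q" "i < k" for \<pi> i
    using permutes_not_in[OF sh_perm[OF that(1)]] that(2) by auto
  have sh_sign: "sign (sh \<pi>) = sign \<pi>" if "\<pi> \<in> ?Q" for \<pi>
    using that sign_map_permutation[OF inj] unfolding sh_def by auto
  have sh_inj: "inj_on sh ?Q"
  proof (rule inj_onI, rule ext)
    fix \<pi> \<rho> i assume *: "\<pi> \<in> ?Q" "\<rho> \<in> ?Q" "sh \<pi> = sh \<rho>"
    show "\<pi> i = \<rho> i"
    proof (cases "i < l")
      case True
      then show ?thesis using sh_app[OF *(1) True] sh_app[OF *(2) True] *(3) by simp
    next
      case False
      then show ?thesis using * by (simp add: permutes_not_in)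
    qed
  qed
  have "m (\<alpha> v) (alternate l \<beta> (\<lambda>i. v (k + i))) =
      (\<Sum>\<pi>\<in>sh ` ?Q. of_int (sign \<pi>) *\<^sub>R (\<lambda>v. m (\<alpha> v) (\<beta> (\<lambda>i. v (k + i)))) (\<lambda>i. v (\<pi> i)))" for v
    unfolding alternate_def linear_sum[OF assms(1)] linear_scale[OF assms(1)] sum.reindex[OF sh_inj] o_def
  proof (intro sum.cong refl)
    fix \<pi> assume \<pi>: "\<pi> \<in> ?Q"
    have 1: "\<alpha> (\<lambda>i. v (sh \<pi> i)) = \<alpha> v" by (rule \<alpha>) (simp add: sh_low[OF \<pi>])
    have 2: "\<beta> (\<lambda>i. v (sh \<pi> (k + i))) = \<beta> (\<lambda>i. v (k + \<pi> i))" by (rule \<beta>) (simp add: sh_app[OF \<pi>])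
    show "of_int (sign \<pi>) *\<^sub>R m (\<alpha> v) (\<beta> (\<lambda>i. v (k + \<pi> i))) =
      of_int (sign (sh \<pi>)) *\<^sub>R m (\<alpha> (\<lambda>i. v (sh \<pi> i))) (\<beta> (\<lambda>i. v (sh \<pi> (k + i))))"
      by (simp only: 1 2 sh_sign[OF \<pi>])
  qed
  then have "alternate (k + l) (\<lambda>v. m (\<alpha> v) (alternate l \<beta> (\<lambda>i. v (k + i)))) v =
     of_nat (card (sh ` ?Q)) *\<^sub>R alternate (k + l) (\<lambda>v. m (\<alpha> v) (\<beta> (\<lambda>i. v (k + i)))) v"
    by (simp only:) (intro alternate_absorb, use sh_P in \<open>auto simp: finite_permutations\<close>)
  then show ?thesis by (simp add: card_image[OF sh_inj] card_permutations[of "{..<l}" l])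
qed

lemma wedge_power_eq_alternate:
  "wedge_power_2form (form2 w) m v =
     (1 / 2 ^ m) *\<^sub>R alternate (2 * m) (\<lambda>v. \<Prod>k<m. w (v (2 * k)) (v (2 * k + 1))) v"
proof (induction m arbitrary: v)
  case 0
  have "{\<sigma>. \<sigma> permutes {..<0::nat}} = {id}" by (auto simp: permutes_empty)
  then show ?case by (simp add: alternate_def)
next
  case (Suc m)
  have l: "linear ((*) (x::complex))" for x by (simp add: linear_times)
  have "wedge_power_2form (form2 w) (Suc m) v = (1 / (fact 2 * fact (2 * m))) *\<^sub>R
      alternate (2 + 2 * m) (\<lambda>v. form2 w v * wedge_power_2form (form2 w) m (\<lambda>i. v (2 + i))) v"
    by (simp add: wedge_by_eq_alternate)
  also have "\<dots> = (1 / (fact 2 * fact (2 * m) * 2 ^ m)) *\<^sub>R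
      alternate (2 + 2 * m) (\<lambda>v. form2 w v *
        alternate (2 * m) (\<lambda>v. \<Prod>k<m. w (v (2 * k)) (v (2 * k + 1))) (\<lambda>i. v (2 + i))) v"
    by (simp add: Suc.IH mult_scaleR_right alternate_scaleR del: scaleR_conv_of_real of_real_power)
  also have "alternate (2 + 2 * m) (\<lambda>v. form2 w v *
        alternate (2 * m) (\<lambda>v. \<Prod>k<m. w (v (2 * k)) (v (2 * k + 1))) (\<lambda>i. v (2 + i))) v =
      fact (2 * m) *\<^sub>R alternate (2 + 2 * m)
        (\<lambda>v. form2 w v * (\<Prod>k<m. w (v (2 + 2 * k)) (v (2 + (2 * k + 1))))) v"
    by (rule alternate_absorb_right[OF l]) (auto simp: form2_def intro!: prod.cong)
  also have "alternate (2 + 2 * m) (\<lambda>v. form2 w v * (\<Prod>k<m. w (v (2 + 2 * k)) (v (2 + (2 * k + 1))))) v =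
      alternate (2 * Suc m) (\<lambda>v. \<Prod>k<Suc m. w (v (2 * k)) (v (2 * k + 1))) v"
    by (simp only: prod.lessThan_Suc_shift) (simp add: form2_def)
  finally show ?case by simp
qed

text \<open>All factorials of the nested wedge products cancel against the inner alternations. What remains is a
  single alternation of a plain product, which can be evaluated on a frame.\<close>

lemma wedge_4form_power_eq_alternate:
  assumes B: "\<And>v w. (\<And>i. i < 4 \<Longrightarrow> v i = w i) \<Longrightarrow> B v = B w"
  shows "wedge 4 (2 * m) (alternate 4 B) (wedge_power_2form (form2 w) m) v =
     (1 / 2 ^ m) *\<^sub>R alternate (4 + 2 * m) (\<lambda>v. B v * (\<Prod>k<m. w (v (4 + 2 * k)) (v (4 + 2 * k + 1)))) v"
proof -
  let ?P = "\<lambda>v. \<Prod>k<m. w (v (2 * k)) (v (2 * k + 1))"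
  have l: "linear ((*) (x::complex))" "linear (\<lambda>y::complex. y * x)" for x 
    by (simp_all add: linear_times linear_times[unfolded mult.commute[of x]] bounded_linear.linear bounded_linear_mult_left)
  have "wedge 4 (2 * m) (alternate 4 B) (wedge_power_2form (form2 w) m) v =
      (1 / (fact 4 * fact (2 * m))) *\<^sub>R alternate (4 + 2 * m)
        (\<lambda>v. alternate 4 B v * ((1 / 2 ^ m) *\<^sub>R alternate (2 * m) ?P (\<lambda>i. v (4 + i)))) v"
    by (simp only: wedge_by_eq_alternate wedge_power_eq_alternate)
  also have "\<dots> = (1 / (fact 4 * fact (2 * m) * 2 ^ m)) *\<^sub>R alternate (4 + 2 * m)
        (\<lambda>v. alternate 4 B v * (alternate (2 * m) ?P (\<lambda>i. v (4 + i)))) v"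
    by (simp only: mult_scaleR_right alternate_scaleR) simp
  also have "alternate (4 + 2 * m) (\<lambda>v. alternate 4 B v * (alternate (2 * m) ?P (\<lambda>i. v (4 + i)))) v =
      fact 4 *\<^sub>R alternate (4 + 2 * m) (\<lambda>v. B v * (alternate (2 * m) ?P (\<lambda>i. v (4 + i)))) v"
    by (rule alternate_absorb_left[OF l(2)])
  also have "alternate (4 + 2 * m) (\<lambda>v. B v * (alternate (2 * m) ?P (\<lambda>i. v (4 + i)))) v =
      fact (2 * m) *\<^sub>R alternate (4 + 2 * m) (\<lambda>v. B v * ?P (\<lambda>i. v (4 + i))) v"
    by (rule alternate_absorb_right[OF l(1)]) (auto intro!: prod.cong intro: B)
  finally show ?thesis by (simp add: add.assoc)
qed

section \<open>Alternating multilinear forms\<close>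

text \<open>Forms are functions of infinite sequences; this says that only the first \<open>N\<close> entries matter.\<close>

definition depends_on_first :: "nat \<Rightarrow> ((nat \<Rightarrow> 'e) \<Rightarrow> 'c) \<Rightarrow> bool" where
  "depends_on_first N F \<longleftrightarrow> (\<forall>v w. (\<forall>i<N. v i = w i) \<longrightarrow> F v = F w)"

definition multilinear :: "nat \<Rightarrow> ((nat \<Rightarrow> 'e::real_vector) \<Rightarrow> 'c::real_vector) \<Rightarrow> bool" where
  "multilinear N F \<longleftrightarrow> (\<forall>i<N. \<forall>v. linear (\<lambda>x. F (v(i := x))))"

definition alternating :: "nat \<Rightarrow> ((nat \<Rightarrow> 'e::real_vector) \<Rightarrow> 'c::real_vector) \<Rightarrow> bool" where
  "alternating N F \<longleftrightarrow> multilinear N F \<and> (\<forall>v. \<forall>i<N. \<forall>j<N. i \<noteq> j \<longrightarrow> v i = v j \<longrightarrow> F v = 0)"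

text \<open>Reindexing the sum over the symmetric group makes the alternation of any function antisymmetric.\<close>

lemma alternate_permute:
  assumes "\<pi> permutes {..<N}"
  shows "alternate N F (\<lambda>i. v (\<pi> i)) = of_int (sign \<pi>) *\<^sub>R alternate N F v"
proof -
  have "sign \<sigma> = sign \<pi> * sign (\<pi> \<circ> \<sigma>)" if "\<sigma> permutes {..<N}" for \<sigma>
    using that assms by (simp add: sign_compose_permutes)
  then have "alternate N F (\<lambda>i. v (\<pi> i)) =
      (\<Sum>\<sigma> | \<sigma> permutes {..<N}. of_int (sign \<pi> * sign (\<pi> \<circ> \<sigma>)) *\<^sub>R F (\<lambda>i. v ((\<pi> \<circ> \<sigma>) i)))"
    unfolding alternate_def by (intro sum.cong refl) (simp only: mem_Collect_eq, simp)
  also have "\<dots> = (\<Sum>\<sigma> | \<sigma> permutes {..<N}. of_int (sign \<pi> * sign \<sigma>) *\<^sub>R F (\<lambda>i. v (\<sigma> i)))"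
    by (rule setum_permutations_compose_left[OF assms, symmetric, of "\<lambda>\<sigma>. of_int (sign \<pi> * sign \<sigma>) *\<^sub>R F (\<lambda>i. v (\<sigma> i))"])
  finally show ?thesis by (simp add: alternate_def scaleR_sum_right)
qed

lemma alternating_alternate:
  assumes "multilinear N F"
  shows "alternating N (alternate N F)"
  unfolding alternating_def multilinear_def
proof (intro conjI allI impI)
  fix i :: nat and v :: "nat \<Rightarrow> 'a" assume i: "i < N"
  have "(\<lambda>x. alternate N F (v(i := x))) =
     (\<lambda>x. \<Sum>\<sigma> | \<sigma> permutes {..<N}. of_int (sign \<sigma>) *\<^sub>R F ((\<lambda>j. v (\<sigma> j))(inv \<sigma> i := x)))"
  proof (rule ext)
    fix x
    have "(\<lambda>j. (v(i := x)) (\<sigma> j)) = (\<lambda>j. v (\<sigma> j))(inv \<sigma> i := x)" if "\<sigma> permutes {..<N}" for \<sigma>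
      using permutes_inverses[OF that] by (auto simp: fun_eq_iff)
    then show "alternate N F (v(i := x)) =
      (\<Sum>\<sigma> | \<sigma> permutes {..<N}. of_int (sign \<sigma>) *\<^sub>R F ((\<lambda>j. v (\<sigma> j))(inv \<sigma> i := x)))"
      unfolding alternate_def by (intro sum.cong) auto
  qed
  moreover have "linear (\<lambda>x. \<Sum>\<sigma> | \<sigma> permutes {..<N}. of_int (sign \<sigma>) *\<^sub>R F ((\<lambda>j. v (\<sigma> j))(inv \<sigma> i := x)))"
  proof (rule linear_compose_sum, rule ballI)
    fix \<sigma> assume "\<sigma> \<in> {\<sigma>. \<sigma> permutes {..<N}}"
    then have "inv \<sigma> i < N" using permutes_in_image[OF permutes_inv, of \<sigma> "{..<N}" i] i by auto
    then have "linear (\<lambda>x. F ((\<lambda>j. v (\<sigma> j))(inv \<sigma> i := x)))"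
      using assms unfolding multilinear_def by blast
    then show "linear (\<lambda>x. of_int (sign \<sigma>) *\<^sub>R F ((\<lambda>j. v (\<sigma> j))(inv \<sigma> i := x)))"
      by (rule linear_compose_scale_right)
  qed
  ultimately show "linear (\<lambda>x. alternate N F (v(i := x)))" by simp
next
  fix v :: "nat \<Rightarrow> 'a" and i j :: nat assume *: "i < N" "j < N" "i \<noteq> j" "v i = v j"
  have "(\<lambda>k. v (Transposition.transpose i j k)) = v" using *(4) by (auto simp: fun_eq_iff Transposition.transpose_def)
  then have "alternate N F v = - alternate N F v"
    using alternate_permute[OF permutes_swap_id[of i "{..<N}" j], of F v] * by (simp add: sign_swap_id)
  then have "2 *\<^sub>R alternate N F v = 0" by (simp only: scaleR_2 eq_neg_iff_add_eq_0)
  then show "alternate N F v = 0" by simp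
qed

lemma alternating_linear: "alternating N \<eta> \<Longrightarrow> i < N \<Longrightarrow> linear (\<lambda>x. \<eta> (v(i := x)))"
  by (simp add: alternating_def multilinear_def)

lemma alternating_eq_0: "alternating N \<eta> \<Longrightarrow> i < N \<Longrightarrow> j < N \<Longrightarrow> i \<noteq> j \<Longrightarrow> v i = v j \<Longrightarrow> \<eta> v = 0"
  by (auto simp: alternating_def)

text \<open>An alternating form vanishes on linearly dependent arguments. The argument at \<open>i\<close> is updated, and
  the entries that span it are the remaining ones.\<close>

lemma alternating_span_eq_0:
  assumes "alternating N \<eta>" "i < N" and x: "x \<in> span (v ` ({..<N} - {i}))"
  shows "\<eta> (v(i := x)) = 0"
  using x
proof (induction rule: span_induct)
  case base
  then show ?case
    using linear_subspace_vimage[OF alternating_linear[OF assms(1,2), of v] subspace_single_0]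
    unfolding vimage_def singleton_iff .
next
  case (step x)
  then obtain j where "j < N" "j \<noteq> i" "x = v j" by auto
  then show ?case using assms by (intro alternating_eq_0[of N \<eta> i j]) auto
qed

text \<open>The tuple \<open>e\<^sub>0, L e\<^sub>0, e\<^sub>1, L e\<^sub>1, \<dots>\<close>: a real frame made from a complex one.\<close>

definition doubled :: "('e \<Rightarrow> 'e) \<Rightarrow> (nat \<Rightarrow> 'e) \<Rightarrow> nat \<Rightarrow> 'e" where
  "doubled L e = (\<lambda>i. if even i then e (i div 2) else L (e (i div 2)))"

lemma doubled_simps [simp]:
  "doubled L e (2 * k) = e k" "doubled L e (Suc (2 * k)) = L (e k)"
  by (simp_all add: doubled_def)

lemma doubled_upd: "doubled L (e(k := x)) = (doubled L e)(2 * k := x, Suc (2 * k) := L x)"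
  by (auto simp: doubled_def fun_eq_iff elim!: evenE oddE)

text \<open>A complex column operation: adding to \<open>e\<^sub>k\<close> a complex combination \<open>y\<close> of the other entries adds
  \<open>L y\<close>, again such a combination, to the partner \<open>L e\<^sub>k\<close>, and both additions are invisible to an alternating
  form.\<close>

lemma alternating_doubled_add:
  fixes L :: "'e::real_vector \<Rightarrow> 'e"
  assumes \<eta>: "alternating (2 * p) \<eta>" and L: "linear L" "\<And>x. L (L x) = - x" and k: "k < p"
    and y: "y \<in> span (\<Union>j\<in>{..<p} - {k}. {e j, L (e j)})"
  shows "\<eta> (doubled L (e(k := x + y))) = \<eta> (doubled L (e(k := x)))"
proof -
  let ?S = "\<Union>j\<in>{..<p} - {k}. {e j, L (e j)}"
  let ?F = "\<lambda>a b. \<eta> ((doubled L e)(2 * k := a, Suc (2 * k) := b))"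
  have "L ` span ?S \<subseteq> span ?S"
  proof -
    have "L ` ?S \<subseteq> span ?S"
    proof (intro image_subsetI)
      fix x assume "x \<in> ?S"
      then obtain j where j: "j \<in> {..<p} - {k}" "x = e j \<or> x = L (e j)" by auto
      have "e j \<in> span ?S" "L (e j) \<in> span ?S" using j by (auto intro!: span_base)
      then show "L x \<in> span ?S" using j L by (auto intro: span_neg)
    qed
    then have "span (L ` ?S) \<subseteq> span ?S" by (rule span_minimal) (rule subspace_span)
    then show ?thesis by (simp add: linear_span_image[OF L(1)])
  qed
  then have Ly: "L y \<in> span ?S" using y by auto
  have sub: "?S \<subseteq> doubled L e ` ({..<2*p} - {2 * k, Suc (2 * k)})"
  proof
    fix x assume "x \<in> ?S"
    then obtain j where j: "j < p" "j \<noteq> k" "x = e j \<or> x = L (e j)" by auto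
    then have "x = doubled L e (2 * j) \<or> x = doubled L e (Suc (2 * j))" by simp
    moreover have "2 * j \<noteq> Suc (2 * k)" "Suc (2 * j) \<noteq> 2 * k" "Suc (2 * j) < 2 * p"
      using j(1,2) by presburger+
    then have "2 * j \<in> {..<2*p} - {2 * k, Suc (2 * k)}" "Suc (2 * j) \<in> {..<2*p} - {2 * k, Suc (2 * k)}"
      using j by auto
    ultimately show "x \<in> doubled L e ` ({..<2*p} - {2 * k, Suc (2 * k)})" by blast
  qed
  let ?X = "{..<2*p} - {2 * k, Suc (2 * k)}"
  have img: "doubled L e ` ?X = (doubled L e)(i := c) ` ?X" if "i \<notin> ?X" for i c
    using that by (intro image_cong) auto
  have z1: "?F a b = 0" if "a \<in> span ?S" for a b
  proof -
    have "doubled L e ` ?X = (doubled L e)(Suc (2 * k) := b) ` ?X"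
      by (rule img) simp
    also have "\<dots> \<subseteq> (doubled L e)(Suc (2 * k) := b) ` ({..<2*p} - {2 * k})"
      by (rule image_mono) auto
    finally have S: "?S \<subseteq> (doubled L e)(Suc (2 * k) := b) ` ({..<2*p} - {2 * k})"
      by (rule subset_trans[OF sub])
    have "\<eta> (((doubled L e)(Suc (2 * k) := b))(2 * k := a)) = 0"
      using k span_mono[OF S] that by (intro alternating_span_eq_0[OF \<eta>]) auto
    then show ?thesis by (simp add: fun_upd_twist)
  qed
  have z2: "?F a b = 0" if "b \<in> span ?S" for a b
  proof -
    have "doubled L e ` ?X = (doubled L e)(2 * k := a) ` ?X"
      by (rule img) simp
    also have "\<dots> \<subseteq> (doubled L e)(2 * k := a) ` ({..<2*p} - {Suc (2 * k)})"
      by (rule image_mono) auto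
    finally have S: "?S \<subseteq> (doubled L e)(2 * k := a) ` ({..<2*p} - {Suc (2 * k)})"
      by (rule subset_trans[OF sub])
    show ?thesis
      using k span_mono[OF S] that by (intro alternating_span_eq_0[OF \<eta>]) auto
  qed
  have l2: "linear (?F a)" for a using alternating_linear[OF \<eta>, of "Suc (2 * k)"] k by simp
  have l1: "linear (\<lambda>a. ?F a b)" for b
    using alternating_linear[OF \<eta>, of "2 * k" "(doubled L e)(Suc (2 * k) := b)"] k by (simp add: fun_upd_twist)
  have "?F (x + y) (L x + L y) = ?F x (L x)"
    using z1[OF y] z2[OF Ly] by (simp add: linear_add[OF l2] linear_add[OF l1])
  then show ?thesis by (simp add: doubled_upd linear_add[OF L(1)])
qed

text \<open>Both \<open>x\<close> and its partner \<open>L x\<close> are scaled, so the factor is a square; this is why signs survive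
  normalization.\<close>

lemma alternating_doubled_scale:
  assumes \<eta>: "alternating (2 * p) \<eta>" and L: "linear L" and k: "k < p"
  shows "\<eta> (doubled L (e(k := r *\<^sub>R x))) = r\<^sup>2 *\<^sub>R \<eta> (doubled L (e(k := x)))"
proof -
  let ?F = "\<lambda>a b. \<eta> ((doubled L e)(2 * k := a, Suc (2 * k) := b))"
  have l2: "linear (?F a)" for a using alternating_linear[OF \<eta>, of "Suc (2 * k)"] k by simp
  have l1: "linear (\<lambda>a. ?F a b)" for b
    using alternating_linear[OF \<eta>, of "2 * k" "(doubled L e)(Suc (2 * k) := b)"] k by (simp add: fun_upd_twist)
  show ?thesis
    by (simp add: doubled_upd linear_scale[OF L] linear_scale[OF l1] linear_scale[OF l2] power2_eq_square)
qed

lemma multilinear_times_bilinear: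
  fixes F :: "(nat \<Rightarrow> 'e::real_vector) \<Rightarrow> real"
  assumes F: "multilinear N F" "depends_on_first N F" and w: "bilinear w"
  shows "multilinear (N + 2) (\<lambda>v. F v * w (v N) (v (Suc N)))"
    and "depends_on_first (N + 2) (\<lambda>v. F v * w (v N) (v (Suc N)))"
proof -
  have wl: "linear (\<lambda>x. w x y)" "linear (w x)" for x y using w by (auto simp: bilinear_def)
  have eq: "F (v(i := x)) = F v" if "i \<ge> N" for v i x
    using F(2) that unfolding depends_on_first_def by auto
  show "multilinear (N + 2) (\<lambda>v. F v * w (v N) (v (Suc N)))"
    unfolding multilinear_def
  proof (intro allI impI)
    fix i v assume "i < N + 2"
    then consider "i < N" | "i = N" | "i = Suc N" by linarith
    then show "linear (\<lambda>x. F (v(i := x)) * w ((v(i := x)) N) ((v(i := x)) (Suc N)))"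
    proof cases
      case 1
      then have l: "linear (\<lambda>x. F (v(i := x)))" using F(1) by (simp add: multilinear_def)
      show ?thesis using 1 by (auto intro!: linearI simp: linear_add[OF l] linear_scale[OF l] algebra_simps)
    next
      case 2
      show ?thesis using 2 by (auto intro!: linearI simp: eq linear_add[OF wl(1)] linear_scale[OF wl(1)] algebra_simps)
    next
      case 3
      show ?thesis using 3 by (auto intro!: linearI simp: eq linear_add[OF wl(2)] linear_scale[OF wl(2)] algebra_simps)
    qed
  qed
  show "depends_on_first (N + 2) (\<lambda>v. F v * w (v N) (v (Suc N)))"
    using F(2) unfolding depends_on_first_def by (metis add_2_eq_Suc' less_SucI lessI)
qed

text \<open>Used for the product whose alternation is \<open>r\<^sub>2 \<and> \<omega>\<^sup>m\<close>. Both properties are proved together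
  because the induction step for multilinearity uses the dependence on the first arguments only.\<close>

lemma multilinear_times_power:
  fixes F :: "(nat \<Rightarrow> 'e::real_vector) \<Rightarrow> real"
  assumes F: "multilinear N F" "depends_on_first N F" and w: "bilinear w"
  shows "multilinear (N + 2 * m) (\<lambda>v. F v * (\<Prod>k<m. w (v (N + 2 * k)) (v (N + 2 * k + 1)))) \<and>
    depends_on_first (N + 2 * m) (\<lambda>v. F v * (\<Prod>k<m. w (v (N + 2 * k)) (v (N + 2 * k + 1))))"
proof (induction m)
  case 0
  then show ?case using F by simp
next
  case (Suc m)
  have eq: "(\<lambda>v. F v * (\<Prod>k<Suc m. w (v (N + 2 * k)) (v (N + 2 * k + 1)))) =
    (\<lambda>v. (F v * (\<Prod>k<m. w (v (N + 2 * k)) (v (N + 2 * k + 1)))) * w (v (N + 2 * m)) (v (Suc (N + 2 * m))))"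
    by (simp add: fun_eq_iff mult.assoc)
  have "N + 2 * Suc m = (N + 2 * m) + 2" by simp
  then show ?case
    using multilinear_times_bilinear[OF conjunct1[OF Suc] conjunct2[OF Suc] w] by (simp only: eq)
qed

lemma multilinear_curvature_product:
  fixes \<Theta> :: "'e::real_vector \<Rightarrow> 'e \<Rightarrow> 'b::real_vector" and q :: "'b \<Rightarrow> 'b \<Rightarrow> real"
  assumes \<Theta>: "bilinear \<Theta>" and q: "bilinear q"
  shows "multilinear 4 (\<lambda>v. - q (\<Theta> (v 0) (v 1)) (\<Theta> (v 2) (v 3)))"
  unfolding multilinear_def
proof (intro allI impI)
  fix i :: nat and v :: "nat \<Rightarrow> 'e" assume "i < 4"
  have l: "linear (\<lambda>x. \<Theta> x y)" "linear (\<Theta> x)" "linear (\<lambda>x. q x z)" "linear (q z)" for x y z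
    using assms by (auto simp: bilinear_def)
  consider "i = 0" | "i = 1" | "i = 2" | "i = 3" using \<open>i < 4\<close> by linarith
  then show "linear (\<lambda>x. - q (\<Theta> ((v(i := x)) 0) ((v(i := x)) 1)) (\<Theta> ((v(i := x)) 2) ((v(i := x)) 3)))"
    by cases (auto intro!: linearI simp: linear_add[OF l(1)] linear_add[OF l(2)] linear_add[OF l(3)] linear_add[OF l(4)]
        linear_scale[OF l(1)] linear_scale[OF l(2)] linear_scale[OF l(3)] linear_scale[OF l(4)])
qed

lemma alternating_linear_image:
  assumes "alternating N \<xi>" "linear f"
  shows "alternating N (\<lambda>v. f (\<xi> v))"
  using assms linear_compose[of "\<lambda>x. \<xi> (_(_ := x))" f] linear_0[OF assms(2)]
  unfolding alternating_def multilinear_def o_def by fastforce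

lemma depends_on_first_image: "depends_on_first N \<xi> \<Longrightarrow> depends_on_first N (\<lambda>v. f (\<xi> v))"
  unfolding depends_on_first_def by metis

section \<open>Complexification and type\<close>

text \<open>Separates the choice made in slot \<open>j\<close>, which exhibits the complexification as complex linear in that
  slot: it takes the value at \<open>fst q\<close> plus \<open>\<i>\<close> times the value at \<open>snd q\<close>.\<close>

lemma complexify_split:
  assumes "j < N"
  shows "complexify N \<eta> (w(j := q)) = (\<Sum>S\<in>Pow ({..<N} - {j}). \<i> ^ card S *
      (\<eta> ((\<lambda>k. if k \<in> S then snd (w k) else fst (w k))(j := fst q)) +
       \<i> * \<eta> ((\<lambda>k. if k \<in> S then snd (w k) else fst (w k))(j := snd q))))"
proof -
  let ?A = "{..<N} - {j}"
  let ?f = "\<lambda>S. \<i> ^ card S * \<eta> (\<lambda>k. if k \<in> S then snd ((w(j := q)) k) else fst ((w(j := q)) k))"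
  have ins: "{..<N} = insert j ?A" using assms by auto
  have "complexify N \<eta> (w(j := q)) = sum ?f (Pow ?A \<union> insert j ` Pow ?A)"
    unfolding complexify_def by (subst ins) (simp only: Pow_insert)
  also have "\<dots> = sum ?f (Pow ?A) + sum ?f (insert j ` Pow ?A)"
    by (rule sum.union_disjoint) auto
  also have "sum ?f (insert j ` Pow ?A) = sum (\<lambda>S. ?f (insert j S)) (Pow ?A)"
  proof (subst sum.reindex)
    show "inj_on (insert j) (Pow ?A)"
      by (rule inj_onI) (metis Diff_insert_absorb Diff_subset Pow_iff insert_Diff_single insert_absorb insert_ident subset_Diff_insert)
  qed (simp add: o_def)
  also have "sum ?f (Pow ?A) + sum (\<lambda>S. ?f (insert j S)) (Pow ?A) = sum (\<lambda>S. ?f S + ?f (insert j S)) (Pow ?A)"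
    by (simp add: sum.distrib)
  also have "\<dots> = (\<Sum>S\<in>Pow ({..<N} - {j}). \<i> ^ card S *
      (\<eta> ((\<lambda>k. if k \<in> S then snd (w k) else fst (w k))(j := fst q)) +
       \<i> * \<eta> ((\<lambda>k. if k \<in> S then snd (w k) else fst (w k))(j := snd q))))"
  proof (rule sum.cong[OF refl])
    fix S assume S: "S \<in> Pow ?A"
    then have "j \<notin> S" "finite S" by (auto intro: finite_subset)
    then have c: "card (insert j S) = Suc (card S)" by simp
    have 1: "(\<lambda>k. if k \<in> S then snd ((w(j := q)) k) else fst ((w(j := q)) k)) =
       (\<lambda>k. if k \<in> S then snd (w k) else fst (w k))(j := fst q)"
      using \<open>j \<notin> S\<close> by (auto simp: fun_eq_iff)
    have 2: "(\<lambda>k. if k \<in> insert j S then snd ((w(j := q)) k) else fst ((w(j := q)) k)) =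
       (\<lambda>k. if k \<in> S then snd (w k) else fst (w k))(j := snd q)"
      using \<open>j \<notin> S\<close> by (auto simp: fun_eq_iff)
    show "?f S + ?f (insert j S) = \<i> ^ card S *
      (\<eta> ((\<lambda>k. if k \<in> S then snd (w k) else fst (w k))(j := fst q)) +
       \<i> * \<eta> ((\<lambda>k. if k \<in> S then snd (w k) else fst (w k))(j := snd q)))"
      unfolding 1 2 c by (simp add: algebra_simps)
  qed
  finally show ?thesis .
qed

text \<open>Multiplication by \<open>z\<close> on the complexified space, where \<open>(a, b)\<close> stands for \<open>a + \<i> b\<close>.\<close>

definition cscale :: "complex \<Rightarrow> 'e::real_vector \<times> 'e \<Rightarrow> 'e \<times> 'e" where
  "cscale z w = (Re z *\<^sub>R fst w - Im z *\<^sub>R snd w, Re z *\<^sub>R snd w + Im z *\<^sub>R fst w)"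

lemma complexify_cscale_slot:
  assumes "multilinear N \<eta>" "j < N"
  shows "complexify N \<eta> (w(j := cscale z q)) = z * complexify N \<eta> (w(j := q))"
proof -
  have *: "\<eta> (v(j := fst (cscale z q))) + \<i> * \<eta> (v(j := snd (cscale z q))) =
      z * (\<eta> (v(j := fst q)) + \<i> * \<eta> (v(j := snd q)))" for v
  proof -
    have l: "linear (\<lambda>x. \<eta> (v(j := x)))" using assms by (simp add: multilinear_def)
    have "z = complex_of_real (Re z) + \<i> * complex_of_real (Im z)" by (rule complex_eq)
    then show ?thesis
      by (simp add: cscale_def linear_add[OF l] linear_diff[OF l] linear_scale[OF l] scaleR_conv_of_real)
        (simp add: complex_eq_iff algebra_simps)
  qed
  show ?thesis
    unfolding complexify_split[OF assms(2)] sum_distrib_left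
    by (intro sum.cong refl) (simp add: * algebra_simps)
qed

lemma complexify_cong:
  assumes "depends_on_first N \<eta>" "\<And>j. j < N \<Longrightarrow> w j = w' j"
  shows "complexify N \<eta> w = complexify N \<eta> w'"
proof -
  have "\<eta> (\<lambda>j. if j \<in> S then snd (w j) else fst (w j)) = \<eta> (\<lambda>j. if j \<in> S then snd (w' j) else fst (w' j))" for S
    using assms unfolding depends_on_first_def by auto
  then show ?thesis by (simp add: complexify_def)
qed

lemma complexify_cscale:
  assumes "multilinear N \<eta>" and loc: "depends_on_first N \<eta>"
  shows "complexify N \<eta> (\<lambda>j. cscale (z j) (w j)) = (\<Prod>j<N. z j) * complexify N \<eta> w"
proof -
  have *: "complexify N \<eta> (\<lambda>j. if j < k then cscale (z j) (w j) else w j) = (\<Prod>j<k. z j) * complexify N \<eta> w"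
    if "k \<le> N" for k
    using that
  proof (induction k)
    case (Suc k)
    let ?w = "\<lambda>j. if j < k then cscale (z j) (w j) else w j"
    have "(\<lambda>j. if j < Suc k then cscale (z j) (w j) else w j) = ?w(k := cscale (z k) (w k))"
      by (auto simp: fun_eq_iff)
    moreover have "?w(k := w k) = ?w" by (auto simp: fun_eq_iff)
    ultimately show ?case
      using complexify_cscale_slot[OF assms(1), of k ?w "z k" "w k"] Suc by simp
  qed simp
  have "complexify N \<eta> (\<lambda>j. cscale (z j) (w j)) = complexify N \<eta> (\<lambda>j. if j < N then cscale (z j) (w j) else w j)"
    by (rule complexify_cong[OF loc]) simp
  then show ?thesis using *[of N] by simp
qed

text \<open>The rotation \<open>exp(tL) = cos t + sin t L\<close> multiplies vectors of type (1,0) by \<open>exp(\<i>t)\<close> and vectors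
  of type (0,1) by \<open>exp(-\<i>t)\<close>. On \<open>2p\<close> vectors of pure type, \<open>k\<close> of them of type (1,0), the form is multiplied by
  \<open>exp(2\<i>t(k - p))\<close>. If \<open>k \<noteq> p\<close>, some \<open>t\<close> makes this factor \<open>-1\<close>, and invariance makes the value zero.\<close>

lemma pp_form_rotation_invariant:
  assumes "multilinear (2 * p) \<eta>" and loc: "depends_on_first (2 * p) \<eta>" and "linear L"
    and inv: "\<And>t v. \<eta> (\<lambda>j. cos t *\<^sub>R v j + sin t *\<^sub>R L (v j)) = \<eta> v"
  shows "pp_form L p \<eta>"
  unfolding pp_form_def
proof (intro allI impI)
  fix S w
  assume S: "S \<subseteq> {..<2 * p}" "card S \<noteq> p" and 10: "\<forall>j\<in>S. type_10 L (w j)"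
    and 01: "\<forall>j\<in>{..<2 * p} - S. type_01 L (w j)"
  \<comment> \<open>The angle for which the total phase \<open>2t(card S - p)\<close> is \<open>\<pi>\<close>.\<close>
  define t where "t = pi / (2 * (real (card S) - real p))"
  define \<rho> where "\<rho> = (\<lambda>u. cos t *\<^sub>R u + sin t *\<^sub>R L u)"
  define z where "z = (\<lambda>j. if j \<in> S then cis t else cis (- t))"
  have "(\<lambda>j. if j \<in> S' then snd (\<rho> (fst (w j)), \<rho> (snd (w j))) else fst (\<rho> (fst (w j)), \<rho> (snd (w j)))) =
      (\<lambda>j. \<rho> ((\<lambda>j. if j \<in> S' then snd (w j) else fst (w j)) j))" for S'
    by auto
  moreover have "\<eta> (\<lambda>j. \<rho> (v j)) = \<eta> v" for v
    unfolding \<rho>_def by (rule inv)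
  ultimately have 1: "complexify (2 * p) \<eta> (\<lambda>j. (\<rho> (fst (w j)), \<rho> (snd (w j)))) = complexify (2 * p) \<eta> w"
    unfolding complexify_def by (simp only:)
  have 2: "complexify (2 * p) \<eta> (\<lambda>j. (\<rho> (fst (w j)), \<rho> (snd (w j)))) = complexify (2 * p) \<eta> (\<lambda>j. cscale (z j) (w j))"
  proof (rule complexify_cong[OF loc])
    fix j assume j: "j < 2 * p"
    show "(\<rho> (fst (w j)), \<rho> (snd (w j))) = cscale (z j) (w j)"
    proof (cases "j \<in> S")
      case True
      then have "L (fst (w j)) = - snd (w j)" "L (snd (w j)) = fst (w j)" using 10 by (auto simp: type_10_def)
      then show ?thesis using True by (simp add: \<rho>_def z_def cscale_def algebra_simps)
    next
      case False
      then have *: "L (fst (w j)) = snd (w j)" "L (- snd (w j)) = fst (w j)"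
        using 01 j by (auto simp: type_01_def type_10_def conj_vec_def)
      then have "L (snd (w j)) = - fst (w j)" using linear_neg[OF \<open>linear L\<close>, of "snd (w j)"] by (simp add: minus_equation_iff)
      then show ?thesis using False * by (simp add: \<rho>_def z_def cscale_def algebra_simps)
    qed
  qed
  have "complexify (2 * p) \<eta> w = (\<Prod>j<2 * p. z j) * complexify (2 * p) \<eta> w"
    using 1 2 complexify_cscale[OF assms(1) loc] by metis
  moreover have "(\<Prod>j<2 * p. z j) = -1"
  proof -
    have fin: "finite S" using S(1) finite_subset by blast
    have le: "card S \<le> 2 * p" using card_mono[OF _ S(1)] by simp
    have "(\<Prod>j<2 * p. z j) = (\<Prod>j\<in>S. z j) * (\<Prod>j\<in>{..<2 * p} - S. z j)"
      using prod.subset_diff[OF S(1), of z] by (simp add: mult.commute)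
    also have "(\<Prod>j\<in>S. z j) = cis t ^ card S" by (simp add: z_def)
    also have "(\<Prod>j\<in>{..<2 * p} - S. z j) = cis (- t) ^ (2 * p - card S)"
      using card_Diff_subset[OF fin S(1)] by (simp add: z_def)
    also have "cis t ^ card S * cis (- t) ^ (2 * p - card S) = cis (real (card S) * t + real (2 * p - card S) * (- t))"
      by (simp only: Complex.DeMoivre cis_mult)
    also have "real (card S) * t + real (2 * p - card S) * (- t) = 2 * (real (card S) - real p) * t"
      using le by (simp add: of_nat_diff algebra_simps)
    also have "\<dots> = pi" using S(2) by (simp add: t_def)
    finally show ?thesis by simp
  qed
  ultimately have "complexify (2 * p) \<eta> w = - complexify (2 * p) \<eta> w" by simp
  then show "complexify (2 * p) \<eta> w = 0" by simp
qed

lemma complexify_real_slot: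
  assumes "multilinear N \<eta>" "j < N"
  shows "linear (\<lambda>x. complexify N \<eta> (w(j := (x, 0))))"
    and "complexify N \<eta> (w(j := (a, b))) = complexify N \<eta> (w(j := (a, 0))) + \<i> * complexify N \<eta> (w(j := (b, 0)))"
proof -
  have l: "linear (\<lambda>x. \<eta> (v(j := x)))" for v using assms by (simp add: multilinear_def)
  have eq: "complexify N \<eta> (w(j := (x, 0))) = (\<Sum>S\<in>Pow ({..<N} - {j}). \<i> ^ card S *
      \<eta> ((\<lambda>k. if k \<in> S then snd (w k) else fst (w k))(j := x)))" for x
    by (simp add: complexify_split[OF assms(2)] linear_0[OF l])
  show "linear (\<lambda>x. complexify N \<eta> (w(j := (x, 0))))"
    unfolding eq by (rule linear_compose_sum) (auto intro!: linearI simp: linear_add[OF l] linear_scale[OF l] algebra_simps)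
  show "complexify N \<eta> (w(j := (a, b))) = complexify N \<eta> (w(j := (a, 0))) + \<i> * complexify N \<eta> (w(j := (b, 0)))"
    unfolding eq by (simp add: complexify_split[OF assms(2)] sum_distrib_left sum.distrib algebra_simps)
qed

lemma complexify_real_repeated:
  assumes "alternating N \<eta>" "i < N" "j < N" "i \<noteq> j" "w i = (a, 0)" "w j = (a, 0)"
  shows "complexify N \<eta> w = 0"
  unfolding complexify_def
proof (rule sum.neutral, rule ballI)
  fix S
  let ?v = "\<lambda>j. if j \<in> S then snd (w j) else fst (w j)"
  have z: "\<eta> ?v = 0" if "k < N" "?v k = 0" for k
  proof -
    have "?v = ?v(k := 0)" using that(2) by (auto simp: fun_eq_iff)
    then show ?thesis using linear_0[OF alternating_linear[OF assms(1) that(1)], of ?v] by simp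
  qed
  have "\<eta> ?v = 0"
  proof (cases "i \<in> S \<or> j \<in> S")
    case True
    then show ?thesis using z[of i] z[of j] assms by auto
  next
    case False
    then show ?thesis using assms by (intro alternating_eq_0[OF assms(1-4)]) auto
  qed
  then show "\<i> ^ card S * \<eta> ?v = 0" by simp
qed

text \<open>The identity \<open>(a - \<i>b) \<and> (a + \<i>b) = 2\<i> a \<and> b\<close> in two slots of an alternating form.\<close>

lemma complexify_conjugate_pair:
  fixes \<eta> :: "(nat \<Rightarrow> 'e::real_vector) \<Rightarrow> complex"
  assumes \<eta>: "alternating N \<eta>" and ij: "i < N" "j < N" "i \<noteq> j"
  shows "complexify N \<eta> (w(i := (a, - b), j := (a, b))) = 2 * \<i> * complexify N \<eta> (w(i := (a, 0), j := (b, 0)))"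
proof -
  have m: "multilinear N \<eta>" using \<eta> by (simp add: alternating_def)
  define Q where "Q = (\<lambda>x y. complexify N \<eta> (w(i := (x, 0), j := (y, 0))))"
  have tw: "w(i := x, j := y) = w(j := y, i := x)" for x y using ij by (simp add: fun_upd_twist)
  have l1: "linear (\<lambda>x. Q x y)" for y unfolding Q_def tw by (rule complexify_real_slot[OF m ij(1)])
  have l2: "linear (\<lambda>y. Q x y)" for x unfolding Q_def by (rule complexify_real_slot[OF m ij(2)])
  have z: "Q x x = 0" for x unfolding Q_def using ij by (intro complexify_real_repeated[OF \<eta> ij, where a = x]) auto
  have "Q (x + y) (x + y) = Q x y + Q y x" for x y
    using z[of x] z[of y] by (simp add: linear_add[OF l1] linear_add[OF l2])
  then have "Q y x + Q x y = 0" for x y using z by metis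
  then have anti: "Q y x = - Q x y" for x y by (simp add: eq_neg_iff_add_eq_0)
  have "complexify N \<eta> (w(i := (a, - b), j := (a, b))) =
      complexify N \<eta> (w(j := (a, 0), i := (a, - b))) + \<i> * complexify N \<eta> (w(j := (b, 0), i := (a, - b)))"
    by (subst complexify_real_slot(2)[OF m ij(2)]) (simp add: tw)
  also have "\<dots> = Q a a + \<i> * Q (- b) a + \<i> * (Q a b + \<i> * Q (- b) b)"
    unfolding Q_def tw by (subst (1 2) complexify_real_slot(2)[OF m ij(1)]) simp
  also have "\<dots> = 2 * \<i> * Q a b" by (simp add: z linear_neg[OF l1] anti[of a b])
  finally show ?thesis by (simp add: Q_def)
qed

text \<open>Reduces the positivity condition to real arguments: the vector \<open>(a, b)\<close> of type (1,0) has \<open>b = - L a\<close>, and the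
  identity for one conjugate pair is applied to the \<open>p\<close> pairs in turn.\<close>

lemma complexify_conjugate_pairs:
  fixes \<eta> :: "(nat \<Rightarrow> 'e::real_vector) \<Rightarrow> complex"
  assumes \<eta>: "alternating (2 * p) \<eta>" and loc: "depends_on_first (2 * p) \<eta>"
    and \<alpha>: "\<And>j. j < p \<Longrightarrow> type_10 L (\<alpha> j)"
  shows "complexify (2 * p) \<eta> (\<lambda>j. if even j then \<alpha> (j div 2) else conj_vec (\<alpha> (j div 2))) =
    (2 * \<i>) ^ p * \<eta> (doubled L (\<lambda>j. fst (\<alpha> j)))"
proof -
  let ?w = "\<lambda>j. if even j then \<alpha> (j div 2) else conj_vec (\<alpha> (j div 2))"
  let ?d = "\<lambda>j. (doubled L (\<lambda>j. fst (\<alpha> j)) j, 0::'e)"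
  let ?f = "\<lambda>S. \<i> ^ card S * \<eta> (\<lambda>j. if j \<in> S then snd (?d j) else fst (?d j))"
  have step: "complexify (2 * p) \<eta> ?w = (2 * \<i>) ^ k * complexify (2 * p) \<eta> (\<lambda>j. if j < 2 * k then ?d j else ?w j)"
    if "k \<le> p" for k
    using that
  proof (induction k)
    case (Suc k)
    let ?wk = "\<lambda>j. if j < 2 * k then ?d j else ?w j"
    obtain a b where ab: "\<alpha> k = (a, b)" by fastforce
    have La: "L a = - b" using \<alpha>[of k] Suc.prems ab by (simp add: type_10_def)
    have "?wk = ?wk(2 * k := (a, - (- b)), Suc (2 * k) := (a, - b))"
      using ab by (auto simp: fun_eq_iff conj_vec_def)
    then have "complexify (2 * p) \<eta> ?wk = 2 * \<i> * complexify (2 * p) \<eta> (?wk(2 * k := (a, 0), Suc (2 * k) := (- b, 0)))"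
      using complexify_conjugate_pair[OF \<eta>, of "2 * k" "Suc (2 * k)" ?wk a "- b"] Suc.prems by simp
    moreover have "?wk(2 * k := (a, 0), Suc (2 * k) := (- b, 0)) = (\<lambda>j. if j < 2 * Suc k then ?d j else ?w j)"
      using ab La by (auto simp: fun_eq_iff less_Suc_eq)
    ultimately show ?case using Suc by simp
  qed simp
  have "complexify (2 * p) \<eta> (\<lambda>j. if j < 2 * p then ?d j else ?w j) = complexify (2 * p) \<eta> ?d"
    by (rule complexify_cong[OF loc]) simp
  also have "\<dots> = (\<Sum>S\<in>Pow {..<2 * p}. ?f S)"
    by (simp only: complexify_def)
  also have "\<dots> = (\<Sum>S\<in>{{}}. ?f S)"
  proof (rule sum.mono_neutral_right)
    show "\<forall>S\<in>Pow {..<2 * p} - {{}}. ?f S = 0"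
    proof
      fix S assume "S \<in> Pow {..<2 * p} - {{}}"
      then obtain k where k: "k \<in> S" "k < 2 * p" by auto
      let ?v = "\<lambda>j. if j \<in> S then snd (?d j) else fst (?d j)"
      have "?v = ?v(k := 0)" using k by (auto simp: fun_eq_iff)
      then have "\<eta> ?v = 0" using linear_0[OF alternating_linear[OF \<eta> k(2)], of ?v] by simp
      then show "\<i> ^ card S * \<eta> ?v = 0" by simp
    qed
  qed auto
  finally show ?thesis using step[of p] by simp
qed

section \<open>Alternations with powers of the Kaehler form on a unitary frame\<close>

text \<open>The 24 permutations split into three cosets of the group of order eight that preserves the partition
  \<open>{{0,1},{2,3}}\<close>. The assumed symmetries say that this group acts on \<open>f\<close> by its sign, so each coset contributes
  eight equal terms.\<close>

lemma alternate_4_curvature_symmetric: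
  fixes f :: "'e \<Rightarrow> 'e \<Rightarrow> 'e \<Rightarrow> 'e \<Rightarrow> real"
  assumes s1: "\<And>x y z w. f y x z w = - f x y z w" and s2: "\<And>x y z w. f x y w z = - f x y z w"
    and s3: "\<And>x y z w. f z w x y = f x y z w"
  shows "alternate 4 (\<lambda>v. f (v 0) (v 1) (v 2) (v 3)) v =
    8 * (f (v 0) (v 1) (v 2) (v 3) - f (v 0) (v 2) (v 1) (v 3) + f (v 0) (v 3) (v 1) (v 2))"
proof -
  have set4: "{..<4::nat} = insert 0 (insert 1 (insert 2 {3}))" by auto
  have ins: "finite {1, 2, 3::nat}" "(0::nat) \<notin> {1, 2, 3}" "finite {2, 3::nat}" "(1::nat) \<notin> {2, 3}"
    "finite {3::nat}" "(2::nat) \<notin> {3}" by auto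
  define a b c d where "a = v 0" and "b = v (Suc 0)" and "c = v 2" and "d = v 3"
  have eqs: "f a b d c = - f a b c d"
      "f a c d b = - f a c b d"
      "f a d c b = - f a d b c"
      "f b a c d = - f a b c d"
      "f b a d c = f a b c d"
      "f b c a d = f a d b c"
      "f b c d a = - f a d b c"
      "f b d a c = f a c b d"
      "f b d c a = - f a c b d"
      "f c a b d = - f a c b d"
      "f c a d b = f a c b d"
      "f c b a d = - f a d b c"
      "f c b d a = f a d b c"
      "f c d a b = f a b c d"
      "f c d b a = - f a b c d"
      "f d a b c = - f a d b c"
      "f d a c b = f a d b c"
      "f d b a c = - f a c b d"
      "f d b c a = f a c b d"
      "f d c a b = - f a b c d"
      "f d c b a = f a b c d"
    by (metis s1 s2 s3)+
  show ?thesis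
    unfolding alternate_def set4
    unfolding sum_over_permutations_insert[OF ins(1,2)]
    unfolding sum_over_permutations_insert[OF ins(3,4)]
    unfolding sum_over_permutations_insert[OF ins(5,6)]
    unfolding permutes_sing
    by (simp add: sign_swap_id permutation_swap_id sign_compose permutation_compose swap_id_eq
        a_def[symmetric] b_def[symmetric] c_def[symmetric] d_def[symmetric])
      (insert eqs, linarith)
qed

text \<open>Exchanging the pairs \<open>(2i, 2i+1)\<close> and \<open>(2q, 2q+1)\<close> is an even permutation. It carries the doubled
  frame of \<open>e\<close> to that of \<open>e\<close> with two entries exchanged.\<close>

lemma permutes_double_swap:
  assumes "i \<le> q"
  defines "\<tau> \<equiv> Transposition.transpose (2 * i) (2 * q) \<circ> Transposition.transpose (Suc (2 * i)) (Suc (2 * q))"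
  shows "\<tau> permutes {..<2 * q + 2}" "sign \<tau> = 1" "\<tau> \<circ> \<tau> = id"
    and "\<tau> (2 * q) = 2 * i" "\<tau> (Suc (2 * q)) = Suc (2 * i)"
    and "(\<lambda>k. doubled L e (\<tau> k)) = doubled L (e \<circ> Transposition.transpose i q)"
proof -
  show 1: "\<tau> permutes {..<2 * q + 2}"
    unfolding \<tau>_def using assms(1) by (intro permutes_compose permutes_swap_id) auto
  show "sign \<tau> = 1" unfolding \<tau>_def by (auto simp: sign_compose permutation_swap_id sign_swap_id)
  have par: "2 * x \<noteq> Suc (2 * y)" "Suc (2 * y) \<noteq> 2 * x" for x y :: nat by presburger+
  show 2: "\<tau> (2 * q) = 2 * i" "\<tau> (Suc (2 * q)) = Suc (2 * i)"
    unfolding \<tau>_def by (auto simp: Transposition.transpose_def par)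
  have \<tau>2: "\<tau> (2 * k) = 2 * Transposition.transpose i q k" "\<tau> (Suc (2 * k)) = Suc (2 * Transposition.transpose i q k)" for k
    unfolding \<tau>_def by (auto simp: Transposition.transpose_def par)
  have cases2: "\<exists>j. k = 2 * j \<or> k = Suc (2 * j)" for k :: nat by presburger
  show "\<tau> \<circ> \<tau> = id"
  proof (rule ext)
    fix k
    obtain j where "k = 2 * j \<or> k = Suc (2 * j)" using cases2 by blast
    then show "(\<tau> \<circ> \<tau>) k = id k" by (auto simp: \<tau>2)
  qed
  show "(\<lambda>k. doubled L e (\<tau> k)) = doubled L (e \<circ> Transposition.transpose i q)"
  proof (rule ext)
    fix k
    obtain j where "k = 2 * j \<or> k = Suc (2 * j)" using cases2 by blast
    then show "doubled L e (\<tau> k) = doubled L (e \<circ> Transposition.transpose i q) k" by (auto simp: \<tau>2)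
  qed
qed

text \<open>The hypotheses on \<open>w\<close> are the values of the Kaehler form on a unitary family. A permutation \<open>\<sigma>\<close> contributes only if it
  sends the last two indices to a pair \<open>{2i, 2i+1}\<close>. Both orders contribute the same, as the sign of \<open>\<sigma>\<close>
  and the sign of \<open>w\<close> change together; this is the factor 2. Moving that pair to the end by an even permutation leaves an
  alternation over the remaining \<open>2q\<close> indices.\<close>

lemma alternate_peel_pair:
  fixes F :: "(nat \<Rightarrow> 'e) \<Rightarrow> real" and w :: "'e \<Rightarrow> 'e \<Rightarrow> real"
  assumes F: "depends_on_first (2 * q) F"
    and w: "\<And>j k. j \<le> q \<Longrightarrow> k \<le> q \<Longrightarrow> w (e j) (e k) = 0"
      "\<And>j k. j \<le> q \<Longrightarrow> k \<le> q \<Longrightarrow> w (L (e j)) (L (e k)) = 0"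
      "\<And>j k. j \<le> q \<Longrightarrow> k \<le> q \<Longrightarrow> w (e j) (L (e k)) = (if j = k then 1 else 0)"
      "\<And>j k. j \<le> q \<Longrightarrow> k \<le> q \<Longrightarrow> w (L (e j)) (e k) = (if j = k then - 1 else 0)"
  shows "alternate (2 * q + 2) (\<lambda>v. F v * w (v (2 * q)) (v (Suc (2 * q)))) (doubled L e) =
     2 * (\<Sum>i\<le>q. alternate (2 * q) F (doubled L (e \<circ> Transposition.transpose i q)))"
proof -
  define P where "P = {\<sigma>. \<sigma> permutes {..<2 * q + 2}}"
  let ?v = "doubled L e"
  define f where "f = (\<lambda>\<sigma>. of_int (sign \<sigma>) * (F (\<lambda>i. ?v (\<sigma> i)) * w (?v (\<sigma> (2 * q))) (?v (\<sigma> (Suc (2 * q))))))"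
  define A where "A = (\<lambda>i. {\<sigma> \<in> P. \<sigma> (2 * q) = 2 * i \<and> \<sigma> (Suc (2 * q)) = Suc (2 * i)})"
  define B where "B = (\<lambda>i. {\<sigma> \<in> P. \<sigma> (2 * q) = Suc (2 * i) \<and> \<sigma> (Suc (2 * q)) = 2 * i})"
  have finP: "finite P" unfolding P_def by (simp add: finite_permutations)
  have par: "2 * x \<noteq> Suc (2 * y)" "Suc (2 * y) \<noteq> 2 * x" for x y :: nat by presburger+
  have pair_index: "\<exists>j. (k = 2 * j \<or> k = Suc (2 * j)) \<and> j \<le> q" if "k < 2 * q + 2" for k :: nat
    using that by presburger
  have "alternate (2 * q + 2) (\<lambda>v. F v * w (v (2 * q)) (v (Suc (2 * q)))) ?v = sum f P"
    unfolding alternate_def P_def f_def by simp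
  also have "\<dots> = sum f (\<Union>i\<in>{..q}. A i \<union> B i)"
  proof (rule sum.mono_neutral_right)
    show "finite P" by (rule finP)
    show "(\<Union>i\<in>{..q}. A i \<union> B i) \<subseteq> P" unfolding A_def B_def by auto
    show "\<forall>\<sigma>\<in>P - (\<Union>i\<in>{..q}. A i \<union> B i). f \<sigma> = 0"
    proof
      fix \<sigma> assume \<sigma>: "\<sigma> \<in> P - (\<Union>i\<in>{..q}. A i \<union> B i)"
      then have lt: "\<sigma> (2 * q) < 2 * q + 2" "\<sigma> (Suc (2 * q)) < 2 * q + 2"
        using permutes_in_image[of \<sigma> "{..<2 * q + 2}"] unfolding P_def by auto
      obtain j where j: "\<sigma> (2 * q) = 2 * j \<or> \<sigma> (2 * q) = Suc (2 * j)" "j \<le> q"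
        using pair_index[OF lt(1)] by blast
      obtain k where k: "\<sigma> (Suc (2 * q)) = 2 * k \<or> \<sigma> (Suc (2 * q)) = Suc (2 * k)" "k \<le> q"
        using pair_index[OF lt(2)] by blast
      have "w (?v (\<sigma> (2 * q))) (?v (\<sigma> (Suc (2 * q)))) = 0"
      proof (cases "j = k")
        case False
        then show ?thesis using j k w[OF j(2) k(2)] by auto
      next
        case True
        have "inj \<sigma>" using \<sigma> unfolding P_def by (auto dest: permutes_inj)
        then have "\<sigma> (2 * q) \<noteq> \<sigma> (Suc (2 * q))"
          by (simp add: inj_eq)
        moreover have "\<not> (\<sigma> (2 * q) = 2 * j \<and> \<sigma> (Suc (2 * q)) = Suc (2 * j))"
          "\<not> (\<sigma> (2 * q) = Suc (2 * j) \<and> \<sigma> (Suc (2 * q)) = 2 * j)"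
          using \<sigma> j(2) unfolding A_def B_def by auto
        ultimately show ?thesis using True j k by auto
      qed
      then show "f \<sigma> = 0" by (simp add: f_def)
    qed
  qed
  also have "\<dots> = (\<Sum>i\<le>q. sum f (A i \<union> B i))"
    by (rule sum.UNION_disjoint) (use finP par in \<open>auto simp: A_def B_def\<close>)
  also have "\<dots> = (\<Sum>i\<le>q. sum f (A i) + sum f (B i))"
    by (intro sum.cong refl sum.union_disjoint) (use finP par in \<open>auto simp: A_def B_def\<close>)
  also have "\<dots> = (\<Sum>i\<le>q. 2 * alternate (2 * q) F (doubled L (e \<circ> Transposition.transpose i q)))"
  proof (intro sum.cong refl)
    fix i assume "i \<in> {..q}"
    then have i: "i \<le> q" by simp
    let ?t = "Transposition.transpose (2 * q) (Suc (2 * q))"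
    have t: "?t permutes {..<2 * q + 2}" by (rule permutes_swap_id) auto
    have AB: "sum f (B i) = sum f (A i)"
    proof (rule sum.reindex_bij_witness[where i = "\<lambda>\<sigma>. \<sigma> \<circ> ?t" and j = "\<lambda>\<sigma>. \<sigma> \<circ> ?t"])
      fix \<sigma> :: "nat \<Rightarrow> nat"
      show "\<sigma> \<circ> ?t \<circ> ?t = \<sigma>" "\<sigma> \<circ> ?t \<circ> ?t = \<sigma>" by (simp_all add: comp_assoc)
      show "\<sigma> \<circ> ?t \<in> A i" if "\<sigma> \<in> B i" using that t unfolding A_def B_def P_def by (auto intro: permutes_compose)
      show "\<sigma> \<circ> ?t \<in> B i" if "\<sigma> \<in> A i" using that t unfolding A_def B_def P_def by (auto intro: permutes_compose)
      show "f (\<sigma> \<circ> ?t) = f \<sigma>" if "\<sigma> \<in> B i"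
      proof -
        have "sign (\<sigma> \<circ> ?t) = - sign \<sigma>"
          using sign_compose_permutes[OF _ t, of \<sigma>] that by (simp add: B_def P_def sign_swap_id)
        moreover have "F (\<lambda>k. ?v ((\<sigma> \<circ> ?t) k)) = F (\<lambda>k. ?v (\<sigma> k))"
          using F unfolding depends_on_first_def by (auto simp: Transposition.transpose_def)
        ultimately show ?thesis
          using that w(3,4)[OF i i] unfolding f_def by (simp add: B_def)
      qed
    qed
    define \<tau> where "\<tau> = Transposition.transpose (2 * i) (2 * q) \<circ> Transposition.transpose (Suc (2 * i)) (Suc (2 * q))"
    note \<tau> = permutes_double_swap[OF i, folded \<tau>_def]
    have "sum f (A i) = (\<Sum>\<pi> | \<pi> permutes {..<2 * q}. of_int (sign \<pi>) * F (\<lambda>k. ?v (\<tau> (\<pi> k))))"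
    proof (rule sum.reindex_bij_witness[where i = "\<lambda>\<pi>. \<tau> \<circ> \<pi>" and j = "\<lambda>\<sigma>. \<tau> \<circ> \<sigma>"])
      fix \<sigma> :: "nat \<Rightarrow> nat"
      show "\<tau> \<circ> (\<tau> \<circ> \<sigma>) = \<sigma>" "\<tau> \<circ> (\<tau> \<circ> \<sigma>) = \<sigma>" by (simp_all add: \<tau>(3) comp_assoc[symmetric])
      show "\<tau> \<circ> \<sigma> \<in> {\<pi>. \<pi> permutes {..<2 * q}}" if "\<sigma> \<in> A i"
      proof -
        have perm: "\<tau> \<circ> \<sigma> permutes {..<2 * q + 2}" using that \<tau>(1) by (auto simp: A_def P_def intro: permutes_compose)
        have fixed: "(\<tau> \<circ> \<sigma>) (2 * q) = 2 * q" "(\<tau> \<circ> \<sigma>) (Suc (2 * q)) = Suc (2 * q)"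
          using that \<tau>(4,5) fun_cong[OF \<tau>(3), of "2 * q"] fun_cong[OF \<tau>(3), of "Suc (2 * q)"] by (auto simp: A_def)
        have "\<tau> \<circ> \<sigma> permutes {..<2 * q}"
          by (rule permutes_superset[OF perm]) (use fixed in \<open>auto simp: less_Suc_eq\<close>)
        then show ?thesis by simp
      qed
      show "\<tau> \<circ> \<sigma> \<in> A i" if "\<sigma> \<in> {\<pi>. \<pi> permutes {..<2 * q}}"
      proof -
        have "\<sigma> permutes {..<2 * q + 2}" "\<sigma> (2 * q) = 2 * q" "\<sigma> (Suc (2 * q)) = Suc (2 * q)"
          using that by (auto intro: permutes_subset permutes_not_in)
        then show ?thesis using \<tau>(1,4,5) by (auto simp: A_def P_def intro: permutes_compose)
      qed
      show "of_int (sign (\<tau> \<circ> \<sigma>)) * F (\<lambda>k. ?v (\<tau> ((\<tau> \<circ> \<sigma>) k))) = f \<sigma>" if "\<sigma> \<in> A i"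
      proof -
        have "sign (\<tau> \<circ> \<sigma>) = sign \<sigma>"
          using sign_compose_permutes[OF \<tau>(1), of \<sigma>] that by (simp add: A_def P_def \<tau>(2))
        moreover have "\<tau> (\<tau> k) = k" for k using fun_cong[OF \<tau>(3), of k] by simp
        ultimately show ?thesis
          using that w(3)[OF i i] unfolding f_def by (simp add: A_def)
      qed
    qed
    also have "\<dots> = alternate (2 * q) F (doubled L (e \<circ> Transposition.transpose i q))"
      unfolding alternate_def \<tau>(6)[symmetric] by simp
    finally show "sum f (A i) + sum f (B i) = 2 * alternate (2 * q) F (doubled L (e \<circ> Transposition.transpose i q))"
      using AB by simp
  qed
  finally show ?thesis by (simp add: sum_distrib_left)
qed

lemma depends_on_first_alternate:
  assumes "depends_on_first N F"
  shows "depends_on_first N (alternate N F)"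
  unfolding depends_on_first_def
proof (intro allI impI)
  fix v w :: "nat \<Rightarrow> 'a" assume vw: "\<forall>i<N. v i = w i"
  have "F (\<lambda>i. v (\<sigma> i)) = F (\<lambda>i. w (\<sigma> i))" if "\<sigma> permutes {..<N}" for \<sigma>
    using assms vw permutes_in_image[OF that] unfolding depends_on_first_def by (metis lessThan_iff)
  then show "alternate N F v = alternate N F w" by (simp add: alternate_def)
qed

lemma alternate_doubled_swap:
  assumes "i \<le> q" "q < p"
  shows "alternate (2 * p) F (doubled L (e \<circ> Transposition.transpose i q)) = alternate (2 * p) F (doubled L e)"
proof -
  define \<tau> where "\<tau> = Transposition.transpose (2 * i) (2 * q) \<circ> Transposition.transpose (Suc (2 * i)) (Suc (2 * q))"
  note \<tau> = permutes_double_swap[OF assms(1), folded \<tau>_def]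
  have "{..<2 * q + 2} \<subseteq> {..<2 * p}" using assms(2) by auto
  then have "\<tau> permutes {..<2 * p}" by (rule permutes_subset[OF \<tau>(1)])
  then show ?thesis using alternate_permute[of \<tau> "2 * p" F "doubled L e"] by (simp add: \<tau>(2,6))
qed

definition off_diagonal :: "nat \<Rightarrow> (nat \<times> nat) set" where
  "off_diagonal n = {(j, k). j < n \<and> k < n \<and> j \<noteq> k}"

lemma off_diagonal_subset: "off_diagonal n \<subseteq> {..<n} \<times> {..<n}"
  by (auto simp: off_diagonal_def)

lemma finite_off_diagonal [simp]: "finite (off_diagonal n)"
  by (rule finite_subset[OF off_diagonal_subset]) simp

text \<open>Transposing \<open>i\<close> and \<open>n\<close> maps \<open>{..<n}\<close> onto \<open>{..n}\<close> without \<open>i\<close>. Summed over \<open>i\<close>, a pair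
  \<open>(j, k)\<close> of different indices occurs once for each \<open>i\<close> other than \<open>j\<close> and \<open>k\<close>.\<close>

lemma sum_off_diagonal_delete:
  fixes f :: "nat \<Rightarrow> nat \<Rightarrow> real"
  shows "(\<Sum>i\<le>n. \<Sum>(j, k)\<in>off_diagonal n. f (Transposition.transpose i n j) (Transposition.transpose i n k)) =
    (real n - 1) * (\<Sum>(j, k)\<in>off_diagonal (Suc n). f j k)"
proof -
  let ?D = "off_diagonal (Suc n)"
  have "(\<Sum>(j, k)\<in>off_diagonal n. f (Transposition.transpose i n j) (Transposition.transpose i n k)) =
      (\<Sum>x\<in>?D. if i \<noteq> fst x \<and> i \<noteq> snd x then f (fst x) (snd x) else 0)" if i: "i \<le> n" for i
  proof -
    let ?t = "Transposition.transpose i n"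
    have "(\<Sum>(j, k)\<in>off_diagonal n. f (?t j) (?t k)) = (\<Sum>x\<in>{x\<in>?D. i \<noteq> fst x \<and> i \<noteq> snd x}. f (fst x) (snd x))"
    proof (rule sum.reindex_bij_witness[where i = "\<lambda>(j, k). (?t j, ?t k)" and j = "\<lambda>(j, k). (?t j, ?t k)"])
      fix x :: "nat \<times> nat"
      show "(case (case x of (j, k) \<Rightarrow> (?t j, ?t k)) of (j, k) \<Rightarrow> (?t j, ?t k)) = x"
        "(case (case x of (j, k) \<Rightarrow> (?t j, ?t k)) of (j, k) \<Rightarrow> (?t j, ?t k)) = x"
        by (simp_all add: case_prod_beta)
      have lt: "?t j < Suc n" if "j < Suc n" for j using that i by (auto simp: Transposition.transpose_def)
      have ne: "?t j \<noteq> i" if "j < n" for j using that i by (auto simp: Transposition.transpose_def)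
      have lt': "?t j < n" if "j < Suc n" "j \<noteq> i" for j using that i by (auto simp: Transposition.transpose_def)
      have inj: "?t j = ?t k \<longleftrightarrow> j = k" for j k by (metis Transposition.transpose_involutory)
      show "(case x of (j, k) \<Rightarrow> (?t j, ?t k)) \<in> {x\<in>?D. i \<noteq> fst x \<and> i \<noteq> snd x}" if "x \<in> off_diagonal n"
      proof -
        obtain j k where x: "x = (j, k)" "j < n" "k < n" "j \<noteq> k"
          using \<open>x \<in> off_diagonal n\<close> by (auto simp: off_diagonal_def)
        then show ?thesis
          using lt[of j] lt[of k] ne[of j] ne[of k] inj[of j k] by (simp add: off_diagonal_def eq_commute[of i])
      qed
      show "(case x of (j, k) \<Rightarrow> (?t j, ?t k)) \<in> off_diagonal n" if "x \<in> {x\<in>?D. i \<noteq> fst x \<and> i \<noteq> snd x}"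
      proof -
        obtain j k where x: "x = (j, k)" "j < Suc n" "k < Suc n" "j \<noteq> k" "j \<noteq> i" "k \<noteq> i"
          using \<open>x \<in> {x\<in>?D. i \<noteq> fst x \<and> i \<noteq> snd x}\<close> by (auto simp: off_diagonal_def)
        then show ?thesis
          using lt'[of j] lt'[of k] inj[of j k] by (simp add: off_diagonal_def)
      qed
    qed (auto simp: case_prod_beta)
    also have "\<dots> = (\<Sum>x\<in>?D. if i \<noteq> fst x \<and> i \<noteq> snd x then f (fst x) (snd x) else 0)"
      by (rule sum.inter_filter) simp
    finally show ?thesis .
  qed
  then have "(\<Sum>i\<le>n. \<Sum>(j, k)\<in>off_diagonal n. f (Transposition.transpose i n j) (Transposition.transpose i n k)) =
      (\<Sum>x\<in>?D. \<Sum>i\<le>n. if i \<noteq> fst x \<and> i \<noteq> snd x then f (fst x) (snd x) else 0)"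
    by (subst sum.swap) simp
  also have "\<dots> = (\<Sum>x\<in>?D. (real n - 1) * f (fst x) (snd x))"
  proof (rule sum.cong[OF refl])
    fix x assume "x \<in> ?D"
    then have x: "fst x \<le> n" "snd x \<le> n" "fst x \<noteq> snd x" by (auto simp: off_diagonal_def)
    have "(\<Sum>i\<le>n. if i \<noteq> fst x \<and> i \<noteq> snd x then f (fst x) (snd x) else 0) =
        (\<Sum>i\<in>{..n} - {fst x, snd x}. f (fst x) (snd x))"
      by (rule sum.mono_neutral_cong_right) auto
    moreover have "card ({..n} - {fst x, snd x}) = Suc n - 2"
      using x by (subst card_Diff_subset) auto
    moreover have "n \<ge> 1" using x by auto
    ultimately show "(\<Sum>i\<le>n. if i \<noteq> fst x \<and> i \<noteq> snd x then f (fst x) (snd x) else 0) = (real n - 1) * f (fst x) (snd x)"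
      by (simp add: of_nat_diff)
  qed
  finally show ?thesis by (simp add: sum_distrib_left case_prod_beta)
qed

definition pair_value :: "((nat \<Rightarrow> 'e) \<Rightarrow> real) \<Rightarrow> ('e \<Rightarrow> 'e) \<Rightarrow> 'e \<Rightarrow> 'e \<Rightarrow> real" where
  "pair_value F L x y = alternate 4 F (doubled L (\<lambda>i. if i = 0 then x else y))"

text \<open>Each step of the induction peels one factor \<open>w\<close> off and deletes one pair of the frame. Every pair
  of different indices survives in \<open>m!\<close> orders of deletion. Both orders of a pair of indices give the same value of the
  4-form, hence the factor \<open>1/2\<close>.\<close>

lemma alternate_power_on_frame:
  fixes F :: "(nat \<Rightarrow> 'e) \<Rightarrow> real" and w :: "'e \<Rightarrow> 'e \<Rightarrow> real"
  assumes F: "depends_on_first 4 F"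
    and w: "\<And>j k. j < m + 2 \<Longrightarrow> k < m + 2 \<Longrightarrow> w (e j) (e k) = 0"
      "\<And>j k. j < m + 2 \<Longrightarrow> k < m + 2 \<Longrightarrow> w (L (e j)) (L (e k)) = 0"
      "\<And>j k. j < m + 2 \<Longrightarrow> k < m + 2 \<Longrightarrow> w (e j) (L (e k)) = (if j = k then 1 else 0)"
      "\<And>j k. j < m + 2 \<Longrightarrow> k < m + 2 \<Longrightarrow> w (L (e j)) (e k) = (if j = k then - 1 else 0)"
  shows "alternate (4 + 2 * m) (\<lambda>v. F v * (\<Prod>k<m. w (v (4 + 2 * k)) (v (4 + 2 * k + 1)))) (doubled L e) =
     2 ^ m * fact m * (\<Sum>(j, k)\<in>off_diagonal (m + 2). pair_value F L (e j) (e k) / 2)"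
  using w
proof (induction m arbitrary: e)
  case 0
  have loc: "alternate 4 F (doubled L x) = alternate 4 F (doubled L y)" if "x 0 = y 0" "x 1 = y 1" for x y
  proof -
    have "doubled L x i = doubled L y i" if "i < 4" for i
    proof -
      have "i = 2 * 0 \<or> i = Suc (2 * 0) \<or> i = 2 * 1 \<or> i = Suc (2 * 1)" using that by auto
      then show ?thesis using \<open>x 0 = y 0\<close> \<open>x 1 = y 1\<close> by (elim disjE; simp only: doubled_simps)
    qed
    then show ?thesis using depends_on_first_alternate[OF F] unfolding depends_on_first_def by blast
  qed
  have D: "off_diagonal (Suc (Suc 0)) = {(0, 1), (1, 0)}" by (auto simp: off_diagonal_def)
  have "pair_value F L (e 0) (e 1) = alternate 4 F (doubled L e)"
    unfolding pair_value_def by (rule loc) auto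
  moreover have "pair_value F L (e 1) (e 0) = alternate 4 F (doubled L (e \<circ> Transposition.transpose 0 1))"
    unfolding pair_value_def by (rule loc) auto
  moreover have "alternate 4 F (doubled L (e \<circ> Transposition.transpose 0 1)) = alternate 4 F (doubled L e)"
    using alternate_doubled_swap[of 0 1 2 F L e] by simp
  ultimately show ?case by (simp add: D)
next
  case (Suc m)
  let ?q = "m + 2"
  let ?G = "\<lambda>v. F v * (\<Prod>k<m. w (v (4 + 2 * k)) (v (4 + 2 * k + 1)))"
  have locG: "depends_on_first (2 * ?q) ?G"
  proof -
    have "(\<Prod>k<m. w (v (4 + 2 * k)) (v (4 + 2 * k + 1))) = (\<Prod>k<m. w (u (4 + 2 * k)) (u (4 + 2 * k + 1)))"
      if "\<forall>i<2 * ?q. v i = u i" for u v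
      using that by (intro prod.cong) auto
    moreover have "F v = F u" if "\<forall>i<2 * ?q. v i = u i" for u v
      using that F unfolding depends_on_first_def by auto
    ultimately show ?thesis unfolding depends_on_first_def by (metis (no_types, lifting))
  qed
  have "alternate (4 + 2 * Suc m) (\<lambda>v. F v * (\<Prod>k<Suc m. w (v (4 + 2 * k)) (v (4 + 2 * k + 1)))) (doubled L e) =
      alternate (2 * ?q + 2) (\<lambda>v. ?G v * w (v (2 * ?q)) (v (Suc (2 * ?q)))) (doubled L e)"
  proof -
    have "4 + 2 * Suc m = 2 * ?q + 2" "2 * ?q = 4 + 2 * m" "Suc (2 * ?q) = 4 + 2 * m + 1" by simp_all
    then show ?thesis by (simp only: prod.lessThan_Suc mult.assoc)
  qed
  also have "\<dots> = 2 * (\<Sum>i\<le>?q. alternate (2 * ?q) ?G (doubled L (e \<circ> Transposition.transpose i ?q)))"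
    by (rule alternate_peel_pair[OF locG]) (use Suc.prems in auto)
  also have "\<dots> = 2 * (\<Sum>i\<le>?q. 2 ^ m * fact m * (\<Sum>(j, k)\<in>off_diagonal ?q.
      pair_value F L (e (Transposition.transpose i ?q j)) (e (Transposition.transpose i ?q k)) / 2))"
  proof (intro arg_cong[of _ _ "\<lambda>x. 2 * x"] sum.cong refl)
    fix i assume "i \<in> {..?q}"
    then have lt: "Transposition.transpose i ?q j < Suc m + 2" if "j < m + 2" for j
      using that by (auto simp: Transposition.transpose_def)
    have N: "2 * ?q = 4 + 2 * m" by simp
    have inj: "Transposition.transpose i ?q j = Transposition.transpose i ?q k \<longleftrightarrow> j = k" for j k
      by (metis Transposition.transpose_involutory)
    show "alternate (2 * ?q) ?G (doubled L (e \<circ> Transposition.transpose i ?q)) =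
      2 ^ m * fact m * (\<Sum>(j, k)\<in>off_diagonal ?q.
        pair_value F L (e (Transposition.transpose i ?q j)) (e (Transposition.transpose i ?q k)) / 2)"
      unfolding N
      by (subst Suc.IH) (simp_all only: o_apply Suc.prems lt inj)
  qed
  also have "\<dots> = 2 ^ Suc m * fact m * ((real ?q - 1) * (\<Sum>(j, k)\<in>off_diagonal (Suc ?q). pair_value F L (e j) (e k) / 2))"
    unfolding sum_distrib_left[symmetric] by (subst sum_off_diagonal_delete) simp
  also have "\<dots> = 2 ^ Suc m * fact (Suc m) * (\<Sum>(j, k)\<in>off_diagonal (Suc m + 2). pair_value F L (e j) (e k) / 2)"
    by (simp add: algebra_simps)
  finally show ?case .
qed

section \<open>Orthonormal and unitary frames\<close>

text \<open>The metrics \<open>g p\<close> and the real parts of Hermitian metrics are inner products on a Euclidean space that differ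
  from its own one, so the Gram-Schmidt process is developed for an arbitrary positive definite form.\<close>

locale inner_form =
  fixes g :: "'e::euclidean_space \<Rightarrow> 'e \<Rightarrow> real"
  assumes bilinear: "bilinear g" and sym: "g u v = g v u" and pos: "u \<noteq> 0 \<Longrightarrow> g u u > 0"
begin

lemma lin: "linear (\<lambda>u. g u v)" "linear (g u)"
  using bilinear by (auto simp: bilinear_def)

lemmas g_simps = linear_add[OF lin(1)] linear_add[OF lin(2)] linear_scale[OF lin(1)] linear_scale[OF lin(2)]
  linear_diff[OF lin(1)] linear_diff[OF lin(2)] linear_sum[OF lin(1)] linear_sum[OF lin(2)]
  linear_0[OF lin(1)] linear_0[OF lin(2)] linear_neg[OF lin(1)] linear_neg[OF lin(2)]

lemma nonneg: "g u u \<ge> 0"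
  using pos[of u] by (cases "u = 0") (auto simp: g_simps)

definition orthonormal :: "nat \<Rightarrow> (nat \<Rightarrow> 'e) \<Rightarrow> bool" where
  "orthonormal N f \<longleftrightarrow> (\<forall>i<N. \<forall>j<N. g (f i) (f j) = (if i = j then 1 else 0))"

lemma orthonormal_independent:
  assumes "orthonormal N f"
  shows "inj_on f {..<N}" "independent (f ` {..<N})"
proof -
  show inj: "inj_on f {..<N}"
    using assms unfolding orthonormal_def inj_on_def by (metis lessThan_iff zero_neq_one)
  show "independent (f ` {..<N})"
  proof (rule independent_if_scalars_zero)
    fix c x assume s: "(\<Sum>x\<in>f ` {..<N}. c x *\<^sub>R x) = 0" and "x \<in> f ` {..<N}"
    then obtain i where i: "i < N" "x = f i" by auto
    have "0 = g (\<Sum>x\<in>f ` {..<N}. c x *\<^sub>R x) (f i)" using s by (simp add: g_simps)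
    also have "\<dots> = (\<Sum>j<N. c (f j) * g (f j) (f i))" by (simp add: g_simps sum.reindex[OF inj])
    also have "\<dots> = (\<Sum>j<N. if j = i then c (f i) else 0)"
      using assms i by (intro sum.cong) (auto simp: orthonormal_def)
    finally show "c x = 0" using i by simp
  qed simp
qed

lemma orthonormal_card_le: "orthonormal N f \<Longrightarrow> N \<le> DIM('e)"
  using orthonormal_independent[of N f] independent_bound[of "f ` {..<N}"] by (simp add: card_image)

lemma orthonormal_residual:
  assumes "orthonormal N f" "j < N"
  shows "g (x - (\<Sum>i<N. g x (f i) *\<^sub>R f i)) (f j) = 0"
proof -
  have "(\<Sum>i<N. g x (f i) * g (f i) (f j)) = (\<Sum>i<N. if i = j then g x (f j) else 0)"
    using assms by (intro sum.cong) (auto simp: orthonormal_def)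
  then show ?thesis using assms(2) by (simp add: g_simps)
qed

lemma normalized_unit:
  assumes "u \<noteq> 0"
  shows "g ((1 / sqrt (g u u)) *\<^sub>R u) ((1 / sqrt (g u u)) *\<^sub>R u) = 1"
proof -
  have "sqrt (g u u) * sqrt (g u u) = g u u" using nonneg[of u] by simp
  then show ?thesis using pos[OF assms] by (simp add: g_simps(3,4) divide_simps)
qed

lemma unit_residual:
  assumes "orthonormal N f" "x \<noteq> (\<Sum>i<N. g x (f i) *\<^sub>R f i)"
  shows "\<exists>u. g u u = 1 \<and> (\<forall>j<N. g u (f j) = 0)"
proof -
  define r where "r = x - (\<Sum>i<N. g x (f i) *\<^sub>R f i)"
  have "r \<noteq> 0" using assms(2) by (simp add: r_def)
  have "g ((1 / sqrt (g r r)) *\<^sub>R r) (f j) = 0" if "j < N" for j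
    using orthonormal_residual[OF assms(1) that, of x, folded r_def] by (simp only: g_simps(3)) simp
  then show ?thesis using normalized_unit[OF \<open>r \<noteq> 0\<close>] by blast
qed

lemma orthonormal_extend:
  assumes "orthonormal N f" "g u u = 1" "\<And>j. j < N \<Longrightarrow> g u (f j) = 0"
  shows "orthonormal (Suc N) (f(N := u))"
  using assms unfolding orthonormal_def by (auto simp: less_Suc_eq sym[of "f _" u])

lemma orthonormal_expand:
  assumes "orthonormal DIM('e) f"
  shows "x = (\<Sum>i<DIM('e). g x (f i) *\<^sub>R f i)"
proof (rule ccontr)
  assume "x \<noteq> (\<Sum>i<DIM('e). g x (f i) *\<^sub>R f i)"
  then obtain u where "g u u = 1" "\<forall>j<DIM('e). g u (f j) = 0"
    using unit_residual[OF assms] by blast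
  then have "orthonormal (Suc DIM('e)) (f(DIM('e) := u))"
    by (intro orthonormal_extend[OF assms]) auto
  then have "Suc DIM('e) \<le> DIM('e)" by (rule orthonormal_card_le)
  then show False by simp
qed

lemma exists_orthogonal_unit:
  assumes "orthonormal N f" "N < DIM('e)"
  shows "\<exists>u. g u u = 1 \<and> (\<forall>j<N. g u (f j) = 0)"
proof -
  have "dim (f ` {..<N}) \<le> N"
    using dim_le_card'[of "f ` {..<N}"] card_image_le[of "{..<N}" f] by simp
  then have "span (f ` {..<N}) \<noteq> UNIV" using assms(2) by (metis dim_UNIV dim_span not_less)
  then obtain x where x: "x \<notin> span (f ` {..<N})" by auto
  have "(\<Sum>i<N. g x (f i) *\<^sub>R f i) \<in> span (f ` {..<N})"
    by (intro span_sum span_scale span_base) auto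
  then have "x \<noteq> (\<Sum>i<N. g x (f i) *\<^sub>R f i)" using x by metis
  then show ?thesis by (rule unit_residual[OF assms(1)])
qed

lemma orthonormal_exists: "N \<le> DIM('e) \<Longrightarrow> \<exists>f. orthonormal N f"
proof (induction N)
  case 0
  then show ?case by (simp add: orthonormal_def)
next
  case (Suc N)
  then have "N < DIM('e)" by simp
  moreover obtain f where f: "orthonormal N f" using Suc.IH[OF less_imp_le[OF \<open>N < DIM('e)\<close>]] by blast
  ultimately obtain u where u: "g u u = 1" "\<forall>j<N. g u (f j) = 0" using exists_orthogonal_unit by blast
  have "orthonormal (Suc N) (f(N := u))" by (rule orthonormal_extend[OF f]) (use u in auto)
  then show ?case by (rule exI[of _ "f(N := u)"])
qed

text \<open>Expanding each \<open>f\<^sub>i\<close> in the basis \<open>f'\<close> in one argument turns the left side into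
  \<open>\<Sum>\<^sub>i\<^sub>j g(f\<^sub>i,f'\<^sub>j) H(f\<^sub>i,f'\<^sub>j)\<close>, which is symmetric in the two bases.\<close>

lemma trace_orthonormal_invariant:
  fixes H :: "'e \<Rightarrow> 'e \<Rightarrow> 'b::real_vector"
  assumes f: "orthonormal DIM('e) f" and f': "orthonormal DIM('e) f'"
    and H: "\<And>v. linear (\<lambda>u. H u v)" "\<And>u. linear (H u)"
  shows "(\<Sum>i<DIM('e). H (f i) (f i)) = (\<Sum>i<DIM('e). H (f' i) (f' i))"
proof -
  let ?N = "DIM('e)"
  have "(\<Sum>i<?N. H (f i) (f i)) = (\<Sum>i<?N. \<Sum>j<?N. g (f i) (f' j) *\<^sub>R H (f i) (f' j))"
  proof (rule sum.cong[OF refl])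
    fix i
    have "H (f i) (\<Sum>j<?N. g (f i) (f' j) *\<^sub>R f' j) = (\<Sum>j<?N. g (f i) (f' j) *\<^sub>R H (f i) (f' j))"
      by (simp add: linear_sum[OF H(2)] linear_scale[OF H(2)])
    then show "H (f i) (f i) = (\<Sum>j<?N. g (f i) (f' j) *\<^sub>R H (f i) (f' j))"
      using orthonormal_expand[OF f', of "f i"] by simp
  qed
  also have "\<dots> = (\<Sum>j<?N. \<Sum>i<?N. g (f' j) (f i) *\<^sub>R H (f i) (f' j))"
    by (subst sum.swap) (simp add: sym)
  also have "\<dots> = (\<Sum>j<?N. H (f' j) (f' j))"
  proof (rule sum.cong[OF refl])
    fix j
    have "H (\<Sum>i<?N. g (f' j) (f i) *\<^sub>R f i) (f' j) = (\<Sum>i<?N. g (f' j) (f i) *\<^sub>R H (f i) (f' j))"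
      by (simp add: linear_sum[OF H(1)] linear_scale[OF H(1)])
    then show "(\<Sum>i<?N. g (f' j) (f i) *\<^sub>R H (f i) (f' j)) = H (f' j) (f' j)"
      using orthonormal_expand[OF f, of "f' j"] by simp
  qed
  finally show ?thesis .
qed

text \<open>The trace of a real endomorphism can be taken with respect to an orthonormal basis of any inner product.\<close>

lemma trace_eq_orthonormal_trace:
  assumes f: "orthonormal DIM('e) f" and A: "linear A"
  shows "(\<Sum>b\<in>Basis. A b \<bullet> b) = (\<Sum>i<DIM('e). g (A (f i)) (f i))"
proof -
  let ?N = "DIM('e)"
  have "A b \<bullet> b = (\<Sum>i<?N. (f i \<bullet> b) * g (A b) (f i))" for b
  proof -
    have "A b \<bullet> b = (\<Sum>i<?N. g (A b) (f i) *\<^sub>R f i) \<bullet> b" using orthonormal_expand[OF f, of "A b"] by simp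
    then show ?thesis by (simp add: inner_sum_left mult.commute)
  qed
  then have "(\<Sum>b\<in>Basis. A b \<bullet> b) = (\<Sum>i<?N. \<Sum>b\<in>Basis. (f i \<bullet> b) * g (A b) (f i))"
    by (simp add: sum.swap[of _ "{..<?N}"])
  also have "\<dots> = (\<Sum>i<?N. g (A (f i)) (f i))"
  proof (rule sum.cong[OF refl])
    fix i
    have "g (A (\<Sum>b\<in>Basis. (f i \<bullet> b) *\<^sub>R b)) (f i) = (\<Sum>b\<in>Basis. (f i \<bullet> b) * g (A b) (f i))"
      by (simp only: linear_sum[OF A] linear_scale[OF A] g_simps real_scaleR_def)
    then show "(\<Sum>b\<in>Basis. (f i \<bullet> b) * g (A b) (f i)) = g (A (f i)) (f i)"
      by (simp only: euclidean_representation)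
  qed
  finally show ?thesis .
qed

end

text \<open>A complex structure \<open>L\<close> compatible with the inner product; \<open>g (L x) y\<close> is its Kaehler form.\<close>

locale hermitian_form = inner_form g for g :: "'e::euclidean_space \<Rightarrow> 'e \<Rightarrow> real" +
  fixes L :: "'e \<Rightarrow> 'e"
  assumes linear_L: "linear L" and L_L: "L (L x) = - x" and g_L: "g (L x) (L y) = g x y"
begin

lemma g_L_left: "g (L x) y = - g x (L y)"
  using g_L[of x "L y"] by (simp add: L_L g_simps)

lemma g_L_self: "g x (L x) = 0" "g (L x) x = 0"
  using g_L_left[of x x] sym[of x "L x"] by auto

definition unitary :: "nat \<Rightarrow> (nat \<Rightarrow> 'e) \<Rightarrow> bool" where
  "unitary n e \<longleftrightarrow> (\<forall>j<n. \<forall>k<n. g (e j) (e k) = (if j = k then 1 else 0) \<and> g (e j) (L (e k)) = 0)"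

lemma even_odd_cases: "i < 2 * n \<Longrightarrow> \<exists>j<n. i = 2 * j \<or> i = Suc (2 * j)" for i n :: nat
  by presburger

lemma unitary_orthonormal: "unitary n e \<Longrightarrow> orthonormal (2 * n) (doubled L e)"
  unfolding orthonormal_def
proof (intro allI impI)
  fix i j assume e: "unitary n e" and ij: "i < 2 * n" "j < 2 * n"
  obtain i' where i: "i' < n" "i = 2 * i' \<or> i = Suc (2 * i')" using even_odd_cases[OF ij(1)] by blast
  obtain j' where j: "j' < n" "j = 2 * j' \<or> j = Suc (2 * j')" using even_odd_cases[OF ij(2)] by blast
  have par: "2 * x \<noteq> Suc (2 * y)" "Suc (2 * y) \<noteq> 2 * x" for x y :: nat by presburger+
  have e1: "g (e i') (e j') = (if i' = j' then 1 else 0)" "g (e i') (L (e j')) = 0"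
    using e i(1) j(1) unfolding unitary_def by (blast, blast)
  have e2: "g (L (e i')) (e j') = 0" "g (L (e i')) (L (e j')) = (if i' = j' then 1 else 0)"
    using e1 by (simp_all add: g_L g_L_left[of "e i'" "e j'"])
  show "g (doubled L e i) (doubled L e j) = (if i = j then 1 else 0)"
    using i(2) j(2) by (elim disjE) (simp_all add: par e1 e2)
qed

lemma unitary_extend:
  assumes "unitary n e" "g u u = 1" "\<And>i. i < 2 * n \<Longrightarrow> g u (doubled L e i) = 0"
  shows "unitary (Suc n) (e(n := u))"
proof -
  have 1: "g u (e j) = 0" "g u (L (e j)) = 0" if "j < n" for j
    using assms(3)[of "2 * j"] assms(3)[of "Suc (2 * j)"] that by simp_all
  have 2: "g (e j) u = 0" "g (e j) (L u) = 0" if "j < n" for j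
    using 1[OF that] sym[of u "e j"] g_L_left[of "e j" u] sym[of u "L (e j)"] by auto
  have e: "g (e j) (e k) = (if j = k then 1 else 0)" "g (e j) (L (e k)) = 0" if "j < n" "k < n" for j k
    using assms(1) that unfolding unitary_def by (blast, blast)
  show ?thesis unfolding unitary_def
  proof (intro allI impI)
    fix j k assume "j < Suc n" "k < Suc n"
    then consider "j < n" "k < n" | "j < n" "k = n" | "j = n" "k < n" | "j = n" "k = n" by linarith
    then show "g ((e(n := u)) j) ((e(n := u)) k) = (if j = k then 1 else 0) \<and> g ((e(n := u)) j) (L ((e(n := u)) k)) = 0"
      by cases (simp_all add: e 1 2 assms(2) g_L_self)
  qed
qed

lemma exists_unitary_extend:
  assumes "unitary n e" "2 * n < DIM('e)"
  shows "\<exists>u. unitary (Suc n) (e(n := u))"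
  using exists_orthogonal_unit[OF unitary_orthonormal[OF assms(1)] assms(2)] unitary_extend[OF assms(1)] by blast

lemma kaehler_form_on_unitary:
  assumes "unitary n e" "j < n" "k < n"
  shows "g (L (e j)) (e k) = 0" "g (L (L (e j))) (L (e k)) = 0"
    "g (L (e j)) (L (e k)) = (if j = k then 1 else 0)"
    "g (L (L (e j))) (e k) = (if j = k then - 1 else 0)"
proof -
  have e: "g (e j) (e k) = (if j = k then 1 else 0)" "g (e j) (L (e k)) = 0"
    using assms unfolding unitary_def by (blast, blast)
  show "g (L (e j)) (e k) = 0" using e by (simp add: g_L_left[of "e j" "e k"])
  show "g (L (L (e j))) (L (e k)) = 0" using e by (simp only: L_L g_simps)
  show "g (L (e j)) (L (e k)) = (if j = k then 1 else 0)" using e by (simp only: g_L)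
  show "g (L (L (e j))) (e k) = (if j = k then - 1 else 0)" using e by (simp only: L_L g_simps) simp
qed

text \<open>Gram-Schmidt over \<open>\<complex>\<close>: if \<open>u\<^sub>0,\<dots>,u\<^sub>k\<^sub>-\<^sub>1\<close> are unitary already, subtract from \<open>u\<^sub>k\<close> its projection
  \<open>s\<close> to their complex span, which does not change the value of \<open>\<eta>\<close>, and normalize the rest \<open>w\<close>, which divides it by a
  positive number. If \<open>w = 0\<close>, the value is zero.\<close>

lemma nonneg_on_frames_imp_nonneg:
  fixes \<eta> :: "(nat \<Rightarrow> 'e) \<Rightarrow> real"
  assumes \<eta>: "alternating (2 * p) \<eta>" and frames: "\<And>e. unitary p e \<Longrightarrow> \<eta> (doubled L e) \<ge> 0"
  shows "\<eta> (doubled L u) \<ge> 0"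
proof -
  have "\<eta> (doubled L u) \<ge> 0" if "unitary k u" "k \<le> p" for k u
    using that(2,1)
  proof (induction k arbitrary: u rule: inc_induct)
    case base
    then show ?case by (rule frames)
  next
    case (step k)
    define s where "s = (\<Sum>i<2 * k. g (u k) (doubled L u i) *\<^sub>R doubled L u i)"
    define w where "w = u k - s"
    have "s \<in> span (\<Union>j\<in>{..<p} - {k}. {u j, L (u j)})"
      unfolding s_def
    proof (intro span_sum span_scale span_base)
      fix i assume "i \<in> {..<2 * k}"
      then obtain j where j: "j < k" "i = 2 * j \<or> i = Suc (2 * j)" using even_odd_cases[of i k] by auto
      then have "j \<in> {..<p} - {k}" "doubled L u i \<in> {u j, L (u j)}" using \<open>k < p\<close> by auto
      then show "doubled L u i \<in> (\<Union>j\<in>{..<p} - {k}. {u j, L (u j)})" by blast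
    qed
    then have "\<eta> (doubled L (u(k := w + s))) = \<eta> (doubled L (u(k := w)))"
      by (rule alternating_doubled_add[OF \<eta> linear_L L_L \<open>k < p\<close>])
    then have eq: "\<eta> (doubled L u) = \<eta> (doubled L (u(k := w)))" by (simp add: w_def)
    show ?case
    proof (cases "w = 0")
      case True
      then show ?thesis using eq alternating_doubled_scale[OF \<eta> linear_L \<open>k < p\<close>, of u 0 0] by simp
    next
      case False
      define r where "r = sqrt (g w w)"
      have "r > 0" using pos[OF False] by (simp add: r_def)
      define w' where "w' = (1 / r) *\<^sub>R w"
      have "g w' w' = 1" unfolding w'_def r_def by (rule normalized_unit[OF False])
      moreover have "g w' (doubled L u i) = 0" if "i < 2 * k" for i
        using orthonormal_residual[OF unitary_orthonormal[OF step.prems] that, of "u k", folded s_def w_def]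
        by (simp add: w'_def g_simps(3))
      ultimately have "unitary (Suc k) (u(k := w'))" by (intro unitary_extend step.prems)
      then have "\<eta> (doubled L (u(k := w'))) \<ge> 0" by (rule step.IH)
      moreover have "w = r *\<^sub>R w'" using \<open>r > 0\<close> by (simp add: w'_def)
      ultimately show ?thesis using eq alternating_doubled_scale[OF \<eta> linear_L \<open>k < p\<close>, of u r w'] by simp
    qed
  qed
  from this[of 0 u] show ?thesis by (simp add: unitary_def)
qed

end

section \<open>The trace form on skew-Hermitian matrices\<close>

text \<open>The left side is the trace over \<open>\<real>\<close>; the basis consists of the unit vectors and their multiples by \<open>\<i>\<close>.\<close>

lemma real_trace_matrix:
  fixes X :: "complex^'r::finite^'r"
  shows "(\<Sum>b\<in>Basis. (X *v b) \<bullet> b) = 2 * Re (trace X)"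
proof -
  have entry: "(X *v axis i z) $ i = X $ i $ i * z" for i z
    by (simp add: matrix_vector_mult_def axis_def if_distrib cong: if_cong)
  have inj: "inj (\<lambda>i. axis i (z::complex))" if "z \<noteq> 0" for z
    using that by (auto simp: inj_def axis_eq_axis)
  have B: "(Basis :: (complex^'r) set) = range (\<lambda>i. axis i 1) \<union> range (\<lambda>i. axis i \<i>)"
    by (auto simp: Basis_vec_def Basis_complex_def)
  have "(\<Sum>b\<in>Basis. (X *v b) \<bullet> b) =
     (\<Sum>b\<in>range (\<lambda>i. axis i 1). (X *v b) \<bullet> b) + (\<Sum>b\<in>range (\<lambda>i. axis i \<i>). (X *v b) \<bullet> b)"
    unfolding B by (rule sum.union_disjoint) (auto simp: axis_eq_axis)
  also have "\<dots> = (\<Sum>i\<in>UNIV. Re (X $ i $ i)) + (\<Sum>i\<in>UNIV. Re (X $ i $ i))"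
    by (subst (1 2) sum.reindex) (simp_all add: inj inner_axis entry inner_complex_def)
  finally show ?thesis by (simp add: trace_def)
qed

text \<open>The conditions on a Hermitian metric in a single fibre.\<close>

locale hermitian_product =
  fixes h :: "complex^'r::finite \<Rightarrow> complex^'r \<Rightarrow> complex"
  assumes linear_left: "h (a *s x + y) z = a * h x z + h y z" and hermitian: "h y x = cnj (h x y)"
    and positive: "x \<noteq> 0 \<Longrightarrow> Re (h x x) > 0"
begin

lemma h_add: "h (x + y) z = h x z + h y z" "h z (x + y) = h z x + h z y"
proof -
  show *: "h (x + y) z = h x z + h y z" for x y z using linear_left[of 1] by simp
  show "h z (x + y) = h z x + h z y" using hermitian * by (metis complex_cnj_add)
qed

lemma h_zero: "h 0 z = 0" "h z 0 = 0"
  using h_add(1)[of 0 0 z] h_add(2)[of z 0 0] by auto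

lemma h_scale: "h (a *s x) z = a * h x z" "h z (a *s x) = cnj a * h z x"
proof -
  show *: "h (a *s x) z = a * h x z" for a x z using linear_left[of a x 0 z] h_zero by simp
  show "h z (a *s x) = cnj a * h z x" using hermitian[of z "a *s x"] hermitian[of z x] *[of a x z] by simp
qed

lemma h_scaleR: "h (r *\<^sub>R x) z = of_real r * h x z" "h z (r *\<^sub>R x) = of_real r * h z x"
  by (simp_all add: scaleR_eq_of_real_smult h_scale)

lemma h_minus: "h (- x) z = - h x z"
  using h_scale(1)[of "- 1" x z] by simp

sublocale re: inner_form "\<lambda>x y. Re (h x y)"
proof
  show sym: "Re (h u v) = Re (h v u)" for u v using hermitian[of u v] by simp
  have "linear (\<lambda>x. Re (h x z))" "linear (\<lambda>x. Re (h z x))" for z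
    by (rule linearI; simp add: h_add h_scaleR)+
  then show "bilinear (\<lambda>x y. Re (h x y))" unfolding bilinear_def by blast
qed (rule positive)

text \<open>The vectors \<open>f\<^sub>i\<close> are a real orthonormal basis for the real part of \<open>h\<close>. In this form the trace can be combined with
  the adjoint with respect to \<open>h\<close>.\<close>

lemma re_trace_eq:
  "\<exists>f N. \<forall>X. 2 * Re (trace X) = (\<Sum>i<(N::nat). Re (h (X *v f i) (f i)))"
proof -
  obtain f where f: "re.orthonormal DIM(complex^'r) f" using re.orthonormal_exists by blast
  have "linear ((*v) X)" for X :: "complex^'r^'r"
    by (rule linearI) (simp_all add: matrix_vector_right_distrib scaleR_eq_of_real_smult vector_scalar_commute)
  then have "2 * Re (trace X) = (\<Sum>i<DIM(complex^'r). Re (h (X *v f i) (f i)))" for X :: "complex^'r^'r"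
    unfolding real_trace_matrix[symmetric] by (rule re.trace_eq_orthonormal_trace[OF f])
  then show ?thesis by blast
qed

definition skew_hermitian :: "(complex^'r^'r) set" where
  "skew_hermitian = {X. \<forall>x y. h (X *v x) y + h x (X *v y) = 0}"

lemma subspace_skew_hermitian: "subspace skew_hermitian"
proof (rule subspaceI)
  show "0 \<in> skew_hermitian" by (simp add: skew_hermitian_def h_zero)
next
  fix X Y assume "X \<in> skew_hermitian" "Y \<in> skew_hermitian"
  then have X: "h (X *v x) y + h x (X *v y) = 0" and Y: "h (Y *v x) y + h x (Y *v y) = 0" for x y
    by (simp_all add: skew_hermitian_def)
  have "h ((X + Y) *v x) y + h x ((X + Y) *v y) = (h (X *v x) y + h x (X *v y)) + (h (Y *v x) y + h x (Y *v y))" for x y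
    by (simp add: matrix_vector_mult_add_rdistrib h_add)
  then show "X + Y \<in> skew_hermitian" by (simp add: skew_hermitian_def X Y)
next
  fix r :: real and X assume "X \<in> skew_hermitian"
  then have X: "h (X *v x) y + h x (X *v y) = 0" for x y by (simp add: skew_hermitian_def)
  have "h ((r *\<^sub>R X) *v x) y + h x ((r *\<^sub>R X) *v y) = of_real r * (h (X *v x) y + h x (X *v y))" for x y
    by (simp add: scaleR_matrix_vector h_scaleR distrib_left)
  then show "r *\<^sub>R X \<in> skew_hermitian" by (simp add: skew_hermitian_def X)
qed

lemma skew_hermitian_product:
  assumes "X \<in> skew_hermitian"
  shows "h ((X ** Y) *v x) y = - h (Y *v x) (X *v y)"
proof -
  have "h (X *v (Y *v x)) y + h (Y *v x) (X *v y) = 0" using assms by (simp add: skew_hermitian_def)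
  then show ?thesis by (simp add: matrix_vector_mul_assoc eq_neg_iff_add_eq_0)
qed

text \<open>The real part of the trace of \<open>X\<^sup>2\<close> is \<open>- \<Sum>\<^sub>i h(Xf\<^sub>i,Xf\<^sub>i)/2\<close>.\<close>

lemma trace_skew_hermitian_square:
  assumes "X \<in> skew_hermitian"
  shows "Re (trace (X ** X)) \<le> 0"
proof -
  obtain f N where f: "2 * Re (trace Z) = (\<Sum>i<(N::nat). Re (h (Z *v f i) (f i)))" for Z :: "complex^'r^'r"
    using re_trace_eq by metis
  have "(\<Sum>i<N. Re (h (X *v f i) (X *v f i))) \<ge> 0" by (intro sum_nonneg re.nonneg)
  then show ?thesis using f[of "X ** X"] by (simp add: skew_hermitian_product[OF assms] sum_negf)
qed

text \<open>By skewness \<open>h(XYf,f) = - h(Yf,Xf)\<close>, whose imaginary part is antisymmetric in \<open>X\<close> and \<open>Y\<close>,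
  whereas the trace of \<open>XY\<close> is symmetric.\<close>

lemma trace_skew_hermitian_product_real:
  assumes X: "X \<in> skew_hermitian" and Y: "Y \<in> skew_hermitian"
  shows "Im (trace (X ** Y)) = 0"
proof -
  obtain f N where f: "2 * Re (trace Z) = (\<Sum>i<(N::nat). Re (h (Z *v f i) (f i)))" for Z :: "complex^'r^'r"
    using re_trace_eq by metis
  have im: "2 * Im (trace (A ** B)) = (\<Sum>i<N. - Im (h (B *v f i) (A *v f i)))" if "A \<in> skew_hermitian" for A B
  proof -
    \<comment> \<open>The formula for the real part, applied to \<open>- \<i>AB\<close>.\<close>
    define C where "C = (\<chi> i j. - \<i> * (A ** B) $ i $ j)"
    have "trace C = - \<i> * trace (A ** B)" by (simp add: trace_def C_def sum_distrib_left)
    moreover have "C *v x = - \<i> *s ((A ** B) *v x)" for x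
      by (simp add: C_def vec_eq_iff matrix_vector_mult_def sum_distrib_left sum_negf mult.assoc)
    ultimately show ?thesis using f[of C] by (simp add: h_scale(1) h_minus skew_hermitian_product[OF that])
  qed
  have "Im (h (X *v x) (Y *v x)) = - Im (h (Y *v x) (X *v x))" for x
    using hermitian[of "Y *v x" "X *v x"] by simp
  then have "2 * Im (trace (X ** Y)) = - (2 * Im (trace (Y ** X)))"
    by (simp add: im[OF X] im[OF Y] sum_negf)
  then show ?thesis by (simp add: trace_mul_sym[of Y X])
qed

end

text \<open>Positive semidefinite on skew-Hermitian matrices, hence the sign.\<close>

definition trace_form :: "complex^'r::finite^'r \<Rightarrow> complex^'r^'r \<Rightarrow> real" where
  "trace_form X Y = - Re (trace (X ** Y))"

lemma trace_scaleR: "trace (r *\<^sub>R X) = r *\<^sub>R trace (X :: complex^'r::finite^'r)"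
  by (simp only: trace_def vector_scaleR_component scaleR_sum_right)

lemma trace_form_commute: "trace_form X Y = trace_form Y X"
  unfolding trace_form_def by (subst trace_mul_sym) (rule refl)

lemma bilinear_trace_form: "bilinear (trace_form :: complex^'r::finite^'r \<Rightarrow> complex^'r^'r \<Rightarrow> real)"
proof -
  have 1: "linear (\<lambda>X. trace_form X Y)" for Y :: "complex^'r^'r"
  proof -
    have "(A + B) ** Y = A ** Y + B ** Y" "(r *\<^sub>R A) ** Y = r *\<^sub>R (A ** Y)" for A B :: "complex^'r^'r" and r :: real
      by (simp_all add: matrix_matrix_mult_def vec_eq_iff distrib_right sum.distrib scaleR_sum_right)
    then show ?thesis unfolding trace_form_def by (intro linearI) (simp_all add: trace_add trace_scaleR)
  qed
  have "trace_form X = (\<lambda>Y. trace_form Y X)" for X :: "complex^'r^'r" by (rule ext) (rule trace_form_commute)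
  then have "linear (trace_form X)" for X :: "complex^'r^'r" by (metis 1)
  then show ?thesis unfolding bilinear_def using 1 by blast
qed

section \<open>The curvature inequality\<close>

text \<open>Cauchy-Schwarz for a linear combination with vector coefficients: expand the sum of the squares
  of \<open>X\<^sub>i - s\<^sub>i Z\<close> and \<open>Y\<^sub>i - t\<^sub>i Z\<close>, which is nonnegative because the form is positive on \<open>S\<close>.\<close>

lemma normalized_cauchy_schwarz:
  fixes q :: "'b::real_vector \<Rightarrow> 'b \<Rightarrow> real"
  assumes q: "bilinear q" "\<And>X Y. q X Y = q Y X" and S: "subspace S" "\<And>X. X \<in> S \<Longrightarrow> q X X \<ge> 0"
    and X: "\<And>i. i \<in> A \<Longrightarrow> X i \<in> S" "\<And>i. i \<in> A \<Longrightarrow> Y i \<in> S"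
    and st: "(\<Sum>i\<in>A. (s i)\<^sup>2 + (t i)\<^sup>2) = 1" and Z: "Z = (\<Sum>i\<in>A. s i *\<^sub>R X i + t i *\<^sub>R Y i)"
  shows "q Z Z \<le> (\<Sum>i\<in>A. q (X i) (X i) + q (Y i) (Y i))"
proof -
  have l: "linear (\<lambda>x. q x y)" "linear (q x)" for x y using q(1) by (auto simp: bilinear_def)
  note lin = linear_add[OF l(1)] linear_add[OF l(2)] linear_diff[OF l(1)] linear_diff[OF l(2)]
    linear_scale[OF l(1)] linear_scale[OF l(2)]
  have ZS: "Z \<in> S" unfolding Z using X S(1) by (intro subspace_sum subspace_add subspace_scale) auto
  have "0 \<le> (\<Sum>i\<in>A. q (X i - s i *\<^sub>R Z) (X i - s i *\<^sub>R Z) + q (Y i - t i *\<^sub>R Z) (Y i - t i *\<^sub>R Z))"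
    using X ZS S(1) by (intro sum_nonneg add_nonneg_nonneg S(2) subspace_diff subspace_scale) auto
  also have "\<dots> = (\<Sum>i\<in>A. (q (X i) (X i) + q (Y i) (Y i)) - 2 * q (s i *\<^sub>R X i + t i *\<^sub>R Y i) Z
      + ((s i)\<^sup>2 + (t i)\<^sup>2) * q Z Z)"
    by (intro sum.cong refl) (simp add: lin q(2)[of Z "X _"] q(2)[of Z "Y _"] power2_eq_square algebra_simps)
  also have "\<dots> = (\<Sum>i\<in>A. q (X i) (X i) + q (Y i) (Y i)) - 2 * q Z Z + q Z Z"
  proof -
    have "(\<Sum>i\<in>A. q (s i *\<^sub>R X i + t i *\<^sub>R Y i) Z) = q Z Z"
      unfolding linear_sum[OF l(1), symmetric] Z[symmetric] ..
    then show ?thesis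
      by (simp add: sum.distrib sum_subtractf sum_distrib_left[symmetric] sum_distrib_right[symmetric] st[unfolded sum.distrib])
  qed
  finally show ?thesis by simp
qed

lemma sum_doubled: "(\<Sum>i<2 * n. f i) = (\<Sum>j<n. f (2 * j) + f (Suc (2 * j)))" for f :: "nat \<Rightarrow> 'b::comm_monoid_add"
  by (induction n) (simp_all add: add.assoc)

context hermitian_form
begin

text \<open>The symmetric form \<open>H(u,v) = \<Theta>(u,Lv)\<close> is \<open>L\<close>-invariant and changes its sign under \<open>R\<close>, so
  its trace over \<open>V\<close> is zero. With \<open>\<xi>\<close> the unit vector missing from the family, the partial trace on the left
  is therefore \<open>- H(\<xi>,\<xi>) = H(R\<xi>,R\<xi>)\<close>. As \<open>R\<xi>\<close> is a unit vector in the complex span of the family,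
  \<open>H(R\<xi>,R\<xi>)\<close> is a combination of the \<open>\<Theta>(e\<^sub>j,Le\<^sub>k)\<close> and \<open>\<Theta>(e\<^sub>j,e\<^sub>k)\<close> with
  coefficients whose squares add up to 1.\<close>

lemma unitary_curvature_inequality:
  fixes \<Theta> :: "'e \<Rightarrow> 'e \<Rightarrow> 'b::real_vector" and q :: "'b \<Rightarrow> 'b \<Rightarrow> real"
  assumes R: "hermitian_form g R" and LR: "\<And>u. L (R u) = - R (L u)"
    and \<Theta>: "\<And>v. linear (\<lambda>u. \<Theta> u v)" "\<And>u v. \<Theta> u v = - \<Theta> v u"
    and inv: "\<And>u v. \<Theta> (L u) (L v) = \<Theta> u v" "\<And>u v. \<Theta> (R u) (R v) = \<Theta> u v"
    and q: "bilinear q" "\<And>X Y. q X Y = q Y X" and S: "subspace S" "\<And>X. X \<in> S \<Longrightarrow> q X X \<ge> 0" "\<And>u v. \<Theta> u v \<in> S"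
    and e: "unitary p e" and dim: "DIM('e) = 2 * Suc p"
  shows "q (\<Sum>j<p. \<Theta> (e j) (L (e j))) (\<Sum>j<p. \<Theta> (e j) (L (e j))) \<le>
    (\<Sum>j<p. \<Sum>k<p. q (\<Theta> (e j) (L (e k))) (\<Theta> (e j) (L (e k))) + q (\<Theta> (e j) (e k)) (\<Theta> (e j) (e k)))"
proof -
  interpret R: hermitian_form g R by (rule R)
  have \<Theta>2: "linear (\<Theta> u)" for u
  proof -
    have "\<Theta> u = (\<lambda>v. - \<Theta> v u)" using \<Theta>(2) by blast
    then show ?thesis using linear_compose_neg[OF \<Theta>(1)[of u]] by simp
  qed
  note lin = linear_add[OF \<Theta>(1)] linear_add[OF \<Theta>2] linear_scale[OF \<Theta>(1)] linear_scale[OF \<Theta>2]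
    linear_neg[OF \<Theta>(1)] linear_neg[OF \<Theta>2] linear_diff[OF \<Theta>2]
  have inv': "\<Theta> (L u) v = - \<Theta> u (L v)" for u v
  proof -
    have "- \<Theta> (L u) v = \<Theta> u (L v)" using inv(1)[of u "L v"] by (simp add: L_L lin)
    then show ?thesis by (metis minus_minus)
  qed
  define H where "H = (\<lambda>u v. \<Theta> u (L v))"
  have Hlin: "linear (\<lambda>u. H u v)" "linear (H u)" for u v
    unfolding H_def using \<Theta>(1) linear_compose[OF linear_L \<Theta>2[of u]] by (auto simp: o_def)
  have HL: "H (L u) (L v) = H u v" for u v unfolding H_def by (rule inv(1))
  have HR: "H (R u) (R u) = - H u u" for u
    unfolding H_def LR by (simp add: lin inv(2))
  obtain \<xi> where \<xi>: "unitary (Suc p) (e(p := \<xi>))" using exists_unitary_extend[OF e] dim by auto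
  define e' where "e' = e(p := \<xi>)"
  define f where "f = doubled L e'"
  have f: "orthonormal DIM('e) f"
    unfolding f_def dim e'_def by (rule unitary_orthonormal[OF \<xi>])
  have f': "orthonormal DIM('e) (\<lambda>i. R (f i))"
    using f unfolding orthonormal_def by (simp add: R.g_L)
  have "(\<Sum>i<DIM('e). H (f i) (f i)) = (\<Sum>i<DIM('e). H (R (f i)) (R (f i)))"
    by (rule trace_orthonormal_invariant[OF f f' Hlin])
  then have "(\<Sum>i<DIM('e). H (f i) (f i)) = - (\<Sum>i<DIM('e). H (f i) (f i))"
    by (simp add: HR sum_negf)
  then have "2 *\<^sub>R (\<Sum>i<DIM('e). H (f i) (f i)) = 0" by (simp only: scaleR_2 eq_neg_iff_add_eq_0)
  then have "(\<Sum>i<2 * Suc p. H (f i) (f i)) = 0" by (simp add: dim)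
  then have "(\<Sum>j<Suc p. 2 *\<^sub>R H (e' j) (e' j)) = 0"
    unfolding sum_doubled f_def by (simp add: HL scaleR_2)
  then have "2 *\<^sub>R (\<Sum>j<Suc p. H (e' j) (e' j)) = 0" by (simp only: scaleR_sum_right)
  then have "(\<Sum>j<p. H (e j) (e j)) = - H \<xi> \<xi>"
    by (simp add: e'_def eq_neg_iff_add_eq_0)
  then have tr: "(\<Sum>j<p. \<Theta> (e j) (L (e j))) = H (R \<xi>) (R \<xi>)" unfolding HR by (simp add: H_def)
  define x y where "x = (\<lambda>j. g (R \<xi>) (e j))" and "y = (\<lambda>j. g (R \<xi>) (L (e j)))"
  have "g (R \<xi>) (L \<xi>) = - g (R \<xi>) (L \<xi>)"
    using R.g_L_left[of \<xi> "L \<xi>"] g_L_left[of \<xi> "R \<xi>"] LR[of \<xi>] sym[of "R \<xi>" "L \<xi>"] by (simp add: g_simps)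
  then have orth: "g (R \<xi>) (L \<xi>) = 0" "g (R \<xi>) \<xi> = 0" using R.g_L_self by auto
  \<comment> \<open>\<open>R\<xi>\<close> has no component along \<open>\<xi>\<close> and \<open>L\<xi>\<close>.\<close>
  have expand: "R \<xi> = (\<Sum>j<p. x j *\<^sub>R e j + y j *\<^sub>R L (e j))"
  proof -
    have "R \<xi> = (\<Sum>i<2 * Suc p. g (R \<xi>) (f i) *\<^sub>R f i)" using orthonormal_expand[OF f, of "R \<xi>"] by (simp only: dim)
    also have "\<dots> = (\<Sum>j<Suc p. g (R \<xi>) (e' j) *\<^sub>R e' j + g (R \<xi>) (L (e' j)) *\<^sub>R L (e' j))"
      unfolding sum_doubled f_def by simp
    also have "\<dots> = (\<Sum>j<p. x j *\<^sub>R e j + y j *\<^sub>R L (e j))"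
      by (simp add: e'_def orth x_def y_def)
    finally show ?thesis .
  qed
  have "g \<xi> \<xi> = 1" using \<xi> unfolding unitary_def by (metis fun_upd_same lessI)
  then have "1 = g (R \<xi>) (R \<xi>)" by (simp add: R.g_L)
  also have "\<dots> = g (R \<xi>) (\<Sum>j<p. x j *\<^sub>R e j + y j *\<^sub>R L (e j))" using expand by simp
  also have "\<dots> = (\<Sum>j<p. (x j)\<^sup>2 + (y j)\<^sup>2)"
    by (simp add: g_simps x_def y_def power2_eq_square)
  finally have norm1: "(\<Sum>j<p. (x j)\<^sup>2 + (y j)\<^sup>2) = 1" ..
  let ?A = "\<lambda>jk. \<Theta> (e (fst jk)) (L (e (snd jk)))" and ?C = "\<lambda>jk. \<Theta> (e (fst jk)) (e (snd jk))"
  let ?s = "\<lambda>jk. x (fst jk) * x (snd jk) + y (fst jk) * y (snd jk)"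
  let ?t = "\<lambda>jk. y (fst jk) * x (snd jk) - x (fst jk) * y (snd jk)"
  let ?I = "{..<p} \<times> {..<p}"
  have "(\<Sum>jk\<in>?I. (?s jk)\<^sup>2 + (?t jk)\<^sup>2) = (\<Sum>j<p. \<Sum>k<p. ((x j)\<^sup>2 + (y j)\<^sup>2) * ((x k)\<^sup>2 + (y k)\<^sup>2))"
    unfolding sum.cartesian_product by (intro sum.cong refl) (auto simp: power2_eq_square algebra_simps)
  also have "\<dots> = 1" unfolding sum_product[symmetric] norm1 by simp
  finally have st: "(\<Sum>jk\<in>?I. (?s jk)\<^sup>2 + (?t jk)\<^sup>2) = 1" .
  have "H (R \<xi>) (R \<xi>) = (\<Sum>j<p. \<Sum>k<p. H (x j *\<^sub>R e j + y j *\<^sub>R L (e j)) (x k *\<^sub>R e k + y k *\<^sub>R L (e k)))"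
    unfolding expand linear_sum[OF Hlin(1)] linear_sum[OF Hlin(2)] by (rule sum.swap)
  also have "\<dots> = (\<Sum>jk\<in>?I. ?s jk *\<^sub>R ?A jk + ?t jk *\<^sub>R ?C jk)"
    unfolding sum.cartesian_product
  proof (intro sum.cong refl, clarify)
    fix j k
    show "H (x j *\<^sub>R e j + y j *\<^sub>R L (e j)) (x k *\<^sub>R e k + y k *\<^sub>R L (e k)) =
      ?s (j, k) *\<^sub>R ?A (j, k) + ?t (j, k) *\<^sub>R ?C (j, k)"
      unfolding H_def
      by (simp add: linear_add[OF linear_L] linear_scale[OF linear_L] L_L lin inv' algebra_simps)
  qed
  finally have Z: "H (R \<xi>) (R \<xi>) = (\<Sum>jk\<in>?I. ?s jk *\<^sub>R ?A jk + ?t jk *\<^sub>R ?C jk)" .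
  have "q (H (R \<xi>) (R \<xi>)) (H (R \<xi>) (R \<xi>)) \<le> (\<Sum>jk\<in>?I. q (?A jk) (?A jk) + q (?C jk) (?C jk))"
    by (rule normalized_cauchy_schwarz[OF q S(1,2) S(3) S(3) st Z])
  then show ?thesis unfolding tr by (simp add: sum.cartesian_product case_prod_beta)
qed

text \<open>Evaluation on the unitary family gives four times the difference of the two sides of the curvature inequality, up to the
  factor \<open>2\<^sup>m m!\<close>. The pairs \<open>j = k\<close> can be added to the sum, as their terms vanish.\<close>

lemma alternate_power_nonneg_on_unitary:
  fixes \<Theta> :: "'e \<Rightarrow> 'e \<Rightarrow> 'b::real_vector" and q :: "'b \<Rightarrow> 'b \<Rightarrow> real"
  assumes R: "hermitian_form g R" and LR: "\<And>u. L (R u) = - R (L u)"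
    and \<Theta>: "\<And>v. linear (\<lambda>u. \<Theta> u v)" "\<And>u v. \<Theta> u v = - \<Theta> v u"
    and inv: "\<And>u v. \<Theta> (L u) (L v) = \<Theta> u v" "\<And>u v. \<Theta> (R u) (R v) = \<Theta> u v"
    and q: "bilinear q" "\<And>X Y. q X Y = q Y X" and S: "subspace S" "\<And>X. X \<in> S \<Longrightarrow> q X X \<ge> 0" "\<And>u v. \<Theta> u v \<in> S"
    and e: "unitary (m + 2) e" and dim: "DIM('e) = 2 * (m + 3)"
  shows "alternate (4 + 2 * m) (\<lambda>v. - q (\<Theta> (v 0) (v 1)) (\<Theta> (v 2) (v 3)) *
     (\<Prod>k<m. g (L (v (4 + 2 * k))) (v (4 + 2 * k + 1)))) (doubled L e) \<ge> 0"
proof -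
  define F where "F = (\<lambda>v::nat \<Rightarrow> 'e. - q (\<Theta> (v 0) (v 1)) (\<Theta> (v 2) (v 3)))"
  let ?A = "\<lambda>j k. \<Theta> (e j) (L (e k))" and ?C = "\<lambda>j k. \<Theta> (e j) (e k)"
  let ?p = "m + 2"
  have ql: "linear (\<lambda>x. q x y)" "linear (q x)" for x y using q(1) by (auto simp: bilinear_def)
  note qlin = linear_neg[OF ql(1)] linear_neg[OF ql(2)] linear_0[OF ql(1)] linear_sum[OF ql(1)] linear_sum[OF ql(2)]
  have inv': "\<Theta> (L u) v = - \<Theta> u (L v)" for u v
  proof -
    have "\<Theta> (L u) v = - \<Theta> (L u) (L (L v))" using linear_neg[OF \<Theta>(1), of v "L u"] \<Theta>(2)[of "L u"] by (simp add: L_L)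
    then show ?thesis by (simp add: inv(1))
  qed
  have \<Theta>self: "\<Theta> u u = 0" for u
  proof -
    have "2 *\<^sub>R \<Theta> u u = 0" using \<Theta>(2)[of u u] by (simp only: scaleR_2 eq_neg_iff_add_eq_0)
    then show ?thesis by simp
  qed
  have pv: "pair_value F L x y = 8 * (- q (\<Theta> x (L x)) (\<Theta> y (L y)) + q (\<Theta> x y) (\<Theta> x y) + q (\<Theta> x (L y)) (\<Theta> x (L y)))" for x y
  proof -
    let ?d = "doubled L (\<lambda>i. if i = 0 then x else y)"
    have d: "?d 0 = x" "?d 1 = L x" "?d 2 = y" "?d 3 = L y" by (simp_all add: doubled_def)
    have "pair_value F L x y = 8 * (- q (\<Theta> x (L x)) (\<Theta> y (L y)) - - q (\<Theta> x y) (\<Theta> (L x) (L y)) + - q (\<Theta> x (L y)) (\<Theta> (L x) y))"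
      unfolding pair_value_def F_def
    proof (subst alternate_4_curvature_symmetric[where f = "\<lambda>a b c d. - q (\<Theta> a b) (\<Theta> c d)"])
      fix x y z w
      show "- q (\<Theta> y x) (\<Theta> z w) = - (- q (\<Theta> x y) (\<Theta> z w))" using \<Theta>(2)[of y x] by (simp add: qlin)
      show "- q (\<Theta> x y) (\<Theta> w z) = - (- q (\<Theta> x y) (\<Theta> z w))" using \<Theta>(2)[of w z] by (simp add: qlin)
      show "- q (\<Theta> z w) (\<Theta> x y) = - q (\<Theta> x y) (\<Theta> z w)" by (simp add: q(2)[of "\<Theta> z w" "\<Theta> x y"])
    qed (simp only: d)
    also have "\<dots> = 8 * (- q (\<Theta> x (L x)) (\<Theta> y (L y)) + q (\<Theta> x y) (\<Theta> x y) + q (\<Theta> x (L y)) (\<Theta> x (L y)))"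
      unfolding inv(1) inv'[of x y] qlin by simp
    finally show ?thesis .
  qed
  have "alternate (4 + 2 * m) (\<lambda>v. F v * (\<Prod>k<m. g (L (v (4 + 2 * k))) (v (4 + 2 * k + 1)))) (doubled L e) =
     2 ^ m * fact m * (\<Sum>(j, k)\<in>off_diagonal (m + 2). pair_value F L (e j) (e k) / 2)"
    by (rule alternate_power_on_frame) (simp_all add: F_def depends_on_first_def kaehler_form_on_unitary[OF e])
  also have "(\<Sum>(j, k)\<in>off_diagonal (m + 2). pair_value F L (e j) (e k) / 2) =
     (\<Sum>(j, k)\<in>{..<?p} \<times> {..<?p}. pair_value F L (e j) (e k) / 2)"
  proof (rule sum.mono_neutral_left[OF _ off_diagonal_subset])
    show "\<forall>i\<in>{..<?p} \<times> {..<?p} - off_diagonal ?p. (case i of (j, k) \<Rightarrow> pair_value F L (e j) (e k) / 2) = 0"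
      by (auto simp: off_diagonal_def pv \<Theta>self qlin)
  qed simp
  also have "\<dots> = (\<Sum>j<?p. \<Sum>k<?p. 4 * (- q (?A j j) (?A k k) + q (?C j k) (?C j k) + q (?A j k) (?A j k)))"
    unfolding sum.cartesian_product by (intro sum.cong refl) (auto simp: pv)
  also have "\<dots> = 4 * ((\<Sum>j<?p. \<Sum>k<?p. q (?A j k) (?A j k) + q (?C j k) (?C j k)) - q (\<Sum>j<?p. ?A j j) (\<Sum>j<?p. ?A j j))"
  proof -
    have "q (\<Sum>j<?p. ?A j j) (\<Sum>j<?p. ?A j j) = (\<Sum>j<?p. \<Sum>k<?p. q (?A j j) (?A k k))"
      unfolding linear_sum[OF ql(1)] linear_sum[OF ql(2)] by (rule sum.swap)
    then show ?thesis by (simp only: sum_distrib_left[symmetric] sum.distrib sum_negf) simp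
  qed
  finally have eq: "alternate (4 + 2 * m) (\<lambda>v. F v * (\<Prod>k<m. g (L (v (4 + 2 * k))) (v (4 + 2 * k + 1)))) (doubled L e) =
    2 ^ m * fact m * (4 * ((\<Sum>j<?p. \<Sum>k<?p. q (?A j k) (?A j k) + q (?C j k) (?C j k)) - q (\<Sum>j<?p. ?A j j) (\<Sum>j<?p. ?A j j)))" .
  have "DIM('e) = 2 * Suc ?p" using dim by simp
  from unitary_curvature_inequality[OF R LR \<Theta> inv q S e this]
  have "0 \<le> (\<Sum>j<?p. \<Sum>k<?p. q (?A j k) (?A j k) + q (?C j k) (?C j k)) - q (\<Sum>j<?p. ?A j j) (\<Sum>j<?p. ?A j j)"
    by (simp only: diff_ge_0_iff_ge)
  then show ?thesis unfolding eq[unfolded F_def] by (intro mult_nonneg_nonneg) simp_all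
qed

end

section \<open>Quaternionic structures on an inner product space\<close>

text \<open>A Euclidean space with an isometric action of the quaternions.\<close>

locale quaternionic_form = inner_form g for g :: "'e::euclidean_space \<Rightarrow> 'e \<Rightarrow> real" +
  fixes I J K :: "'e \<Rightarrow> 'e"
  assumes linear_IJK: "linear I" "linear J" "linear K"
    and square: "I (I u) = - u" "J (J u) = - u" "K (K u) = - u"
    and isometric: "g (I u) (I v) = g u v" "g (J u) (J v) = g u v" "g (K u) (K v) = g u v"
    and IJ: "I (J u) = K u" and JI: "J (I u) = - K u"
begin

lemmas expand_linear = linear_add[OF linear_IJK(1)] linear_add[OF linear_IJK(2)] linear_add[OF linear_IJK(3)]
  linear_scale[OF linear_IJK(1)] linear_scale[OF linear_IJK(2)] linear_scale[OF linear_IJK(3)]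
  linear_neg[OF linear_IJK(1)] linear_neg[OF linear_IJK(2)] linear_neg[OF linear_IJK(3)]

lemma products: "K (J u) = - I u" "J (K u) = I u" "I (K u) = - J u" "K (I u) = J u"
proof -
  show "K (J u) = - I u" using IJ[of "J u"] by (simp add: square expand_linear)
  then show "J (K u) = I u" using JI[of "J u"] by (simp add: IJ)
  show IK: "I (K u) = - J u" using square(1)[of "J u"] by (simp add: IJ)
  show "K (I u) = J u" using IJ[of "I u"] by (simp add: JI expand_linear IK)
qed

definition imaginary :: "real \<Rightarrow> real \<Rightarrow> real \<Rightarrow> 'e \<Rightarrow> 'e" where
  "imaginary a b c u = a *\<^sub>R I u + b *\<^sub>R J u + c *\<^sub>R K u"

text \<open>The product of imaginary quaternions is minus the scalar product plus the vector product.\<close>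

lemma imaginary_compose:
  "imaginary a b c (imaginary a' b' c' u) =
    - ((a * a' + b * b' + c * c') *\<^sub>R u) + imaginary (b * c' - c * b') (c * a' - a * c') (a * b' - b * a') u"
  unfolding imaginary_def by (simp add: expand_linear square IJ JI products algebra_simps)

lemma skew: "g (I u) v = - g u (I v)" "g (J u) v = - g u (J v)" "g (K u) v = - g u (K v)"
  using isometric(1)[of u "I v"] isometric(2)[of u "J v"] isometric(3)[of u "K v"] by (simp_all add: square g_simps)

lemma hermitian_form_imaginary:
  assumes "a\<^sup>2 + b\<^sup>2 + c\<^sup>2 = 1"
  shows "hermitian_form g (imaginary a b c)"
proof (rule hermitian_form.intro[OF inner_form_axioms], rule hermitian_form_axioms.intro)
  show "linear (imaginary a b c)"
    by (rule linearI) (simp_all add: imaginary_def expand_linear algebra_simps)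
  have abc: "a * a + b * b + c * c = 1" using assms by (simp add: power2_eq_square)
  have sq: "imaginary a b c (imaginary a b c u) = - u" for u
    unfolding imaginary_compose abc by (simp add: imaginary_def mult.commute)
  then show "imaginary a b c (imaginary a b c x) = - x" for x .
  have "g (imaginary a b c u) v = - g u (imaginary a b c v)" for u v
    unfolding imaginary_def by (simp add: g_simps skew algebra_simps)
  then show "g (imaginary a b c x) (imaginary a b c y) = g x y" for x y
    by (simp add: sq g_simps)
qed

text \<open>Orthogonal imaginary quaternions anticommute, so a unit vector of \<open>\<real>\<^sup>3\<close> orthogonal to \<open>(a,b,c)\<close> will do.\<close>

lemma exists_anticommuting:
  assumes "a\<^sup>2 + b\<^sup>2 + c\<^sup>2 = 1"
  shows "\<exists>a' b' c'. a'\<^sup>2 + b'\<^sup>2 + c'\<^sup>2 = 1 \<and>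
    (\<forall>u. imaginary a b c (imaginary a' b' c' u) = - imaginary a' b' c' (imaginary a b c u))"
proof -
  have anti: "imaginary a b c (imaginary a' b' c' u) = - imaginary a' b' c' (imaginary a b c u)"
    if "a * a' + b * b' + c * c' = 0" for a' b' c' u
  proof -
    have "a' * a + b' * b + c' * c = 0" using that by (simp add: mult.commute)
    then show ?thesis unfolding imaginary_compose that by (simp add: imaginary_def algebra_simps)
  qed
  show ?thesis
  proof (cases "a = 0 \<and> b = 0")
    case True
    then show ?thesis using anti[of 1 0 0] by (intro exI[of _ 1] exI[of _ 0]) simp
  next
    case False
    define r where "r = sqrt (a\<^sup>2 + b\<^sup>2)"
    have r: "r\<^sup>2 = a\<^sup>2 + b\<^sup>2" "r \<noteq> 0" using False unfolding r_def by (auto simp: sum_power2_eq_zero_iff)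
    have "(- b / r)\<^sup>2 + (a / r)\<^sup>2 + 0\<^sup>2 = (a\<^sup>2 + b\<^sup>2) / r\<^sup>2"
      by (simp add: power_divide add_divide_distrib)
    then have "(- b / r)\<^sup>2 + (a / r)\<^sup>2 + 0\<^sup>2 = 1"
      unfolding r(1)[symmetric] using r(2) by simp
    moreover have "a * (- b / r) + b * (a / r) + c * 0 = 0" by simp
    ultimately show ?thesis using anti by blast
  qed
qed

end

section \<open>Positivity\<close>

text \<open>The factor 16 is \<open>4\<close> from the definition of \<open>r\<^sub>2\<close> times \<open>2! 2!\<close> from the wedge product.\<close>

lemma r2_form_eq_alternate:
  assumes "\<And>u v w z. Im (trace (\<Theta> p u v ** \<Theta> p w z)) = 0"
  shows "r2_form \<Theta> p = alternate 4 (\<lambda>v. complex_of_real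
     (1 / (16 * pi\<^sup>2) * - trace_form (\<Theta> p (v 0) (v 1)) (\<Theta> p (v 2) (v 3))))"
proof
  fix v
  have l: "linear (\<lambda>X::complex^'r^'r. complex_of_real (1 / (16 * pi\<^sup>2)) * trace X)"
    by (rule linearI) (simp_all add: trace_def sum.distrib distrib_left scaleR_sum_right[symmetric])
  have "r2_form \<Theta> p v = complex_of_real (1 / (16 * pi\<^sup>2)) *
      trace (alternate 4 (\<lambda>v. \<Theta> p (v 0) (v 1) ** \<Theta> p (v 2) (v 3)) v)"
    unfolding r2_form_def wedge_by_eq_alternate form2_def
    by (simp add: trace_scaleR del: One_nat_def) (simp add: scaleR_conv_of_real)
  also have "\<dots> = alternate 4 (\<lambda>v. complex_of_real (1 / (16 * pi\<^sup>2)) * trace (\<Theta> p (v 0) (v 1) ** \<Theta> p (v 2) (v 3))) v"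
    by (rule linear_alternate[OF l])
  also have "\<dots> = alternate 4 (\<lambda>v. complex_of_real
     (1 / (16 * pi\<^sup>2) * - trace_form (\<Theta> p (v 0) (v 1)) (\<Theta> p (v 2) (v 3)))) v"
    by (rule alternate_cong) (simp add: complex_eq_iff assms trace_form_def)
  finally show "r2_form \<Theta> p v = alternate 4 (\<lambda>v. complex_of_real
     (1 / (16 * pi\<^sup>2) * - trace_form (\<Theta> p (v 0) (v 1)) (\<Theta> p (v 2) (v 3)))) v" .
qed

text \<open>The pointwise form of the theorem, with \<open>m = n - 3\<close>. The form \<open>\<eta>\<close> is the real form \<open>\<zeta>\<close>, a positive
  multiple of the alternation of \<open>G\<close>. Since the rotations \<open>exp(tL)\<close> preserve both factors of \<open>G\<close>, it has type
  \<open>(m+2,m+2)\<close>; its values on the tuples \<open>u\<^sub>0,Lu\<^sub>0,\<dots>\<close> are nonnegative because those on unitary families are.\<close>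

lemma (in hermitian_form) r2_wedge_power_positive_at:
  fixes \<Theta> :: "'m \<Rightarrow> 'e \<Rightarrow> 'e \<Rightarrow> complex^'r::finite^'r" and h :: "complex^'r \<Rightarrow> complex^'r \<Rightarrow> complex"
  assumes dim: "DIM('e) = 2 * (m + 3)"
    and R: "hermitian_form g R" "\<And>u. L (R u) = - R (L u)"
    and h: "hermitian_product h"
    and \<Theta>: "\<And>v. linear (\<lambda>u. \<Theta> p u v)" "\<And>u v. \<Theta> p u v = - \<Theta> p v u"
    and skew: "\<And>u v. \<Theta> p u v \<in> hermitian_product.skew_hermitian h"
    and rotL: "\<And>t u v. \<Theta> p (cos t *\<^sub>R u + sin t *\<^sub>R L u) (cos t *\<^sub>R v + sin t *\<^sub>R L v) = \<Theta> p u v"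
    and invR: "\<And>u v. \<Theta> p (R u) (R v) = \<Theta> p u v"
  defines "\<eta> \<equiv> wedge 4 (2 * m) (r2_form \<Theta> p) (wedge_power_2form (form2 (\<lambda>u v. complex_of_real (g (L u) v))) m)"
  shows "real_form \<eta>" "pp_form L (m + 2) \<eta>"
    and "\<And>\<alpha>. (\<And>j. j < m + 2 \<Longrightarrow> type_10 L (\<alpha> j)) \<Longrightarrow>
      (- \<i>) ^ (m + 2) * complexify (2 * (m + 2)) \<eta>
        (\<lambda>j. if even j then \<alpha> (j div 2) else conj_vec (\<alpha> (j div 2))) \<in> \<real>\<^sub>\<ge>\<^sub>0"
proof -
  interpret h: hermitian_product h by (rule h)
  have deg: "2 * (m + 2) = 4 + 2 * m" by simp
  \<comment> \<open>\<open>exp(tL) = L\<close> for \<open>t = \<pi>/2\<close>.\<close>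
  have invL: "\<Theta> p (L u) (L v) = \<Theta> p u v" for u v using rotL[of "pi / 2" u v] by simp
  have \<Theta>bil: "bilinear (\<Theta> p)"
  proof -
    have eq: "\<Theta> p u = (\<lambda>v. - \<Theta> p v u)" for u by (rule ext) (rule \<Theta>(2))
    have "linear (\<Theta> p u)" for u by (subst eq) (rule linear_compose_neg[OF \<Theta>(1)])
    then show ?thesis using \<Theta>(1) unfolding bilinear_def by blast
  qed
  define \<omega> where "\<omega> = (\<lambda>u v. g (L u) v)"
  have \<omega>bil: "bilinear \<omega>"
    unfolding \<omega>_def bilinear_def using lin linear_compose[OF linear_L lin(1)] by (auto simp: o_def)
  define F where "F = (\<lambda>v::nat \<Rightarrow> 'e. - trace_form (\<Theta> p (v 0) (v 1)) (\<Theta> p (v 2) (v 3)))"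
  define G where "G = (\<lambda>v. F v * (\<Prod>k<m. \<omega> (v (4 + 2 * k)) (v (4 + 2 * k + 1))))"
  define C where "C = 1 / (16 * pi\<^sup>2) * (1 / 2 ^ m)"
  define \<zeta> where "\<zeta> = (\<lambda>v. C * alternate (4 + 2 * m) G v)"
  let ?c = "\<lambda>v. complex_of_real (\<zeta> v)"
  have eq: "\<eta> = ?c"
  proof
    fix v
    have r2: "r2_form \<Theta> p = alternate 4 (\<lambda>v. complex_of_real (1 / (16 * pi\<^sup>2) * F v))"
      unfolding F_def by (rule r2_form_eq_alternate) (rule h.trace_skew_hermitian_product_real[OF skew skew])
    have "\<eta> v = (1 / 2 ^ m) *\<^sub>R alternate (4 + 2 * m)
        (\<lambda>v. complex_of_real (1 / (16 * pi\<^sup>2) * F v) *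
          (\<Prod>k<m. complex_of_real (g (L (v (4 + 2 * k))) (v (4 + 2 * k + 1))))) v"
      unfolding \<eta>_def r2 by (rule wedge_4form_power_eq_alternate) (simp add: F_def)
    also have "\<dots> = (1 / 2 ^ m) *\<^sub>R alternate (4 + 2 * m) (\<lambda>v. complex_of_real (1 / (16 * pi\<^sup>2) * G v)) v"
      by (intro arg_cong[of _ _ "\<lambda>x. (1 / 2 ^ m) *\<^sub>R x"] alternate_cong)
         (simp add: G_def \<omega>_def of_real_prod)
    also have "\<dots> = complex_of_real (\<zeta> v)"
    proof -
      have l: "linear (\<lambda>r. complex_of_real (1 / (16 * pi\<^sup>2) * r))"
        by (rule linearI) (simp_all add: distrib_left scaleR_conv_of_real)
      show ?thesis unfolding linear_alternate[OF l, symmetric] \<zeta>_def C_def by (simp add: scaleR_conv_of_real)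
    qed
    finally show "\<eta> v = ?c v" .
  qed
  have loc4: "depends_on_first 4 F" unfolding depends_on_first_def F_def by simp
  have mlG: "multilinear (4 + 2 * m) G" "depends_on_first (4 + 2 * m) G"
    using multilinear_times_power[OF multilinear_curvature_product[OF \<Theta>bil bilinear_trace_form, folded F_def] loc4 \<omega>bil, of m]
    unfolding G_def by auto
  have alt: "alternating (4 + 2 * m) \<zeta>"
    unfolding \<zeta>_def by (rule alternating_linear_image[OF alternating_alternate[OF mlG(1)] linear_times])
  have loc: "depends_on_first (4 + 2 * m) \<zeta>"
    unfolding \<zeta>_def by (rule depends_on_first_image[OF depends_on_first_alternate[OF mlG(2)]])
  have "linear complex_of_real" by (rule linearI) (simp_all add: scaleR_conv_of_real)
  then have altc: "alternating (2 * (m + 2)) ?c" unfolding deg by (rule alternating_linear_image[OF alt])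
  have locc: "depends_on_first (2 * (m + 2)) ?c" unfolding deg by (rule depends_on_first_image[OF loc])
  have rot: "?c (\<lambda>j. cos t *\<^sub>R v j + sin t *\<^sub>R L (v j)) = ?c v" for t v
  proof -
    have \<omega>rot: "\<omega> (cos t *\<^sub>R u + sin t *\<^sub>R L u) (cos t *\<^sub>R v + sin t *\<^sub>R L v) = \<omega> u v" for u v
    proof -
      have "\<omega> (r *\<^sub>R u + s *\<^sub>R L u) (r *\<^sub>R v + s *\<^sub>R L v) = (r\<^sup>2 + s\<^sup>2) * \<omega> u v" for r s
        unfolding \<omega>_def
        by (simp add: linear_add[OF linear_L] linear_scale[OF linear_L] L_L g_simps g_L g_L_left[of u v] power2_eq_square algebra_simps)
      from this[of "cos t" "sin t"] show ?thesis by simp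
    qed
    have "G (\<lambda>j. cos t *\<^sub>R v j + sin t *\<^sub>R L (v j)) = G v" for v
      unfolding G_def F_def rotL \<omega>rot ..
    then have "alternate (4 + 2 * m) G (\<lambda>j. cos t *\<^sub>R v j + sin t *\<^sub>R L (v j)) = alternate (4 + 2 * m) G v"
      unfolding alternate_def by simp
    then show ?thesis by (simp add: \<zeta>_def)
  qed
  have pos: "\<zeta> (doubled L u) \<ge> 0" for u
  proof (rule nonneg_on_frames_imp_nonneg[of "m + 2"])
    show "alternating (2 * (m + 2)) \<zeta>" unfolding deg by (rule alt)
    fix e assume e: "unitary (m + 2) e"
    have psd: "trace_form X X \<ge> 0" if "X \<in> h.skew_hermitian" for X
      using h.trace_skew_hermitian_square[OF that] by (simp add: trace_form_def)
    have "alternate (4 + 2 * m) G (doubled L e) \<ge> 0"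
      unfolding G_def F_def \<omega>_def
      by (rule alternate_power_nonneg_on_unitary[where R = R and \<Theta> = "\<Theta> p" and S = h.skew_hermitian])
         (rule R \<Theta> invL invR bilinear_trace_form trace_form_commute h.subspace_skew_hermitian psd skew e dim; assumption?)+
    then show "\<zeta> (doubled L e) \<ge> 0" by (simp add: \<zeta>_def C_def)
  qed
  show "real_form \<eta>" unfolding eq by (simp add: real_form_def)
  show "pp_form L (m + 2) \<eta>" unfolding eq
    by (rule pp_form_rotation_invariant[OF _ locc linear_L rot]) (use altc in \<open>simp add: alternating_def\<close>)
  fix \<alpha> :: "nat \<Rightarrow> 'e \<times> 'e"
  assume \<alpha>: "\<And>j. j < m + 2 \<Longrightarrow> type_10 L (\<alpha> j)"
  let ?u = "doubled L (\<lambda>j. fst (\<alpha> j))"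
  have "(- \<i>) ^ (m + 2) * complexify (2 * (m + 2)) ?c (\<lambda>j. if even j then \<alpha> (j div 2) else conj_vec (\<alpha> (j div 2)))
      = ((- \<i>) * (2 * \<i>)) ^ (m + 2) * ?c ?u"
    using complexify_conjugate_pairs[OF altc locc, of L \<alpha>] \<alpha> by (simp only: power_mult_distrib mult.assoc)
  also have "(- \<i>) * (2 * \<i>) = 2" by (simp add: complex_eq_iff)
  also have "2 ^ (m + 2) * ?c ?u = complex_of_real (2 ^ (m + 2) * \<zeta> ?u)" by simp
  also have "\<dots> \<in> \<real>\<^sub>\<ge>\<^sub>0" using pos[of "\<lambda>j. fst (\<alpha> j)"] by (simp only: nonneg_Reals_of_real_iff) simp
  finally show "(- \<i>) ^ (m + 2) * complexify (2 * (m + 2)) \<eta>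
      (\<lambda>j. if even j then \<alpha> (j div 2) else conj_vec (\<alpha> (j div 2))) \<in> \<real>\<^sub>\<ge>\<^sub>0" unfolding eq .
qed

theorem lemma5p4:
  fixes M :: "('m, complex^'n::finite) manifold"
    and g :: "'m \<Rightarrow> complex^'n \<Rightarrow> complex^'n \<Rightarrow> real"
    and I J K L :: "'m \<Rightarrow> complex^'n \<Rightarrow> complex^'n"
    and T :: "('m, 'r::finite) trivialization set"
    and h :: "'m \<Rightarrow> complex^'r \<Rightarrow> complex^'r \<Rightarrow> complex"
    and nabla :: "('m, complex^'n, 'r) connection"
    and \<Theta> :: "'m \<Rightarrow> complex^'n \<Rightarrow> complex^'n \<Rightarrow> complex^'r^'r"
  assumes "hyperkaehler M g I J K"
    and "CARD('n) > 2"
    and "induced_complex_structure I J K L"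
    and "holomorphic_vector_bundle M L T"
    and "hermitian_metric M T h"
    and "hyperholomorphic_connection M I J K T h nabla"
    and "compatible_with_holomorphic_structure M L T nabla"
    and "curvature_form M T nabla \<Theta>"
  shows "positive_form M L (CARD('n) - 1)
    (\<lambda>p. wedge 4 (2 * (CARD('n) - 3)) (r2_form \<Theta> p)
       (wedge_power_2form (form2 (\<lambda>u v. complex_of_real (kaehler_form g L p u v))) (CARD('n) - 3)))"
  unfolding positive_form_def
proof (rule ballI)
  fix p assume p: "p \<in> topspace (topo M)"
  have hk: "smooth_manifold M" "kaehler M g I" "kaehler M g J" "kaehler M g K"
    "\<And>u. I p (J p u) = K p u \<and> J p (I p u) = - K p u"
    using assms(1) p unfolding hyperkaehler_def by blast+
  obtain a b c where abc: "a\<^sup>2 + b\<^sup>2 + c\<^sup>2 = 1" "L = quaternion_action I J K 0 a b c"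
    using assms(3) unfolding induced_complex_structure_def by blast
  have herm: "hermitian_connection M T h nabla" and su2: "su2_invariant_2form M I J K \<Theta>"
    using assms(6,8) unfolding hyperholomorphic_connection_def by blast+
  have conn: "connection M T nabla" using herm unfolding hermitian_connection_def by blast
  define m where "m = CARD('n) - 3"
  have m: "CARD('n) = m + 3" using assms(2) by (simp add: m_def)
  have deg: "CARD('n) - 1 = m + 2" "CARD('n) - 3 = m" by (simp_all add: m)
  have kp: "linear (A p) \<and> (\<forall>u. A p (A p u) = - u) \<and> (\<forall>u v. g p (A p u) (A p v) = g p u v)" if "kaehler M g A" for A
    using that p unfolding kaehler_def complex_structure_def almost_complex_structure_def by blast
  have gp: "bilinear (g p)" "\<And>u v. g p u v = g p v u" "\<And>u. u \<noteq> 0 \<Longrightarrow> g p u u > 0"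
    using hk(2) p unfolding kaehler_def riemannian_metric_def by blast+
  interpret quaternionic_form "g p" "I p" "J p" "K p"
    using gp kp[OF hk(2)] kp[OF hk(3)] kp[OF hk(4)] hk(5)
    by (simp add: quaternionic_form_def quaternionic_form_axioms_def inner_form_def)
  have L: "L p = imaginary a b c" by (simp add: abc(2) fun_eq_iff quaternion_action_def imaginary_def)
  obtain a' b' c' where R: "a'\<^sup>2 + b'\<^sup>2 + c'\<^sup>2 = 1"
      "\<And>u. imaginary a b c (imaginary a' b' c' u) = - imaginary a' b' c' (imaginary a b c u)"
    using exists_anticommuting[OF abc(1)] by blast
  interpret L: hermitian_form "g p" "L p" unfolding L by (rule hermitian_form_imaginary[OF abc(1)])
  have inv: "\<Theta> p (t *\<^sub>R u + imaginary a b c u) (t *\<^sub>R v + imaginary a b c v) = \<Theta> p u v"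
    if "t\<^sup>2 + a\<^sup>2 + b\<^sup>2 + c\<^sup>2 = 1" for t a b c u v
  proof -
    have "quaternion_action I J K t a b c p w = t *\<^sub>R w + imaginary a b c w" for w
      by (simp add: quaternion_action_def imaginary_def)
    then show ?thesis using su2 p that unfolding su2_invariant_2form_def by metis
  qed
  have rotL: "\<Theta> p (cos t *\<^sub>R u + sin t *\<^sub>R L p u) (cos t *\<^sub>R v + sin t *\<^sub>R L p v) = \<Theta> p u v" for t u v
  proof -
    have "(cos t)\<^sup>2 + (sin t * a)\<^sup>2 + (sin t * b)\<^sup>2 + (sin t * c)\<^sup>2 = (cos t)\<^sup>2 + (sin t)\<^sup>2 * (a\<^sup>2 + b\<^sup>2 + c\<^sup>2)"
      by (simp add: power_mult_distrib algebra_simps)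
    then have "(cos t)\<^sup>2 + (sin t * a)\<^sup>2 + (sin t * b)\<^sup>2 + (sin t * c)\<^sup>2 = 1" using abc(1) by simp
    from inv[OF this, of u v] show ?thesis by (simp add: L imaginary_def scaleR_add_right)
  qed
  have invR: "\<Theta> p (imaginary a' b' c' u) (imaginary a' b' c' v) = \<Theta> p u v" for u v
    using inv[of 0 a' b' c' u v] R(1) by simp
  have LR: "L p (imaginary a' b' c' u) = - imaginary a' b' c' (L p u)" for u unfolding L by (rule R(2))
  interpret h: hermitian_product "h p"
    using assms(5) p unfolding hermitian_metric_def by unfold_locales blast+
  have skew: "\<Theta> p u v \<in> h.skew_hermitian" for u v
    unfolding h.skew_hermitian_def
    using curvature_skew_hermitian[OF hk(1) assms(4) conn assms(8) assms(5) herm p] by blast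
  have dim: "DIM(complex^'n) = 2 * (m + 3)" by (simp add: m)
  note positive = L.r2_wedge_power_positive_at[where \<Theta> = \<Theta> and p = p and m = m, OF dim hermitian_form_imaginary[OF R(1)] LR
      h.hermitian_product_axioms curvature_linear[OF hk(1) assms(4) conn assms(8) p]
      curvature_antisymmetric[OF hk(1) assms(4) conn assms(8) p] skew rotL invR]
  show "real_form (wedge 4 (2 * (CARD('n) - 3)) (r2_form \<Theta> p)
        (wedge_power_2form (form2 (\<lambda>u v. complex_of_real (kaehler_form g L p u v))) (CARD('n) - 3))) \<and>
      pp_form (L p) (CARD('n) - 1) (wedge 4 (2 * (CARD('n) - 3)) (r2_form \<Theta> p)
        (wedge_power_2form (form2 (\<lambda>u v. complex_of_real (kaehler_form g L p u v))) (CARD('n) - 3))) \<and>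
      (\<forall>\<alpha>. (\<forall>j<CARD('n) - 1. type_10 (L p) (\<alpha> j)) \<longrightarrow>
         (- \<i>) ^ (CARD('n) - 1) * complexify (2 * (CARD('n) - 1)) (wedge 4 (2 * (CARD('n) - 3)) (r2_form \<Theta> p)
        (wedge_power_2form (form2 (\<lambda>u v. complex_of_real (kaehler_form g L p u v))) (CARD('n) - 3)))
            (\<lambda>j. if even j then \<alpha> (j div 2) else conj_vec (\<alpha> (j div 2))) \<in> \<real>\<^sub>\<ge>\<^sub>0)"
    unfolding deg kaehler_form_def using positive by blast
qed

end
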